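(* Let $\kappa\colon\mathbb R^d\to(0,\infty)$ be bounded and continuous with $\sup_{x\in\mathbb R^d}\sup_{|y|\le1}\frac{\kappa(x)}{\kappa(x-y)}<\infty$, and let $(h_n)_{n\in\mathbb N}\subset(0,\infty)$ with $h_n\to0$. Let $(I(t))_{t\ge0}$ and $(J(t))_{t\ge0}$ be two families of operators on $C_\kappa$, each satisfying Assumption (A) stated in the context (with respect to $(h_n)$), with $$I'(0)f\le J'(0)f\quad\text{for all }f\in C_b^\infty.$$ Let $(S(t))_{t\ge0}$ and $(T(t))_{t\ge0}$ be the strongly continuous convex monotone semigroups on $C_\kappa$ associated with $(I(t))_{t\ge0}$ and $(J(t))_{t\ge0}$, respectively. Then $S(t)f\le T(t)f$ for all $t\ge0$ and $f\in C_\kappa$.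
   Context: $\|f\|_\kappa:=\sup_{x}|f(x)|\kappa(x)$, $\|f\|_{\infty,K}:=\sup_{x\in K}|f(x)|$. $C_\kappa$ is the space of continuous $f\colon\mathbb R^d\to\mathbb R$ with $\|f\|_\kappa<\infty$, ordered pointwise; $B_{C_\kappa}(r)=\{f\in C_\kappa:\|f\|_\kappa\le r\}$. Convergence $f_n\to f$ in $C_\kappa$ (mixed topology) means $\sup_n\|f_n\|_\kappa<\infty$ and $\|f_n-f\|_{\infty,K}\to0$ for every compact $K$; all limits in $C_\kappa$ are of this type, and limits as $h\downarrow0$ are along all sequences. $\mathrm{Lip}_b(r)$ is the set of $r$-Lipschitz $f\colon\mathbb R^d\to\mathbb R$ with $\|f\|_\infty\le r$. $C_b^\infty$ is the space of bounded infinitely differentiable functions with bounded partial derivatives of all orders. $(\tau_xf)(y):=f(x+y)$. $I'(0)f:=\lim_{h\downarrow0}\frac{I(h)f-f}{h}\in C_\kappa$ if the limit exists. $k_n^t:=\max\{k\in\mathbb N_0:kh_n\le t\}$, $I(\pi_n^t)f:=I(h_n)^{k_n^t}f$. Assumption (A) for a family of operators $I(t)\colon C_\kappa\to C_\kappa$, $t\ge0$: (i) $I(0)=\mathrm{id}_{C_\kappa}$. (ii) $I(h_n)$ is convex and monotone with $I(h_n)0=0$ for all $n$. (iii) There is $\omega\ge0$ with $\|I(h_n)f\|_\kappa\le e^{\omega h_n}\|f\|_\kappa$ for all $f\in C_\kappa$, $n\in\mathbb N$. (iv) For every $r\ge0$ there is $\omega_r\ge0$ with $\|I(h_n)f-I(h_n)g\|_\kappa\le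 e^{h_n\omega_r}\|f-g\|_\kappa$ for all $n$ and $f,g\in B_{C_\kappa}(r)$, and $r\mapsto\omega_r$ is non-decreasing. (v) For every $\varepsilon>0$ there are $\delta>0$, $n_0\in\mathbb N$ with $I(h_n)(\tau_xf)\le\tau_xI(h_n)f+\frac{r\varepsilon h_n}{\kappa}$ for all $r\ge0$, $f\in\mathrm{Lip}_b(r)$, $|x|\le\delta$ and $n\ge n_0$. (vi) The limit $I'(0)f\in C_\kappa$ exists for all $f\in C_b^\infty$. (vii) For every $\varepsilon>0$, $r,T\ge0$ and compact $K\subset\mathbb R^d$ there are a compact $K'\subset\mathbb R^d$ and $c\ge0$ with $\|I(\pi_n^t)f-I(\pi_n^t)g\|_{\infty,K}\le c\|f-g\|_{\infty,K'}+\varepsilon$ for all $t\in[0,T]$, $n\in\mathbb N$, $f,g\in B_{C_\kappa}(r)$. (viii) There is $c\ge0$ with $I(h_n)\colon\mathrm{Lip}_b(r)\to\mathrm{Lip}_b(e^{ch_n}r)$ for all $r\ge0$, $n\in\mathbb N$. A convex monotone semigroup on $C_\kappa$ is a family of operators $S(t)\colon C_\kappa\to C_\kappa$, $t\ge0$, such that: (S1) each $S(t)$ is convex and monotone, and $S(t)f_n\downarrow0$ pointwise whenever $(f_n)\subset C_\kappa$ decreases pointwise to $0$; (S2) $S(0)f=f$ and $S(s+t)f=S(s)S(t)f$; (S3) $\sup_{t\in[0,T]}\|S(t)\frac r\kappa\|_\kappa<\infty$ for all $r,T\ge0$; (S4) $\limsup_n(S(s_n)f)(x_n)\le(S(t)f)(x)$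 for all $f\in C_\kappa$, $0\le s_n\to t$, $x_n\to x$. It is strongly continuous if $\lim_{t\to0}S(t)f=f$ for all $f\in C_\kappa$. A strongly continuous convex monotone semigroup $(S(t))$ is associated with $(I(t))$ if there are a countable dense set $\mathcal T\subset[0,\infty)$ with $0\in\mathcal T$ and a subsequence $(n_l)\subset\mathbb N$ with $S(t)f=\lim_{l\to\infty}I(\pi_{n_l}^t)f$ for all $(f,t)\in C_\kappa\times\mathcal T$. Under Assumption (A) such a semigroup exists. *)

theory Defs
  imports "HOL-Analysis.Analysis"
begin

text \<open>
  The space \<open>\<real>\<^sup>d\<close> is rendered by an arbitrary type of class \<open>euclidean_space\<close>. Operators on
  \<open>C\<^sub>\<kappa>\<close> are total functions on \<open>'a \<Rightarrow> real\<close> of which only the values on the carrier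
  \<open>Ckappa \<kappa>\<close> matter; likewise, time indices are reals of which only the nonnegative ones matter.
\<close>

definition weight :: "('a::euclidean_space \<Rightarrow> real) \<Rightarrow> bool" where
  "weight \<kappa> \<longleftrightarrow>
     (\<forall>x. 0 < \<kappa> x) \<and> bounded (range \<kappa>) \<and> continuous_on UNIV \<kappa> \<and>
     bdd_above {\<kappa> x / \<kappa> (x - y) | x y. norm y \<le> 1}"

definition Ckappa :: "('a::euclidean_space \<Rightarrow> real) \<Rightarrow> ('a \<Rightarrow> real) set" where
  "Ckappa \<kappa> = {f. continuous_on UNIV f \<and> bdd_above (range (\<lambda>x. \<bar>f x\<bar> * \<kappa> x))}"

text \<open>The real-valued supremum below is only meaningful for functions in \<open>Ckappa \<kappa>\<close>.\<close>

definition knorm :: "('a::euclidean_space \<Rightarrow> real) \<Rightarrow> ('a \<Rightarrow> real) \<Rightarrow> real" where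
  "knorm \<kappa> f = (SUP x. \<bar>f x\<bar> * \<kappa> x)"

text \<open>
  Inserting \<open>0\<close> changes the supremum only for \<open>K = {}\<close>, where it fixes the value \<open>0\<close>
  (\<open>Sup {}\<close> is unspecified on the reals).
\<close>

definition snorm_on :: "'a::euclidean_space set \<Rightarrow> ('a \<Rightarrow> real) \<Rightarrow> real" where
  "snorm_on K f = Sup (insert 0 ((\<lambda>x. \<bar>f x\<bar>) ` K))"

definition Ckappa_ball :: "('a::euclidean_space \<Rightarrow> real) \<Rightarrow> real \<Rightarrow> ('a \<Rightarrow> real) set" where
  "Ckappa_ball \<kappa> r = {f \<in> Ckappa \<kappa>. knorm \<kappa> f \<le> r}"

text \<open>Convergence of sequences in the mixed topology on \<open>C\<^sub>\<kappa>\<close>.\<close>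

definition mixed_conv ::
  "('a::euclidean_space \<Rightarrow> real) \<Rightarrow> (nat \<Rightarrow> 'a \<Rightarrow> real) \<Rightarrow> ('a \<Rightarrow> real) \<Rightarrow> bool" where
  "mixed_conv \<kappa> F f \<longleftrightarrow>
     (\<forall>n. F n \<in> Ckappa \<kappa>) \<and> f \<in> Ckappa \<kappa> \<and>
     bdd_above (range (\<lambda>n. knorm \<kappa> (F n))) \<and>
     (\<forall>K. compact K \<longrightarrow> (\<lambda>n. snorm_on K (\<lambda>x. F n x - f x)) \<longlonglongrightarrow> 0)"

text \<open>Limits in \<open>C\<^sub>\<kappa>\<close> as \<open>h \<down> 0\<close> are taken along all sequences.\<close>

definition mixed_lim_zero ::
  "('a::euclidean_space \<Rightarrow> real) \<Rightarrow> (real \<Rightarrow> 'a \<Rightarrow> real) \<Rightarrow> ('a \<Rightarrow> real) \<Rightarrow> bool" where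
  "mixed_lim_zero \<kappa> F f \<longleftrightarrow>
     (\<forall>s::nat \<Rightarrow> real. (\<forall>n. 0 < s n) \<and> s \<longlonglongrightarrow> 0 \<longrightarrow> mixed_conv \<kappa> (\<lambda>n. F (s n)) f)"

definition Lip_b :: "real \<Rightarrow> ('a::euclidean_space \<Rightarrow> real) set" where
  "Lip_b r = {f. r-lipschitz_on UNIV f \<and> (\<forall>x. \<bar>f x\<bar> \<le> r)}"

text \<open>Iterated partial derivatives along a list of coordinate directions.\<close>

primrec partials :: "'a list \<Rightarrow> ('a::euclidean_space \<Rightarrow> real) \<Rightarrow> 'a \<Rightarrow> real" where
  "partials [] f = f"
| "partials (b # bs) f = (\<lambda>x. frechet_derivative (partials bs f) (at x) b)"

text \<open>The empty list covers \<open>f\<close> itself, i.e. that \<open>f\<close> is bounded.\<close>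

definition Cb_infty :: "('a::euclidean_space \<Rightarrow> real) set" where
  "Cb_infty = {f. \<forall>bs. set bs \<subseteq> Basis \<longrightarrow>
     (\<forall>x. partials bs f differentiable (at x)) \<and> bounded (range (partials bs f))}"

definition shift :: "'a::euclidean_space \<Rightarrow> ('a \<Rightarrow> real) \<Rightarrow> 'a \<Rightarrow> real" where
  "shift x f = (\<lambda>y. f (x + y))"

type_synonym 'a operators = "real \<Rightarrow> ('a \<Rightarrow> real) \<Rightarrow> ('a \<Rightarrow> real)"

definition convex_op ::
  "('a::euclidean_space \<Rightarrow> real) \<Rightarrow> (('a \<Rightarrow> real) \<Rightarrow> ('a \<Rightarrow> real)) \<Rightarrow> bool" where
  "convex_op \<kappa> A \<longleftrightarrow>
     (\<forall>f\<in>Ckappa \<kappa>. \<forall>g\<in>Ckappa \<kappa>. \<forall>l\<in>{0..1::real}.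
        A (\<lambda>x. l * f x + (1 - l) * g x) \<le> (\<lambda>x. l * A f x + (1 - l) * A g x))"

definition monotone_op ::
  "('a::euclidean_space \<Rightarrow> real) \<Rightarrow> (('a \<Rightarrow> real) \<Rightarrow> ('a \<Rightarrow> real)) \<Rightarrow> bool" where
  "monotone_op \<kappa> A \<longleftrightarrow> (\<forall>f\<in>Ckappa \<kappa>. \<forall>g\<in>Ckappa \<kappa>. f \<le> g \<longrightarrow> A f \<le> A g)"

text \<open>\<open>deriv0 \<kappa> I f\<close> is \<open>I'(0)f\<close>; it is specified only when the limit exists.\<close>

definition has_deriv0 ::
  "('a::euclidean_space \<Rightarrow> real) \<Rightarrow> 'a operators \<Rightarrow> ('a \<Rightarrow> real) \<Rightarrow> ('a \<Rightarrow> real) \<Rightarrow> bool" where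
  "has_deriv0 \<kappa> I f g \<longleftrightarrow> mixed_lim_zero \<kappa> (\<lambda>h x. (I h f x - f x) / h) g"

definition deriv0 ::
  "('a::euclidean_space \<Rightarrow> real) \<Rightarrow> 'a operators \<Rightarrow> ('a \<Rightarrow> real) \<Rightarrow> ('a \<Rightarrow> real)" where
  "deriv0 \<kappa> I f = (THE g. has_deriv0 \<kappa> I f g)"

lemma mixed_conv_pointwise:
  assumes "mixed_conv \<kappa> F f"
  shows "(\<lambda>n. F n x) \<longlonglongrightarrow> f x"
proof -
  have eq: "snorm_on {x} g = \<bar>g x\<bar>" for g :: "'a \<Rightarrow> real"
    by (simp add: snorm_on_def cSup_eq_Max)
  have "\<forall>K. compact K \<longrightarrow> (\<lambda>n. snorm_on K (\<lambda>x. F n x - f x)) \<longlonglongrightarrow> 0"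
    using assms unfolding mixed_conv_def by (elim conjE)
  from this[rule_format, OF compact_sing[of x]]
  have "(\<lambda>n. F n x - f x) \<longlonglongrightarrow> 0"
    unfolding eq by (rule tendsto_rabs_zero_cancel)
  then show ?thesis
    by (rule LIM_zero_cancel)
qed

lemma deriv0_eq:
  assumes "has_deriv0 \<kappa> I f g"
  shows "deriv0 \<kappa> I f = g"
  unfolding deriv0_def
proof (rule the_equality)
  show "has_deriv0 \<kappa> I f g" by (rule assms)
next
  fix g'
  assume g': "has_deriv0 \<kappa> I f g'"
  define s where "s n = inverse (real (Suc n))" for n
  have s: "\<forall>n. 0 < s n" "s \<longlonglongrightarrow> 0"
    using LIMSEQ_inverse_real_of_nat by (auto simp: s_def[abs_def])
  show "g' = g"
  proof
    fix x
    have "mixed_conv \<kappa> (\<lambda>n x. (I (s n) f x - f x) / s n) k" if "has_deriv0 \<kappa> I f k" for k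
      using that[unfolded has_deriv0_def mixed_lim_zero_def, THEN spec, THEN mp, OF conjI, OF s] .
    from this[OF g'] this[OF assms] show "g' x = g x"
      by (rule LIMSEQ_unique[OF mixed_conv_pointwise mixed_conv_pointwise])
  qed
qed

definition steps :: "(nat \<Rightarrow> real) \<Rightarrow> nat \<Rightarrow> real \<Rightarrow> nat" where
  "steps h n t = Max {k::nat. real k * h n \<le> t}"

definition iterate ::
  "(nat \<Rightarrow> real) \<Rightarrow> 'a operators \<Rightarrow> nat \<Rightarrow> real \<Rightarrow> ('a \<Rightarrow> real) \<Rightarrow> ('a \<Rightarrow> real)" where
  "iterate h I n t f = (I (h n) ^^ steps h n t) f"

text \<open>Assumption (A), including that each \<open>I(t)\<close> maps \<open>C\<^sub>\<kappa>\<close> into itself.\<close>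

locale assumption_A =
  fixes \<kappa> :: "'a::euclidean_space \<Rightarrow> real"
    and h :: "nat \<Rightarrow> real"
    and I :: "'a operators"
  assumes maps: "\<And>t f. 0 \<le> t \<Longrightarrow> f \<in> Ckappa \<kappa> \<Longrightarrow> I t f \<in> Ckappa \<kappa>"
    and i: "\<And>f. f \<in> Ckappa \<kappa> \<Longrightarrow> I 0 f = f"
    and ii: "\<And>n. convex_op \<kappa> (I (h n)) \<and> monotone_op \<kappa> (I (h n)) \<and> I (h n) (\<lambda>x. 0) = (\<lambda>x. 0)"
    and iii: "\<exists>\<omega>\<ge>0. \<forall>f\<in>Ckappa \<kappa>. \<forall>n. knorm \<kappa> (I (h n) f) \<le> exp (\<omega> * h n) * knorm \<kappa> f"
    and iv: "\<exists>\<omega>::real \<Rightarrow> real. mono_on {0..} \<omega> \<and>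
      (\<forall>r\<ge>0. \<omega> r \<ge> 0 \<and>
        (\<forall>n. \<forall>f\<in>Ckappa_ball \<kappa> r. \<forall>g\<in>Ckappa_ball \<kappa> r.
           knorm \<kappa> (\<lambda>x. I (h n) f x - I (h n) g x)
             \<le> exp (h n * \<omega> r) * knorm \<kappa> (\<lambda>x. f x - g x)))"
    and v: "\<forall>\<epsilon>>0. \<exists>\<delta>>0. \<exists>n0. \<forall>r\<ge>0. \<forall>f\<in>Lip_b r. \<forall>x. norm x \<le> \<delta> \<longrightarrow> (\<forall>n\<ge>n0.
      I (h n) (shift x f) \<le> (\<lambda>y. shift x (I (h n) f) y + r * \<epsilon> * h n / \<kappa> y))"
    and vi: "\<forall>f\<in>Cb_infty. \<exists>g. has_deriv0 \<kappa> I f g"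
    and vii: "\<forall>\<epsilon>>0. \<forall>r\<ge>0. \<forall>T\<ge>0. \<forall>K. compact K \<longrightarrow> (\<exists>K' c. compact K' \<and> c \<ge> 0 \<and>
      (\<forall>t\<in>{0..T}. \<forall>n. \<forall>f\<in>Ckappa_ball \<kappa> r. \<forall>g\<in>Ckappa_ball \<kappa> r.
         snorm_on K (\<lambda>x. iterate h I n t f x - iterate h I n t g x)
           \<le> c * snorm_on K' (\<lambda>x. f x - g x) + \<epsilon>))"
    and viii: "\<exists>c\<ge>0. \<forall>r\<ge>0. \<forall>n. \<forall>f\<in>Lip_b r. I (h n) f \<in> Lip_b (exp (c * h n) * r)"

definition decreases_to_zero :: "(nat \<Rightarrow> 'a \<Rightarrow> real) \<Rightarrow> bool" where
  "decreases_to_zero F \<longleftrightarrow> decseq F \<and> (\<forall>x. (\<lambda>n. F n x) \<longlonglongrightarrow> 0)"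

locale convex_monotone_semigroup =
  fixes \<kappa> :: "'a::euclidean_space \<Rightarrow> real"
    and S :: "'a operators"
  assumes maps: "\<And>t f. 0 \<le> t \<Longrightarrow> f \<in> Ckappa \<kappa> \<Longrightarrow> S t f \<in> Ckappa \<kappa>"
    and S1: "\<And>t. 0 \<le> t \<Longrightarrow> convex_op \<kappa> (S t) \<and> monotone_op \<kappa> (S t)"
    and S1_cont: "\<And>t F. 0 \<le> t \<Longrightarrow> (\<And>n. F n \<in> Ckappa \<kappa>) \<Longrightarrow> decreases_to_zero F
      \<Longrightarrow> decreases_to_zero (\<lambda>n. S t (F n))"
    and S2_zero: "\<And>f. f \<in> Ckappa \<kappa> \<Longrightarrow> S 0 f = f"
    and S2_add: "\<And>s t f. 0 \<le> s \<Longrightarrow> 0 \<le> t \<Longrightarrow> f \<in> Ckappa \<kappa> \<Longrightarrow> S (s + t) f = S s (S t f)"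
    and S3: "\<And>r T. 0 \<le> r \<Longrightarrow> 0 \<le> T \<Longrightarrow> bdd_above ((\<lambda>t. knorm \<kappa> (S t (\<lambda>x. r / \<kappa> x))) ` {0..T})"
    and S4: "\<And>f s t X x. f \<in> Ckappa \<kappa> \<Longrightarrow> (\<And>n::nat. 0 \<le> s n) \<Longrightarrow> s \<longlonglongrightarrow> t \<Longrightarrow> X \<longlonglongrightarrow> x
      \<Longrightarrow> limsup (\<lambda>n. ereal (S (s n) f (X n))) \<le> ereal (S t f x)"

definition strongly_continuous :: "('a::euclidean_space \<Rightarrow> real) \<Rightarrow> 'a operators \<Rightarrow> bool" where
  "strongly_continuous \<kappa> S \<longleftrightarrow> (\<forall>f\<in>Ckappa \<kappa>. mixed_lim_zero \<kappa> (\<lambda>t. S t f) f)"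

definition associated ::
  "('a::euclidean_space \<Rightarrow> real) \<Rightarrow> (nat \<Rightarrow> real) \<Rightarrow> 'a operators \<Rightarrow> 'a operators \<Rightarrow> bool" where
  "associated \<kappa> h I S \<longleftrightarrow>
     convex_monotone_semigroup \<kappa> S \<and> strongly_continuous \<kappa> S \<and>
     (\<exists>D \<phi>. countable D \<and> D \<subseteq> {0..} \<and> {0..} \<subseteq> closure D \<and> 0 \<in> D \<and> strict_mono (\<phi> :: nat \<Rightarrow> nat) \<and>
        (\<forall>f\<in>Ckappa \<kappa>. \<forall>t\<in>D. mixed_conv \<kappa> (\<lambda>l. iterate h I (\<phi> l) t f) (S t f)))"

end

theory Submission
  imports Defs "HOL-Computational_Algebra.Polynomial"
begin

text \<open>
  Let \<open>f\<close> be smooth and let \<open>M\<close> be convolution with a smooth kernel supported near the origin.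
  The curve \<open>\<phi> s = S (t - s) (M (T s f)) x\<close> joins \<open>S t (M f) x\<close> to \<open>M (T t f) x\<close>, so it suffices
  that \<open>\<phi>\<close> decreases at a rate that vanishes with the radius of \<open>M\<close>; removing the mollification
  and approximating a general \<open>f\<close> by smooth functions then gives the claim.

  For the rate, fix \<open>s\<close>, put \<open>u = M (T s f)\<close> and compare \<open>\<phi> s\<close> with \<open>\<phi> (s + \<tau>)\<close>. Three facts
  enter.

  \<^item> \<open>T \<tau> (M w) \<le> M (T \<tau> w) + \<epsilon> \<tau> / \<kappa>\<close> for Lipschitz \<open>w\<close> (\<open>mollify_commute\<close>): \<open>M w\<close> is an average of
    small translates of \<open>w\<close>, the operator \<open>T \<tau>\<close> is convex, and it nearly commutes with small
    translations. Hence \<open>T \<tau> u\<close> is at most \<open>M (T (s + \<tau>) f)\<close> up to \<open>\<epsilon> \<tau> / \<kappa>\<close>.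

  \<^item> \<open>S \<tau> u \<le> T \<tau> u + \<tau> k\<close> with \<open>k\<close> bounded in the weighted norm and small on a prescribed
    compact set when \<open>\<tau>\<close> is small (\<open>infinitesimal_domination\<close>): the function \<open>u\<close> is smooth, and on
    smooth functions the semigroups have the generators \<open>I'(0)\<close> and \<open>J'(0)\<close>
    (\<open>semigroup_expansion\<close>), which are ordered by hypothesis.

  \<^item> \<open>S r (v + \<tau> k) - S r v \<le> \<tau> (S r (v + k) - S r v)\<close>: convexity turns the equicontinuity of \<open>S r\<close>
    in the mixed topology, which by itself carries no rate, into an error that is \<open>o(\<tau>)\<close>.

  Together they bound \<open>\<phi> s - \<phi> (s + \<tau>)\<close> by \<open>C \<epsilon> \<tau>\<close> for all small \<open>\<tau>\<close>, where \<open>C\<close> is independent of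
  \<open>s\<close> and of \<open>\<epsilon>\<close>. How small \<open>\<tau>\<close> has to be may depend on \<open>s\<close>, since upper semicontinuity from the
  left, which (S4) provides, is enough to pass from this local bound to \<open>\<phi> 0 \<le> \<phi> t + C \<epsilon> t\<close>
  (\<open>le_of_local_increase\<close>, \<open>mollified_comparison\<close>).

  The comparison is made between the semigroups and not between the iterates of \<open>I\<close> and \<open>J\<close>
  because the two semigroups may arise along different subsequences. All estimates on \<open>S\<close> and \<open>T\<close>
  are first shown for the iterates, uniformly in the number of steps, and then carried over to every
  time \<open>t\<close> by a filter on pairs of a scheme index and a step number (\<open>approximating_filter\<close>).
\<close>

section \<open>Mollification by a smooth compactly supported kernel\<close>

text \<open>
  For \<open>p = 1\<close> this is the classical smooth function \<open>exp (- 1 / x)\<close> that is flat at the origin.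
  Polynomial factors in \<open>1 / x\<close> are included to make the family closed under differentiation.
\<close>

definition flat :: "real poly \<Rightarrow> real \<Rightarrow> real" where
  "flat p x = (if x > 0 then poly p (1 / x) * exp (- (1 / x)) else 0)"

lemma poly_times_exp_minus_tendsto_0:
  fixes p :: "real poly"
  shows "((\<lambda>y. poly p y * exp (- y)) \<longlongrightarrow> 0) at_top"
proof -
  have "((\<lambda>y. \<Sum>i\<le>degree p. coeff p i * (y ^ i / exp y)) \<longlongrightarrow> (\<Sum>i\<le>degree p. coeff p i * 0)) at_top"
    by (intro tendsto_sum tendsto_mult tendsto_const tendsto_power_div_exp_0)
  moreover have "(\<lambda>y. \<Sum>i\<le>degree p. coeff p i * (y ^ i / exp y)) = (\<lambda>y. poly p y * exp (- y))"
    by (simp add: poly_altdef exp_minus field_simps sum_divide_distrib)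
  ultimately show ?thesis by simp
qed

lemma flat_tendsto_0: "(flat p \<longlongrightarrow> 0) (at 0)"
proof -
  have "filterlim (\<lambda>x::real. 1 / x) at_top (at_right 0)"
    using filterlim_inverse_at_top_right by (simp add: inverse_eq_divide)
  from filterlim_compose[OF poly_times_exp_minus_tendsto_0 this, of p]
  have "(flat p \<longlongrightarrow> 0) (at_right 0)"
    by (rule Lim_transform_eventually)
       (auto simp: flat_def eventually_at_filter)
  moreover have "(flat p \<longlongrightarrow> 0) (at_left 0)"
    by (rule Lim_transform_eventually[OF tendsto_const])
       (auto simp: flat_def eventually_at_filter)
  ultimately show ?thesis
    by (simp add: filterlim_split_at)
qed

lemma flat_has_derivative:
  "(flat p has_real_derivative flat ([:0, 0, 1:] * (p - pderiv p)) x) (at x)"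
proof -
  consider "x > 0" | "x < 0" | "x = 0" by linarith
  then show ?thesis
  proof cases
    case 1
    have "((\<lambda>x. poly p (1 / x) * exp (- (1 / x))) has_real_derivative
        flat ([:0, 0, 1:] * (p - pderiv p)) x) (at x)"
      using 1
      by (auto intro!: derivative_eq_intros DERIV_chain2[OF poly_DERIV]
          simp: flat_def field_simps power2_eq_square)
    then show ?thesis
      by (rule has_field_derivative_transform_within_open[where S = "{0<..}"])
         (use 1 in \<open>auto simp: flat_def\<close>)
  next
    case 2
    have "((\<lambda>x. 0) has_real_derivative flat ([:0, 0, 1:] * (p - pderiv p)) x) (at x)"
      using 2 by (simp add: flat_def)
    then show ?thesis
      by (rule has_field_derivative_transform_within_open[where S = "{..<0}"])
         (use 2 in \<open>auto simp: flat_def\<close>)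
  next
    case 3
    \<comment> \<open>the difference quotient of \<open>flat p\<close> at the origin is again a flat function\<close>
    have "((\<lambda>h. (flat p (0 + h) - flat p 0) / h) \<longlongrightarrow> 0) (at 0)"
      by (rule Lim_transform_eventually[OF flat_tendsto_0[of "[:0, 1:] * p"]])
         (auto simp: flat_def eventually_at_filter)
    then show ?thesis
      using 3 by (simp add: DERIV_def flat_def)
  qed
qed

text \<open>
  One-dimensional factors of the mollifying kernel. The family contains a bump on
  \<open>[-\<sigma>, \<sigma>]\<close>, and sums are included to make it closed under differentiation by the product rule.
\<close>

inductive_set profiles :: "real \<Rightarrow> (real \<Rightarrow> real) set" for \<sigma> :: real where
  base: "(\<lambda>s. flat p (\<sigma> + s) * flat q (\<sigma> - s)) \<in> profiles \<sigma>"
| add: "f \<in> profiles \<sigma> \<Longrightarrow> g \<in> profiles \<sigma> \<Longrightarrow> (\<lambda>s. f s + g s) \<in> profiles \<sigma>"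

lemma profiles_has_derivative:
  "f \<in> profiles \<sigma> \<Longrightarrow> \<exists>g\<in>profiles \<sigma>. \<forall>s. (f has_real_derivative g s) (at s)"
proof (induction rule: profiles.induct)
  case (base p q)
  define D where "D r = [:0, 0, 1:] * (r - pderiv r)" for r :: "real poly"
  have neg: "flat (- r) x = - flat r x" for r x
    by (simp add: flat_def)
  have "((\<lambda>s. flat p (\<sigma> + s) * flat q (\<sigma> - s)) has_real_derivative
      flat (D p) (\<sigma> + s) * flat q (\<sigma> - s) + flat p (\<sigma> + s) * flat (- D q) (\<sigma> - s)) (at s)" for s
    unfolding neg
    by (rule derivative_eq_intros DERIV_chain2[OF flat_has_derivative] refl)+
       (simp add: D_def)
  moreover have "(\<lambda>s. flat (D p) (\<sigma> + s) * flat q (\<sigma> - s)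
      + flat p (\<sigma> + s) * flat (- D q) (\<sigma> - s)) \<in> profiles \<sigma>"
    by (intro profiles.intros)
  ultimately show ?case
    by (intro bexI[of _ "\<lambda>s. flat (D p) (\<sigma> + s) * flat q (\<sigma> - s)
      + flat p (\<sigma> + s) * flat (- D q) (\<sigma> - s)"]) auto
next
  case (add f g)
  then obtain f' g' where "f' \<in> profiles \<sigma>" "g' \<in> profiles \<sigma>"
    "\<forall>s. (f has_real_derivative f' s) (at s)" "\<forall>s. (g has_real_derivative g' s) (at s)"
    by blast
  then show ?case
    by (intro bexI[of _ "\<lambda>s. f' s + g' s"]) (auto intro: DERIV_add profiles.add)
qed

lemma profiles_eq_0: "f \<in> profiles \<sigma> \<Longrightarrow> \<sigma> \<le> \<bar>s\<bar> \<Longrightarrow> f s = 0"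
  by (induction rule: profiles.induct) (auto simp: flat_def abs_if split: if_splits)

text \<open>
  Products of profiles over the coordinates. Smoothness of a kernel is never stated as such; it is
  used in the form that the partial derivatives of a kernel are kernels again.
\<close>

definition kernels :: "real \<Rightarrow> ('a::euclidean_space \<Rightarrow> real) set" where
  "kernels \<sigma> = {\<lambda>y. c * (\<Prod>b\<in>Basis. f b (y \<bullet> b)) | c f. \<forall>b\<in>Basis. f b \<in> profiles \<sigma>}"

lemma kernels_cmult: "k \<in> kernels \<sigma> \<Longrightarrow> (\<lambda>y. a * k y) \<in> kernels \<sigma>"
  unfolding kernels_def by (force simp: mult.assoc)

lemma kernels_has_derivative:
  fixes k :: "'a::euclidean_space \<Rightarrow> real"
  assumes "k \<in> kernels \<sigma>"
  shows "\<exists>k'. (\<forall>b\<in>Basis. k' b \<in> kernels \<sigma>) \<and>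
    (\<forall>y. (k has_derivative (\<lambda>v. \<Sum>b\<in>Basis. (v \<bullet> b) * k' b y)) (at y))"
proof -
  obtain c f where k: "k = (\<lambda>y. c * (\<Prod>b\<in>Basis. f b (y \<bullet> b)))"
    and f: "\<forall>b\<in>Basis. f b \<in> profiles \<sigma>"
    using assms by (auto simp: kernels_def)
  have "\<forall>b\<in>Basis. \<exists>g. g \<in> profiles \<sigma> \<and> (\<forall>s. (f b has_real_derivative g s) (at s))"
    using f profiles_has_derivative by blast
  then obtain g where g: "\<forall>b\<in>Basis. g b \<in> profiles \<sigma> \<and> (\<forall>s. (f b has_real_derivative g b s) (at s))"
    by (auto simp: bchoice_iff)
  define k' where "k' b y = c * (\<Prod>b'\<in>Basis. (f(b := g b)) b' (y \<bullet> b'))" for b y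
  have k'_eq: "k' b y = c * (g b (y \<bullet> b) * (\<Prod>b'\<in>Basis - {b}. f b' (y \<bullet> b')))"
    if "b \<in> Basis" for b y
    using that unfolding k'_def by (subst prod.remove[of _ b]) (auto intro!: prod.cong)
  have "k' b \<in> kernels \<sigma>" if "b \<in> Basis" for b
    unfolding kernels_def k'_def using f g that by fastforce
  moreover have "(k has_derivative (\<lambda>v. \<Sum>b\<in>Basis. (v \<bullet> b) * k' b y)) (at y)" for y
  proof -
    have "((\<lambda>y. f b (y \<bullet> b)) has_derivative (\<lambda>v. (v \<bullet> b) * g b (y \<bullet> b))) (at y)"
      if "b \<in> Basis" for b
    proof -
      have "(f b has_derivative (*) (g b (y \<bullet> b))) (at (y \<bullet> b))"
        using g that by (simp add: has_field_derivative_def)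
      from has_derivative_compose[where f = "\<lambda>y. y \<bullet> b" and f' = "\<lambda>v. v \<bullet> b" and s = UNIV
          and x = y and g = "f b" and g' = "(*) (g b (y \<bullet> b))", OF _ this]
      show ?thesis
        by (simp add: bounded_linear_inner_left bounded_linear_imp_has_derivative mult.commute)
    qed
    then have "(k has_derivative (\<lambda>v. c * (\<Sum>b\<in>Basis. (v \<bullet> b) * g b (y \<bullet> b)
        * (\<Prod>b'\<in>Basis - {b}. f b' (y \<bullet> b'))))) (at y)"
      unfolding k by (intro has_derivative_mult_right has_derivative_prod) auto
    also have "(\<lambda>v. c * (\<Sum>b\<in>Basis. (v \<bullet> b) * g b (y \<bullet> b) * (\<Prod>b'\<in>Basis - {b}. f b' (y \<bullet> b'))))
        = (\<lambda>v. \<Sum>b\<in>Basis. (v \<bullet> b) * k' b y)"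
      by (auto simp: k'_eq sum_distrib_left mult_ac intro!: sum.cong)
    finally show ?thesis .
  qed
  ultimately show ?thesis by blast
qed

lemma kernels_continuous:
  fixes k :: "'a::euclidean_space \<Rightarrow> real"
  assumes "k \<in> kernels \<sigma>"
  shows "continuous_on A k"
  using kernels_has_derivative[OF assms] has_derivative_continuous
  by (blast intro: continuous_at_imp_continuous_on)

lemma kernels_eq_0:
  fixes k :: "'a::euclidean_space \<Rightarrow> real"
  assumes "k \<in> kernels \<sigma>" "y \<notin> cbox (- (\<sigma> *\<^sub>R One)) (\<sigma> *\<^sub>R One)"
  shows "k y = 0"
proof -
  obtain b where b: "b \<in> Basis" "\<sigma> \<le> \<bar>y \<bullet> b\<bar>"
    using assms(2) by (auto simp: mem_box inner_sum_left_Basis not_le)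
  then show ?thesis
    using assms(1) profiles_eq_0[OF _ b(2)] unfolding kernels_def
    by (auto intro!: bexI[of _ b])
qed

lemma kernels_bounded:
  fixes k :: "'a::euclidean_space \<Rightarrow> real"
  assumes "k \<in> kernels \<sigma>"
  obtains B where "B \<ge> 0" "\<And>y. \<bar>k y\<bar> \<le> B"
proof -
  have "compact (k ` cbox (- (\<sigma> *\<^sub>R One)) (\<sigma> *\<^sub>R One))"
    by (intro compact_continuous_image kernels_continuous[OF assms] compact_cbox)
  then obtain B where B: "\<And>y. y \<in> cbox (- (\<sigma> *\<^sub>R One)) (\<sigma> *\<^sub>R One) \<Longrightarrow> \<bar>k y\<bar> \<le> B"
    by (metis (no_types, lifting) bounded_iff compact_imp_bounded imageI real_norm_def)
  have "\<bar>k y\<bar> \<le> max B 0" for y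
    using B[of y] kernels_eq_0[OF assms, of y] by fastforce
  then show ?thesis using that[of "max B 0"] by auto
qed

text \<open>
  The kernel is not reflected, so that \<open>conv \<sigma> k u x\<close> is literally an average of the translates
  \<open>u (x + y)\<close> when \<open>k\<close> is a probability density.
\<close>

definition conv :: "real \<Rightarrow> ('a::euclidean_space \<Rightarrow> real) \<Rightarrow> ('a \<Rightarrow> real) \<Rightarrow> 'a \<Rightarrow> real" where
  "conv \<sigma> k u x = integral (cbox (- (\<sigma> *\<^sub>R One)) (\<sigma> *\<^sub>R One)) (\<lambda>y. k y * u (x + y))"

lemma conv_integrable:
  fixes u :: "'a::euclidean_space \<Rightarrow> real"
  assumes "k \<in> kernels \<sigma>" "continuous_on UNIV u"
  shows "(\<lambda>y. k y * u (x + y)) integrable_on cbox a b"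
  by (intro integrable_continuous continuous_intros kernels_continuous[OF assms(1)]
      continuous_on_compose2[OF assms(2)]) auto

text \<open>
  Substituting \<open>z = x + y\<close> moves the dependence on \<open>x\<close> from \<open>u\<close>, which is merely continuous, to the
  kernel. The domain of integration can be chosen the same for all \<open>x\<close> near \<open>x0\<close> because the kernel
  vanishes outside its cube; this prepares differentiation under the integral.
\<close>

lemma conv_eq_integral_fixed_box:
  fixes u :: "'a::euclidean_space \<Rightarrow> real"
  assumes k: "k \<in> kernels \<sigma>" and u: "continuous_on UNIV u"
    and x: "x \<in> cbox (x0 - One) (x0 + One)"
  shows "conv \<sigma> k u x = integral (cbox (x0 - (\<sigma> + 1) *\<^sub>R One) (x0 + (\<sigma> + 1) *\<^sub>R One)) (\<lambda>z. k (z - x) * u z)"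
proof -
  let ?B = "cbox (- (\<sigma> *\<^sub>R One)) (\<sigma> *\<^sub>R One) :: 'a set"
  let ?Q = "cbox (x0 - (\<sigma> + 1) *\<^sub>R One) (x0 + (\<sigma> + 1) *\<^sub>R One)"
  have "((\<lambda>y. k y * u (x + y)) has_integral conv \<sigma> k u x) ?B"
    unfolding conv_def by (intro integrable_integral conv_integrable[OF k u])
  from has_integral_shift_cbox[OF this, of "- x"]
  have "((\<lambda>z. k (z - x) * u z) has_integral conv \<sigma> k u x)
      (cbox (- (\<sigma> *\<^sub>R One) + x) (\<sigma> *\<^sub>R One + x))"
    by simp
  then have "((\<lambda>z. k (z - x) * u z) has_integral conv \<sigma> k u x) ?Q"
  proof (rule has_integral_on_superset)
    fix z assume "z \<notin> cbox (- (\<sigma> *\<^sub>R One) + x) (\<sigma> *\<^sub>R One + x)"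
    then have "z - x \<notin> ?B"
      by (auto simp: mem_box algebra_simps)
    then show "k (z - x) * u z = 0"
      using kernels_eq_0[OF k] by simp
  next
    show "cbox (- (\<sigma> *\<^sub>R One) + x) (\<sigma> *\<^sub>R One + x) \<subseteq> ?Q"
    proof
      fix z assume z: "z \<in> cbox (- (\<sigma> *\<^sub>R One) + x) (\<sigma> *\<^sub>R One + x)"
      show "z \<in> ?Q"
        unfolding mem_box
      proof (intro ballI)
        fix i :: 'a assume i: "i \<in> Basis"
        have "- \<sigma> + x \<bullet> i \<le> z \<bullet> i" "z \<bullet> i \<le> \<sigma> + x \<bullet> i" "x0 \<bullet> i - 1 \<le> x \<bullet> i" "x \<bullet> i \<le> x0 \<bullet> i + 1"
          using z x i by (auto simp: mem_box inner_simps)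
        then show "(x0 - (\<sigma> + 1) *\<^sub>R One) \<bullet> i \<le> z \<bullet> i \<and> z \<bullet> i \<le> (x0 + (\<sigma> + 1) *\<^sub>R One) \<bullet> i"
          using i by (simp add: inner_simps)
      qed
    qed
  qed
  then show ?thesis by (simp add: integral_unique)
qed

lemma conv_has_derivative:
  fixes u :: "'a::euclidean_space \<Rightarrow> real"
  assumes k: "k \<in> kernels \<sigma>" and u: "continuous_on UNIV u"
    and k': "\<forall>b\<in>Basis. k' b \<in> kernels \<sigma>"
    and deriv: "\<forall>y. (k has_derivative (\<lambda>v. \<Sum>b\<in>Basis. (v \<bullet> b) * k' b y)) (at y)"
  shows "(conv \<sigma> k u has_derivative (\<lambda>v. \<Sum>b\<in>Basis. (v \<bullet> b) * conv \<sigma> (\<lambda>y. - 1 * k' b y) u x0)) (at x0)"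
proof -
  define Q where "Q = cbox (x0 - (\<sigma> + 1) *\<^sub>R One) (x0 + (\<sigma> + 1) *\<^sub>R One)"
  define U where "U = cbox (x0 - One) (x0 + One)"
  define fx where "fx x z = (\<Sum>b\<in>Basis. (- k' b (z - x) * u z) *\<^sub>R blinfun_inner_left b)" for x z
  have x0: "x0 \<in> box (x0 - One) (x0 + One)"
    by (simp add: mem_box inner_simps)
  have x0U: "x0 \<in> U"
    using x0 box_subset_cbox unfolding U_def by blast
  have kc: "continuous_on A (k' b)" if "b \<in> Basis" for b A
    using k' that by (blast intro: kernels_continuous)
  have fx_apply: "blinfun_apply (fx x z) v = (\<Sum>b\<in>Basis. (v \<bullet> b) * (- k' b (z - x) * u z))" for x z v
    by (simp add: fx_def blinfun.sum_left blinfun.scaleR_left blinfun.minus_left mult_ac)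
  have "((\<lambda>x. integral Q (\<lambda>z. k (z - x) * u z)) has_derivative blinfun_apply (integral Q (fx x0))) (at x0 within U)"
    unfolding Q_def
  proof (rule leibniz_rule)
    fix x z
    have "(k has_derivative (\<lambda>v. \<Sum>b\<in>Basis. (v \<bullet> b) * k' b (z - x))) (at (z - x))"
      using deriv by blast
    then have "((\<lambda>x. k (z - x)) has_derivative (\<lambda>v. \<Sum>b\<in>Basis. ((- v) \<bullet> b) * k' b (z - x))) (at x within U)"
      by (rule has_derivative_compose[rotated]) (auto intro!: derivative_eq_intros)
    then have "((\<lambda>x. k (z - x) * u z) has_derivative (\<lambda>v. (\<Sum>b\<in>Basis. ((- v) \<bullet> b) * k' b (z - x)) * u z)) (at x within U)"
      by (rule has_derivative_mult_left)
    moreover have "blinfun_apply (fx x z) = (\<lambda>v. (\<Sum>b\<in>Basis. ((- v) \<bullet> b) * k' b (z - x)) * u z)"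
      by (rule ext) (simp add: fx_apply sum_distrib_left sum_distrib_right mult_ac)
    ultimately show "((\<lambda>x. k (z - x) * u z) has_derivative blinfun_apply (fx x z)) (at x within U)"
      by simp
  next
    show "(\<lambda>z. k (z - x) * u z) integrable_on cbox (x0 - (\<sigma> + 1) *\<^sub>R One) (x0 + (\<sigma> + 1) *\<^sub>R One)" for x
      by (intro integrable_continuous continuous_intros continuous_on_subset[OF u]
          continuous_on_compose2[OF kernels_continuous[OF k, of UNIV]]) auto
  next
    show "continuous_on (U \<times> cbox (x0 - (\<sigma> + 1) *\<^sub>R One) (x0 + (\<sigma> + 1) *\<^sub>R One)) (\<lambda>(x, z). fx x z)"
      unfolding fx_def split_beta
      by (intro continuous_intros continuous_on_compose2[OF u] continuous_on_compose2[OF kc[of _ UNIV]]) auto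
  qed (use x0U in \<open>auto simp: U_def\<close>)
  then have "((\<lambda>x. integral Q (\<lambda>z. k (z - x) * u z)) has_derivative blinfun_apply (integral Q (fx x0))) (at x0)"
    using at_within_interior[of x0 U] x0 by (simp add: U_def interior_cbox)
  moreover have "integral Q (\<lambda>z. k (z - x) * u z) = conv \<sigma> k u x" if "x \<in> box (x0 - One) (x0 + One)" for x
    unfolding Q_def
    by (rule conv_eq_integral_fixed_box[OF k u subsetD[OF box_subset_cbox that], symmetric])
  ultimately have "(conv \<sigma> k u has_derivative blinfun_apply (integral Q (fx x0))) (at x0)"
    by (rule has_derivative_transform_within_open[OF _ open_box x0])
  also have "blinfun_apply (integral Q (fx x0)) = (\<lambda>v. \<Sum>b\<in>Basis. (v \<bullet> b) * conv \<sigma> (\<lambda>y. - 1 * k' b y) u x0)"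
  proof
    fix v
    have int: "fx x0 integrable_on Q"
      unfolding Q_def fx_def
      by (intro integrable_continuous continuous_intros continuous_on_subset[OF u]
          continuous_on_compose2[OF kc[of _ UNIV]]) auto
    have "blinfun_apply (integral Q (fx x0)) v = integral Q (\<lambda>z. blinfun_apply (fx x0 z) v)"
      by (rule blinfun_apply_integral[OF int])
    also have "\<dots> = (\<Sum>b\<in>Basis. integral Q (\<lambda>z. (v \<bullet> b) * (- 1 * k' b (z - x0) * u z)))"
      unfolding fx_apply
      by (subst integral_sum)
         (auto simp: Q_def intro!: integrable_continuous continuous_intros continuous_on_subset[OF u]
          continuous_on_compose2[OF kc[of _ UNIV]])
    also have "\<dots> = (\<Sum>b\<in>Basis. (v \<bullet> b) * conv \<sigma> (\<lambda>y. - 1 * k' b y) u x0)"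
    proof (rule sum.cong[OF refl])
      fix b :: 'a assume b: "b \<in> Basis"
      have "conv \<sigma> (\<lambda>y. - 1 * k' b y) u x0 = integral Q (\<lambda>z. - 1 * k' b (z - x0) * u z)"
        unfolding Q_def using x0U unfolding U_def
        by (intro conv_eq_integral_fixed_box kernels_cmult u) (use k' b in auto)
      then show "integral Q (\<lambda>z. (v \<bullet> b) * (- 1 * k' b (z - x0) * u z))
          = (v \<bullet> b) * conv \<sigma> (\<lambda>y. - 1 * k' b y) u x0"
        by simp
    qed
    finally show "blinfun_apply (integral Q (fx x0)) v
        = (\<Sum>b\<in>Basis. (v \<bullet> b) * conv \<sigma> (\<lambda>y. - 1 * k' b y) u x0)" .
  qed
  finally show ?thesis .
qed

lemma conv_partials:
  fixes u :: "'a::euclidean_space \<Rightarrow> real"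
  assumes "k \<in> kernels \<sigma>" "continuous_on UNIV u" "set bs \<subseteq> Basis"
  shows "\<exists>k'\<in>kernels \<sigma>. partials bs (conv \<sigma> k u) = conv \<sigma> k' u"
  using assms(3)
proof (induction bs)
  case Nil
  then show ?case using assms(1) by auto
next
  case (Cons b bs)
  then obtain k1 where k1: "k1 \<in> kernels \<sigma>" "partials bs (conv \<sigma> k u) = conv \<sigma> k1 u"
    by auto
  obtain k' where k': "\<forall>b\<in>Basis. k' b \<in> kernels \<sigma>"
    "\<forall>y. (k1 has_derivative (\<lambda>v. \<Sum>b\<in>Basis. (v \<bullet> b) * k' b y)) (at y)"
    using kernels_has_derivative[OF k1(1)] by blast
  have b: "b \<in> Basis" using Cons.prems by simp
  have "partials (b # bs) (conv \<sigma> k u) x = conv \<sigma> (\<lambda>y. - 1 * k' b y) u x" for x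
  proof -
    have "partials (b # bs) (conv \<sigma> k u) x = (\<Sum>c\<in>Basis. (b \<bullet> c) * conv \<sigma> (\<lambda>y. - 1 * k' c y) u x)"
      unfolding partials.simps k1(2)
      by (subst frechet_derivative_at[OF conv_has_derivative[OF k1(1) assms(2) k'], symmetric]) simp
    also have "\<dots> = (\<Sum>c\<in>Basis. if c = b then conv \<sigma> (\<lambda>y. - 1 * k' c y) u x else 0)"
      using b by (intro sum.cong) (auto simp: inner_Basis)
    finally show ?thesis using b by simp
  qed
  moreover have "(\<lambda>y. - 1 * k' b y) \<in> kernels \<sigma>"
    by (rule kernels_cmult) (use k' b in auto)
  ultimately show ?case by blast
qed

lemma conv_in_Cb_infty:
  fixes u :: "'a::euclidean_space \<Rightarrow> real"
  assumes k: "k \<in> kernels \<sigma>" and u: "continuous_on UNIV u" and bound: "\<And>x. \<bar>u x\<bar> \<le> B"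
  shows "conv \<sigma> k u \<in> Cb_infty"
  unfolding Cb_infty_def
proof (intro CollectI allI impI conjI)
  fix bs :: "'a list" assume "set bs \<subseteq> Basis"
  then obtain k1 where k1: "k1 \<in> kernels \<sigma>" "partials bs (conv \<sigma> k u) = conv \<sigma> k1 u"
    using conv_partials[OF k u] by blast
  show "partials bs (conv \<sigma> k u) differentiable at x" for x
    using kernels_has_derivative[OF k1(1)] conv_has_derivative[OF k1(1) u]
    unfolding k1(2) differentiable_def by blast
  obtain C where C: "C \<ge> 0" "\<And>y. \<bar>k1 y\<bar> \<le> C"
    using kernels_bounded[OF k1(1)] by blast
  have "0 \<le> B" using bound[of 0] by linarith
  have "norm (conv \<sigma> k1 u x) \<le> C * B * measure lborel (cbox (- (\<sigma> *\<^sub>R One)) (\<sigma> *\<^sub>R One) :: 'a set)" for x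
    unfolding conv_def
  proof (rule integrable_bound)
    show "0 \<le> C * B" using C \<open>0 \<le> B\<close> by simp
    show "(\<lambda>y. k1 y * u (x + y)) integrable_on cbox (- (\<sigma> *\<^sub>R One)) (\<sigma> *\<^sub>R One)"
      by (rule conv_integrable[OF k1(1) u])
    show "norm (k1 y * u (x + y)) \<le> C * B" for y
      using mult_mono[OF C(2)[of y] bound[of "x + y"]] C(1) by (simp add: abs_mult)
  qed
  then show "bounded (range (partials bs (conv \<sigma> k u)))"
    unfolding k1(2) bounded_iff by blast
qed

definition mollifier_kernel :: "real \<Rightarrow> 'a::euclidean_space \<Rightarrow> real" where
  "mollifier_kernel \<sigma> = (SOME k. k \<in> kernels \<sigma> \<and> (\<forall>y. 0 \<le> k y) \<and>
     integral (cbox (- (\<sigma> *\<^sub>R One)) (\<sigma> *\<^sub>R One)) k = 1)"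

lemma mollifier_kernel:
  assumes "0 < \<sigma>"
  shows "(mollifier_kernel \<sigma> :: 'a::euclidean_space \<Rightarrow> real) \<in> kernels \<sigma>"
    and "0 \<le> mollifier_kernel \<sigma> (y::'a)"
    and "integral (cbox (- (\<sigma> *\<^sub>R One)) (\<sigma> *\<^sub>R One)) (mollifier_kernel \<sigma> :: 'a \<Rightarrow> real) = 1"
proof -
  define f where "f = (\<lambda>s. flat 1 (\<sigma> + s) * flat 1 (\<sigma> - s))"
  define k :: "'a \<Rightarrow> real" where "k y = 1 * (\<Prod>b\<in>Basis. f (y \<bullet> b))" for y
  let ?B = "cbox (- (\<sigma> *\<^sub>R One)) (\<sigma> *\<^sub>R One) :: 'a set"
  have f0: "0 \<le> f s" for s by (auto simp: f_def flat_def)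
  have kk: "k \<in> kernels \<sigma>"
    unfolding kernels_def k_def[abs_def] using profiles.base[of 1 \<sigma> 1]
    by (intro CollectI exI[of _ 1] exI[of _ "\<lambda>_. f"]) (auto simp: f_def)
  have k0: "0 \<le> k y" for y unfolding k_def by (auto intro!: prod_nonneg f0)
  have pos: "0 < k 0" unfolding k_def f_def using assms by (auto intro!: prod_pos simp: flat_def)
  have int: "k integrable_on ?B"
    by (intro integrable_continuous kernels_continuous[OF kk])
  have "integral ?B k \<noteq> 0"
  proof
    assume "integral ?B k = 0"
    then have "(k has_integral 0) ?B" using int by (metis integrable_integral)
    moreover have "box (- (\<sigma> *\<^sub>R One)) (\<sigma> *\<^sub>R One) \<noteq> ({} :: 'a set)" "(0::'a) \<in> ?B"
      using assms by (auto simp: box_ne_empty mem_box)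
    ultimately have "k 0 = 0"
      by (intro has_integral_0_cbox_imp_0[OF kernels_continuous[OF kk]]) (use k0 in auto)
    then show False using pos by simp
  qed
  moreover have "0 \<le> integral ?B k" by (intro integral_nonneg int k0)
  ultimately have Z: "0 < integral ?B k" by simp
  have "\<exists>k::'a\<Rightarrow>real. k \<in> kernels \<sigma> \<and> (\<forall>y. 0 \<le> k y) \<and> integral ?B k = 1"
    using kernels_cmult[OF kk, of "inverse (integral ?B k)"] Z k0
    by (intro exI[of _ "\<lambda>y. inverse (integral ?B k) * k y"]) auto
  from someI_ex[OF this]
  have "(mollifier_kernel \<sigma> :: 'a \<Rightarrow> real) \<in> kernels \<sigma> \<and> (\<forall>y. 0 \<le> mollifier_kernel \<sigma> (y::'a)) \<and>
     integral ?B (mollifier_kernel \<sigma>) = 1"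
    unfolding mollifier_kernel_def .
  then show "(mollifier_kernel \<sigma> :: 'a \<Rightarrow> real) \<in> kernels \<sigma>"
    "0 \<le> mollifier_kernel \<sigma> y" "integral ?B (mollifier_kernel \<sigma>) = 1"
    by auto
qed

definition mollify :: "real \<Rightarrow> ('a::euclidean_space \<Rightarrow> real) \<Rightarrow> 'a \<Rightarrow> real" where
  "mollify \<sigma> = conv \<sigma> (mollifier_kernel \<sigma>)"

lemma norm_le_of_mem_cube:
  fixes y :: "'a::euclidean_space" and \<sigma> :: real
  assumes "y \<in> cbox (- (\<sigma> *\<^sub>R One)) (\<sigma> *\<^sub>R One)"
  shows "norm y \<le> DIM('a) * \<sigma>"
proof -
  have "norm y \<le> (\<Sum>b\<in>Basis. \<bar>y \<bullet> b\<bar>)" by (rule norm_le_l1)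
  also have "\<dots> \<le> (\<Sum>b\<in>(Basis::'a set). \<sigma>)"
    using assms by (intro sum_mono) (auto simp: mem_box abs_le_iff algebra_simps)
  finally show ?thesis by simp
qed

lemma mollify_diff_le:
  fixes u v :: "'a::euclidean_space \<Rightarrow> real" and \<sigma> :: real
  assumes \<sigma>: "0 < \<sigma>" and u: "continuous_on UNIV u" and v: "continuous_on UNIV v"
    and le: "\<And>y. norm y \<le> DIM('a) * \<sigma> \<Longrightarrow> \<bar>u (x + y) - v (x + y)\<bar> \<le> e"
  shows "\<bar>mollify \<sigma> u x - mollify \<sigma> v x\<bar> \<le> e"
proof -
  let ?B = "cbox (- (\<sigma> *\<^sub>R One)) (\<sigma> *\<^sub>R One) :: 'a set"
  let ?k = "mollifier_kernel \<sigma> :: 'a \<Rightarrow> real"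
  note k = mollifier_kernel[OF \<sigma>, where 'a='a]
  have "mollify \<sigma> u x - mollify \<sigma> v x = integral ?B (\<lambda>y. ?k y * u (x + y) - ?k y * v (x + y))"
    unfolding mollify_def conv_def
    by (intro integral_diff[symmetric] conv_integrable[OF k(1)] u v)
  also have "norm \<dots> \<le> integral ?B (\<lambda>y. ?k y * e)"
  proof (rule integral_norm_bound_integral)
    show "(\<lambda>y. ?k y * u (x + y) - ?k y * v (x + y)) integrable_on ?B"
      by (intro integrable_diff conv_integrable[OF k(1)] u v)
    show "(\<lambda>y. ?k y * e) integrable_on ?B"
      by (intro integrable_continuous continuous_intros kernels_continuous[OF k(1)])
    show "norm (?k y * u (x + y) - ?k y * v (x + y)) \<le> ?k y * e" if "y \<in> ?B" for y
      using mult_left_mono[OF le[OF norm_le_of_mem_cube[OF that]] k(2)[of y]] k(2)[of y]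
      by (simp add: abs_mult flip: right_diff_distrib)
  qed
  also have "\<dots> = e" using k(3) by simp
  finally show ?thesis by simp
qed

lemma mollify_const: "0 < \<sigma> \<Longrightarrow> mollify \<sigma> (\<lambda>y. c) (x :: 'a::euclidean_space) = c"
  unfolding mollify_def conv_def using mollifier_kernel(3)[where 'a = 'a] by simp

lemma mollify_near:
  fixes u :: "'a::euclidean_space \<Rightarrow> real" and \<sigma> :: real
  assumes "0 < \<sigma>" "continuous_on UNIV u"
    and "\<And>y. norm y \<le> DIM('a) * \<sigma> \<Longrightarrow> \<bar>u (x + y) - c\<bar> \<le> e"
  shows "\<bar>mollify \<sigma> u x - c\<bar> \<le> e"
  using mollify_diff_le[OF assms(1,2) continuous_on_const[of _ c] assms(3)] mollify_const[OF assms(1)]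
  by metis

lemma mollify_Cb_infty:
  fixes u :: "'a::euclidean_space \<Rightarrow> real" and \<sigma> :: real
  assumes "0 < \<sigma>" "continuous_on UNIV u" "\<And>x. \<bar>u x\<bar> \<le> B"
  shows "mollify \<sigma> u \<in> Cb_infty"
  unfolding mollify_def using conv_in_Cb_infty[OF mollifier_kernel(1)] assms by blast

text \<open>
  The Riemann sums of the convolution integral over a fine tagged partition. The weights are the
  exact integrals of the kernel over the cells, so that they sum up to \<open>1\<close>, and they are independent
  of \<open>u\<close> and \<open>x\<close>. This reduces Jensen's inequality for \<open>mollify\<close> to finite convex combinations.
\<close>

lemma mollify_finite_average:
  fixes \<sigma> e :: real
  assumes \<sigma>: "0 < \<sigma>" and e: "0 < e"
  obtains P :: "('a::euclidean_space \<times> 'a set) set" and w :: "'a \<times> 'a set \<Rightarrow> real"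
  where "finite P" "\<And>i. i \<in> P \<Longrightarrow> 0 \<le> w i" "sum w P = 1"
    and "\<And>i. i \<in> P \<Longrightarrow> norm (fst i) \<le> DIM('a) * \<sigma>"
    and "\<And>u x d. continuous_on UNIV u \<Longrightarrow> (\<And>y z. dist y z < e \<Longrightarrow> \<bar>u (x + y) - u (x + z)\<bar> \<le> d) \<Longrightarrow>
      \<bar>mollify \<sigma> u x - (\<Sum>i\<in>P. w i * u (x + fst i))\<bar> \<le> d"
proof -
  let ?B = "cbox (- (\<sigma> *\<^sub>R One)) (\<sigma> *\<^sub>R One) :: 'a set"
  let ?k = "mollifier_kernel \<sigma> :: 'a \<Rightarrow> real"
  note k = mollifier_kernel[OF \<sigma>, where 'a='a]
  have kint: "?k integrable_on cbox a b" for a b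
    by (intro integrable_continuous kernels_continuous[OF k(1)])
  obtain P where P: "P tagged_division_of ?B" and fine: "(\<lambda>y. ball y e) fine P"
    using fine_division_exists[of "\<lambda>y. ball y e" "- (\<sigma> *\<^sub>R One)" "\<sigma> *\<^sub>R One"] gauge_ball[OF e] by metis
  define w where "w i = integral (snd i) ?k" for i :: "'a \<times> 'a set"
  have fin: "finite P" using P by blast
  have box: "\<exists>a b. snd i = cbox a b" and sub: "snd i \<subseteq> ?B" and tag: "fst i \<in> snd i" if "i \<in> P" for i
    using tagged_division_ofD(2-4)[OF P, of "fst i" "snd i"] that by auto
  have wnn: "0 \<le> w i" if "i \<in> P" for i
    unfolding w_def using box[OF that] by (metis integral_nonneg k(2) kint)
  have wsum: "sum w P = 1"
    using integral_combine_tagged_division_topdown[OF kint P] k(3)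
    by (simp add: w_def split_beta)
  have approx: "\<bar>mollify \<sigma> u x - (\<Sum>i\<in>P. w i * u (x + fst i))\<bar> \<le> d"
    if u: "continuous_on UNIV u" and d: "\<And>y z. dist y z < e \<Longrightarrow> \<bar>u (x + y) - u (x + z)\<bar> \<le> d" for u x d
  proof -
    have gint: "(\<lambda>y. ?k y * u (x + y)) integrable_on cbox a b" for a b
      by (rule conv_integrable[OF k(1) u])
    have "mollify \<sigma> u x = (\<Sum>i\<in>P. integral (snd i) (\<lambda>y. ?k y * u (x + y)))"
      unfolding mollify_def conv_def
      using integral_combine_tagged_division_topdown[OF gint P] by (simp add: split_beta)
    then have "\<bar>mollify \<sigma> u x - (\<Sum>i\<in>P. w i * u (x + fst i))\<bar>
        = \<bar>\<Sum>i\<in>P. integral (snd i) (\<lambda>y. ?k y * u (x + y)) - w i * u (x + fst i)\<bar>"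
      by (simp add: sum_subtractf)
    also have "\<dots> \<le> (\<Sum>i\<in>P. w i * d)"
    proof (rule order.trans[OF sum_abs], rule sum_mono)
      fix i assume i: "i \<in> P"
      obtain a b where ab: "snd i = cbox a b" using box[OF i] by blast
      have cint: "(\<lambda>y. ?k y * c) integrable_on cbox a b" for c
        by (intro integrable_continuous continuous_intros kernels_continuous[OF k(1)])
      have "integral (snd i) (\<lambda>y. ?k y * u (x + y)) - w i * u (x + fst i)
          = integral (cbox a b) (\<lambda>y. ?k y * u (x + y) - ?k y * u (x + fst i))"
        unfolding w_def ab by (subst integral_diff) (auto simp: gint cint)
      also have "norm \<dots> \<le> integral (cbox a b) (\<lambda>y. ?k y * d)"
      proof (rule integral_norm_bound_integral)
        show "(\<lambda>y. ?k y * u (x + y) - ?k y * u (x + fst i)) integrable_on cbox a b"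
          by (intro integrable_diff gint cint)
        fix y assume y: "y \<in> cbox a b"
        have "snd i \<subseteq> ball (fst i) e"
          using fineD[OF fine, of "fst i" "snd i"] i by simp
        then have "dist y (fst i) < e" using y ab by (auto simp: dist_commute)
        from mult_left_mono[OF d[OF this] k(2)[of y]]
        show "norm (?k y * u (x + y) - ?k y * u (x + fst i)) \<le> ?k y * d"
          using k(2)[of y] by (simp add: abs_mult flip: right_diff_distrib)
      qed (rule cint)
      also have "\<dots> = w i * d" by (simp add: w_def ab)
      finally show "\<bar>integral (snd i) (\<lambda>y. ?k y * u (x + y)) - w i * u (x + fst i)\<bar> \<le> w i * d"
        by simp
    qed
    also have "\<dots> = d" by (simp add: wsum flip: sum_distrib_right)
    finally show ?thesis .
  qed
  show ?thesis
    by (rule that[of P w])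
       (use fin wnn wsum approx norm_le_of_mem_cube tag sub in \<open>auto, blast\<close>)
qed

section \<open>The weighted function spaces\<close>

lemma knorm_le: "(\<And>x. \<bar>f x\<bar> * \<kappa> x \<le> r) \<Longrightarrow> knorm \<kappa> f \<le> r"
  unfolding knorm_def by (rule cSUP_least) auto

lemma le_knorm: "f \<in> Ckappa \<kappa> \<Longrightarrow> \<bar>f x\<bar> * \<kappa> x \<le> knorm \<kappa> f"
  unfolding knorm_def Ckappa_def by (auto intro: cSUP_upper)

text \<open>
  From here on all norm bounds are used in this pointwise form, which avoids suprema.
\<close>

lemma Ckappa_ball_iff:
  "f \<in> Ckappa_ball \<kappa> r \<longleftrightarrow> continuous_on UNIV f \<and> (\<forall>x. \<bar>f x\<bar> * \<kappa> x \<le> r)"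
proof
  assume "f \<in> Ckappa_ball \<kappa> r"
  then show "continuous_on UNIV f \<and> (\<forall>x. \<bar>f x\<bar> * \<kappa> x \<le> r)"
    unfolding Ckappa_ball_def using le_knorm[of f \<kappa>] by (auto simp: Ckappa_def intro: order.trans)
next
  assume "continuous_on UNIV f \<and> (\<forall>x. \<bar>f x\<bar> * \<kappa> x \<le> r)"
  then show "f \<in> Ckappa_ball \<kappa> r"
    unfolding Ckappa_ball_def Ckappa_def by (auto intro!: knorm_le bdd_aboveI[of _ r])
qed

lemma Ckappa_ball_D: "f \<in> Ckappa_ball \<kappa> r \<Longrightarrow> \<bar>f x\<bar> * \<kappa> x \<le> r"
  by (simp add: Ckappa_ball_iff)

lemma Ckappa_ball_subset: "f \<in> Ckappa_ball \<kappa> r \<Longrightarrow> f \<in> Ckappa \<kappa>"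
  by (simp add: Ckappa_ball_def)

lemma Ckappa_ball_mono: "f \<in> Ckappa_ball \<kappa> r \<Longrightarrow> r \<le> s \<Longrightarrow> f \<in> Ckappa_ball \<kappa> s"
  by (simp add: Ckappa_ball_def)

lemma Ckappa_obtains_ball:
  assumes "f \<in> Ckappa \<kappa>"
  obtains R where "0 \<le> R" "f \<in> Ckappa_ball \<kappa> R"
  using that[of "max 0 (knorm \<kappa> f)"] assms by (simp add: Ckappa_ball_def)

lemma Ckappa_continuous: "f \<in> Ckappa \<kappa> \<Longrightarrow> continuous_on A f"
  unfolding Ckappa_def by (auto intro: continuous_on_subset)

lemma le_snorm_on:
  assumes "continuous_on K f" "compact K" "x \<in> K"
  shows "\<bar>f x\<bar> \<le> snorm_on K f"
proof -
  have "compact ((\<lambda>x. \<bar>f x\<bar>) ` K)"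
    using assms by (intro compact_continuous_image continuous_intros)
  then have "bdd_above (insert 0 ((\<lambda>x. \<bar>f x\<bar>) ` K))"
    by (simp add: bounded_imp_bdd_above compact_imp_bounded)
  then show ?thesis unfolding snorm_on_def using assms(3) by (intro cSup_upper) auto
qed

lemma snorm_on_le: "0 \<le> e \<Longrightarrow> (\<And>x. x \<in> K \<Longrightarrow> \<bar>f x\<bar> \<le> e) \<Longrightarrow> snorm_on K f \<le> e"
  unfolding snorm_on_def by (rule cSup_least) auto

lemma mixed_conv_ball:
  assumes "mixed_conv \<kappa> F f"
  obtains R where "0 \<le> R" "\<And>n. F n \<in> Ckappa_ball \<kappa> R" "f \<in> Ckappa_ball \<kappa> R"
proof -
  obtain R where R: "\<And>n. knorm \<kappa> (F n) \<le> R"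
    using assms unfolding mixed_conv_def bdd_above_def by auto
  have le: "knorm \<kappa> (F n) \<le> max 0 (max R (knorm \<kappa> f))" for n
    using R[of n] by linarith
  show ?thesis
    using assms le unfolding mixed_conv_def
    by (intro that[of "max 0 (max R (knorm \<kappa> f))"]) (auto simp: Ckappa_ball_def)
qed

lemma mixed_conv_uniform_on:
  assumes conv: "mixed_conv \<kappa> F f" and K: "compact K" and e: "0 < e"
  shows "\<exists>N. \<forall>n\<ge>N. \<forall>x\<in>K. \<bar>F n x - f x\<bar> \<le> e"
proof -
  have "(\<lambda>n. snorm_on K (\<lambda>x. F n x - f x)) \<longlonglongrightarrow> 0"
    using conv K by (simp add: mixed_conv_def)
  then obtain N where N: "\<And>n. n \<ge> N \<Longrightarrow> snorm_on K (\<lambda>x. F n x - f x) < e"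
    using order_tendstoD(2)[OF _ e] by (force simp: eventually_sequentially)
  have "\<bar>F n x - f x\<bar> \<le> e" if "n \<ge> N" "x \<in> K" for n x
  proof -
    have "F n \<in> Ckappa \<kappa>" "f \<in> Ckappa \<kappa>" using conv by (auto simp: mixed_conv_def)
    then have "continuous_on K (\<lambda>x. F n x - f x)"
      by (intro continuous_intros Ckappa_continuous)
    from le_snorm_on[OF this K that(2)] N[OF that(1)] show ?thesis by linarith
  qed
  then show ?thesis by blast
qed

lemma mixed_convI:
  assumes F: "\<And>n. F n \<in> Ckappa_ball \<kappa> R" and f: "f \<in> Ckappa \<kappa>"
    and unif: "\<And>K e. compact K \<Longrightarrow> 0 < e \<Longrightarrow> \<exists>N. \<forall>n\<ge>N. \<forall>x\<in>K. \<bar>F n x - f x\<bar> \<le> e"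
  shows "mixed_conv \<kappa> F f"
  unfolding mixed_conv_def
proof (intro conjI allI impI)
  show "F n \<in> Ckappa \<kappa>" for n using F by (rule Ckappa_ball_subset)
  show "bdd_above (range (\<lambda>n. knorm \<kappa> (F n)))"
    using F by (auto simp: Ckappa_ball_def intro!: bdd_aboveI[of _ R])
next
  fix K :: "'a set" assume K: "compact K"
  show "(\<lambda>n. snorm_on K (\<lambda>x. F n x - f x)) \<longlonglongrightarrow> 0"
  proof (rule LIMSEQ_I)
    fix e :: real assume e: "0 < e"
    obtain N where N: "\<forall>n\<ge>N. \<forall>x\<in>K. \<bar>F n x - f x\<bar> \<le> e / 2"
      using unif[OF K, of "e / 2"] e by auto
    have "norm (snorm_on K (\<lambda>x. F n x - f x) - 0) < e" if "n \<ge> N" for n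
    proof -
      have "snorm_on K (\<lambda>x. F n x - f x) \<le> e / 2"
        using N that e by (intro snorm_on_le) auto
      moreover have "0 \<le> snorm_on K (\<lambda>x. F n x - f x)"
        unfolding snorm_on_def
      proof (rule cSup_upper)
        have "\<bar>F n x - f x\<bar> \<le> e / 2" if "x \<in> K" for x using N \<open>n \<ge> N\<close> that by blast
        then show "bdd_above (insert 0 ((\<lambda>x. \<bar>F n x - f x\<bar>) ` K))"
          using e by (intro bdd_aboveI[of _ "e / 2"]) auto
      qed simp
      ultimately show ?thesis using e by simp
    qed
    then show "\<exists>N. \<forall>n\<ge>N. norm (snorm_on K (\<lambda>x. F n x - f x) - 0) < e" by blast
  qed
qed (rule f)

lemma Ckappa_ball_add:
  assumes "weight \<kappa>" "f \<in> Ckappa_ball \<kappa> a" "g \<in> Ckappa_ball \<kappa> b"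
  shows "(\<lambda>x. f x + g x) \<in> Ckappa_ball \<kappa> (a + b)"
  unfolding Ckappa_ball_iff
proof (intro conjI allI)
  show "continuous_on UNIV (\<lambda>x. f x + g x)"
    using assms by (intro continuous_intros) (auto simp: Ckappa_ball_iff)
  fix x
  have "\<bar>f x + g x\<bar> * \<kappa> x \<le> \<bar>f x\<bar> * \<kappa> x + \<bar>g x\<bar> * \<kappa> x"
    using assms(1) unfolding weight_def
    by (metis abs_triangle_ineq distrib_right less_imp_le mult_right_mono)
  then show "\<bar>f x + g x\<bar> * \<kappa> x \<le> a + b"
    using Ckappa_ball_D[OF assms(2), of x] Ckappa_ball_D[OF assms(3), of x] by linarith
qed

lemma Ckappa_ball_cmult:
  assumes "f \<in> Ckappa_ball \<kappa> a"
  shows "(\<lambda>x. c * f x) \<in> Ckappa_ball \<kappa> (\<bar>c\<bar> * a)"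
  using assms unfolding Ckappa_ball_iff
  by (auto intro!: continuous_intros mult_left_mono simp: abs_mult mult.assoc)

lemma Ckappa_ball_diff:
  assumes "weight \<kappa>" "f \<in> Ckappa_ball \<kappa> a" "g \<in> Ckappa_ball \<kappa> b"
  shows "(\<lambda>x. f x - g x) \<in> Ckappa_ball \<kappa> (a + b)"
  using Ckappa_ball_add[OF assms(1,2) Ckappa_ball_cmult[OF assms(3), of "-1"]] by simp

lemma Ckappa_add: "weight \<kappa> \<Longrightarrow> f \<in> Ckappa \<kappa> \<Longrightarrow> g \<in> Ckappa \<kappa> \<Longrightarrow> (\<lambda>x. f x + g x) \<in> Ckappa \<kappa>"
  by (elim Ckappa_obtains_ball) (rule Ckappa_ball_subset[OF Ckappa_ball_add])

lemma Ckappa_diff: "weight \<kappa> \<Longrightarrow> f \<in> Ckappa \<kappa> \<Longrightarrow> g \<in> Ckappa \<kappa> \<Longrightarrow> (\<lambda>x. f x - g x) \<in> Ckappa \<kappa>"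
  by (elim Ckappa_obtains_ball) (rule Ckappa_ball_subset[OF Ckappa_ball_diff])

lemma Ckappa_cmult: "f \<in> Ckappa \<kappa> \<Longrightarrow> (\<lambda>x. c * f x) \<in> Ckappa \<kappa>"
  by (elim Ckappa_obtains_ball) (rule Ckappa_ball_subset[OF Ckappa_ball_cmult])

lemma weight_pos: "weight \<kappa> \<Longrightarrow> 0 < \<kappa> x"
  by (simp add: weight_def)

lemma weight_bounded:
  assumes "weight \<kappa>"
  obtains B where "0 < B" "\<And>x. \<kappa> x \<le> B"
proof -
  obtain B where "\<And>x. norm (\<kappa> x) \<le> B"
    using assms unfolding weight_def bounded_iff by auto
  then show ?thesis using that[of "max B 1"] by (simp add: abs_le_iff le_max_iff_disj)
qed

lemma weight_translation_bound:
  assumes "weight \<kappa>"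
  obtains C where "1 \<le> C" "\<And>x y. norm y \<le> 1 \<Longrightarrow> \<kappa> x \<le> C * \<kappa> (x + y)"
proof -
  obtain C where C: "\<And>x y. norm y \<le> 1 \<Longrightarrow> \<kappa> x / \<kappa> (x - y) \<le> C"
    using assms unfolding weight_def bdd_above_def by blast
  show ?thesis
  proof (rule that)
    show "1 \<le> C" using C[of 0 0] weight_pos[OF assms] by (simp add: less_imp_neq[symmetric])
    show "\<kappa> x \<le> C * \<kappa> (x + y)" if "norm y \<le> 1" for x y
      using C[of "- y" x] that weight_pos[OF assms, of "x + y"] by (simp add: field_simps)
  qed
qed

lemma Ckappa_ball_divide_weight:
  assumes "weight \<kappa>"
  shows "(\<lambda>x. c / \<kappa> x) \<in> Ckappa_ball \<kappa> \<bar>c\<bar>"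
proof -
  have pos: "0 < \<kappa> x" for x using assms by (rule weight_pos)
  have "\<kappa> x \<noteq> 0" for x using pos[of x] by simp
  then show ?thesis
    unfolding Ckappa_ball_iff using pos assms
    by (auto intro!: continuous_intros simp: weight_def abs_mult field_simps abs_of_pos)
qed

lemma bounded_in_Ckappa_ball:
  assumes "weight \<kappa>" "continuous_on UNIV f" "\<And>x. \<bar>f x\<bar> \<le> r" "\<And>x. \<kappa> x \<le> B"
  shows "f \<in> Ckappa_ball \<kappa> (r * B)"
  unfolding Ckappa_ball_iff
proof (intro conjI allI)
  fix x
  have "0 \<le> r" using assms(3)[of x] by linarith
  then show "\<bar>f x\<bar> * \<kappa> x \<le> r * B"
    using weight_pos[OF assms(1), of x] by (intro mult_mono assms) auto
qed (rule assms(2))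

lemma Lip_b_continuous: "f \<in> Lip_b r \<Longrightarrow> continuous_on A f"
  unfolding Lip_b_def by (auto intro: lipschitz_on_continuous_on continuous_on_subset)

lemma Lip_b_in_Ckappa_ball:
  assumes "weight \<kappa>" "f \<in> Lip_b r" "\<And>x. \<kappa> x \<le> B"
  shows "f \<in> Ckappa_ball \<kappa> (r * B)"
  using assms Lip_b_continuous[OF assms(2)] by (intro bounded_in_Ckappa_ball) (auto simp: Lip_b_def)

lemma Lip_b_in_Ckappa:
  assumes "weight \<kappa>" "f \<in> Lip_b r"
  shows "f \<in> Ckappa \<kappa>"
  using weight_bounded[OF assms(1)] Lip_b_in_Ckappa_ball[OF assms] Ckappa_ball_subset by metis

lemma Lip_b_D: "f \<in> Lip_b r \<Longrightarrow> \<bar>f x - f y\<bar> \<le> r * dist x y"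
  unfolding Lip_b_def by (auto dest: lipschitz_onD simp: dist_real_def)

lemma Lip_b_I:
  "0 \<le> r \<Longrightarrow> (\<And>x y. \<bar>f x - f y\<bar> \<le> r * dist x y) \<Longrightarrow> (\<And>x. \<bar>f x\<bar> \<le> r) \<Longrightarrow> f \<in> Lip_b r"
  unfolding Lip_b_def by (auto intro!: lipschitz_onI simp: dist_real_def)

lemma Lip_b_mono: "f \<in> Lip_b s \<Longrightarrow> s \<le> r \<Longrightarrow> f \<in> Lip_b r"
  unfolding Lip_b_def by (auto intro: lipschitz_on_mono order.trans)

lemma Lip_b_shift: "f \<in> Lip_b r \<Longrightarrow> shift x f \<in> Lip_b r"
proof -
  assume f: "f \<in> Lip_b r"
  then have "0 \<le> r" by (auto simp: Lip_b_def lipschitz_on_def)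
  then show ?thesis
    unfolding shift_def
  proof (rule Lip_b_I)
    show "\<bar>f (x + y) - f (x + z)\<bar> \<le> r * dist y z" for y z
      using Lip_b_D[OF f, of "x + y" "x + z"] by simp
    show "\<bar>f (x + y)\<bar> \<le> r" for y using f by (auto simp: Lip_b_def)
  qed
qed

lemma Cb_infty_Lip_b:
  fixes g :: "'a::euclidean_space \<Rightarrow> real"
  assumes "g \<in> Cb_infty"
  obtains r where "0 \<le> r" "g \<in> Lip_b r"
proof -
  have diff: "g differentiable (at x)" for x
    using assms unfolding Cb_infty_def by (auto dest: spec[of _ "[]"])
  obtain B0 where B0: "\<And>x. \<bar>g x\<bar> \<le> B0"
  proof -
    have "bounded (range (partials [] g))"
      using assms unfolding Cb_infty_def by (auto dest: spec[of _ "[]"])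
    then show ?thesis using that by (auto simp: bounded_iff)
  qed
  have "\<exists>B. \<forall>x. \<bar>frechet_derivative g (at x) b\<bar> \<le> B" if "b \<in> Basis" for b
  proof -
    have "bounded (range (partials [b] g))"
      using assms that unfolding Cb_infty_def by (auto dest: spec[of _ "[b]"])
    then show ?thesis by (auto simp: bounded_iff)
  qed
  then obtain B where B: "\<And>b x. b \<in> Basis \<Longrightarrow> \<bar>frechet_derivative g (at x) b\<bar> \<le> B b"
    by metis
  define D where "D x = frechet_derivative g (at x)" for x
  have D: "(g has_derivative D x) (at x)" for x
    unfolding D_def using diff frechet_derivative_works by blast
  define L where "L = max (max B0 0) (sum B Basis)"
  have on: "onorm (D x) \<le> L" for x
  proof (rule onorm_bound)
    show "0 \<le> L" by (simp add: L_def)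
    fix v
    have lin: "linear (D x)" using D[of x] has_derivative_linear by blast
    have "D x v = D x (\<Sum>b\<in>Basis. (v \<bullet> b) *\<^sub>R b)" by (simp add: euclidean_representation)
    also have "\<dots> = (\<Sum>b\<in>Basis. (v \<bullet> b) * D x b)"
      by (simp add: linear_sum[OF lin] linear_scale[OF lin])
    also have "norm \<dots> \<le> (\<Sum>b\<in>Basis. norm v * B b)"
    proof (rule order.trans[OF norm_sum], rule sum_mono)
      fix b :: 'a assume b: "b \<in> Basis"
      show "norm ((v \<bullet> b) * D x b) \<le> norm v * B b"
        using mult_mono[OF Basis_le_norm[OF b, of v] B[OF b, of x]] by (simp add: D_def abs_mult)
    qed
    also have "\<dots> = sum B Basis * norm v" by (simp add: sum_distrib_left mult.commute)
    also have "\<dots> \<le> L * norm v" by (intro mult_right_mono) (auto simp: L_def)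
    finally show "norm (D x v) \<le> L * norm v" .
  qed
  have "0 \<le> L" by (simp add: L_def)
  moreover have "g \<in> Lip_b L"
  proof (rule Lip_b_I)
    show "\<bar>g x - g y\<bar> \<le> L * dist x y" for x y
      using differentiable_bound[of UNIV g D L x y] D on by (auto simp: dist_norm norm_minus_commute)
    show "\<bar>g x\<bar> \<le> L" for x using B0[of x] by (simp add: L_def)
  qed (simp add: L_def)
  ultimately show ?thesis by (rule that)
qed

text \<open>
  The weight changes by at most the factor \<open>C\<close> within distance \<open>1\<close>, so mollification of radius at
  most \<open>1\<close> is bounded in the weighted norm.
\<close>

lemma mollify_in_Ckappa_ball:
  fixes u :: "'a::euclidean_space \<Rightarrow> real" and \<sigma> :: real
  assumes w: "weight \<kappa>" and C: "\<And>x y. norm y \<le> 1 \<Longrightarrow> \<kappa> x \<le> C * \<kappa> (x + y)" "0 \<le> C"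
    and \<sigma>: "0 < \<sigma>" "DIM('a) * \<sigma> \<le> 1" and u: "u \<in> Ckappa_ball \<kappa> R" "0 \<le> R" and B: "\<And>x. \<bar>u x\<bar> \<le> B"
  shows "mollify \<sigma> u \<in> Ckappa_ball \<kappa> (C * R)"
  unfolding Ckappa_ball_iff
proof (intro conjI allI)
  have uc: "continuous_on UNIV u" using u by (simp add: Ckappa_ball_iff)
  have "mollify \<sigma> u \<in> Cb_infty" using mollify_Cb_infty[OF \<sigma>(1) uc B] .
  then show "continuous_on UNIV (mollify \<sigma> u)" using Cb_infty_Lip_b Lip_b_continuous by metis
  fix x
  have pos: "0 < \<kappa> z" for z using w by (rule weight_pos)
  have "\<bar>u (x + y) - 0\<bar> \<le> C * R / \<kappa> x" if "norm y \<le> DIM('a) * \<sigma>" for y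
  proof -
    have "\<bar>u (x + y)\<bar> * \<kappa> x \<le> \<bar>u (x + y)\<bar> * (C * \<kappa> (x + y))"
      using that \<sigma> by (intro mult_left_mono C) auto
    also have "\<dots> = C * (\<bar>u (x + y)\<bar> * \<kappa> (x + y))" by simp
    also have "\<dots> \<le> C * R" by (intro mult_left_mono Ckappa_ball_D u C)
    finally show ?thesis using pos[of x] by (simp add: field_simps)
  qed
  from mollify_near[OF \<sigma>(1) uc this] show "\<bar>mollify \<sigma> u x\<bar> * \<kappa> x \<le> C * R"
    using pos[of x] by (simp add: field_simps)
qed

text \<open>
  Cut off \<open>f\<close> outside a large ball and mollify. The radius \<open>C * R\<close> depends neither on the compact set
  nor on the accuracy; this is needed because equicontinuity determines the compact set only after
  a radius has been fixed.
\<close>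

lemma Cb_infty_dense:
  fixes \<kappa> :: "'a::euclidean_space \<Rightarrow> real"
  assumes w: "weight \<kappa>"
  obtains C where "1 \<le> C"
    "\<And>R f K d. 0 \<le> R \<Longrightarrow> f \<in> Ckappa_ball \<kappa> R \<Longrightarrow> compact K \<Longrightarrow> 0 < d \<Longrightarrow>
      \<exists>g\<in>Cb_infty. g \<in> Ckappa_ball \<kappa> (C * R) \<and> (\<forall>x\<in>K. \<bar>g x - f x\<bar> \<le> d)"
proof -
  obtain C where C: "1 \<le> C" "\<And>x y. norm y \<le> 1 \<Longrightarrow> \<kappa> x \<le> C * \<kappa> (x + y)"
    using weight_translation_bound[OF w] by blast
  have "\<exists>g\<in>Cb_infty. g \<in> Ckappa_ball \<kappa> (C * R) \<and> (\<forall>x\<in>K. \<bar>g x - f x\<bar> \<le> d)"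
    if R: "0 \<le> R" and f: "f \<in> Ckappa_ball \<kappa> R" and K: "compact K" and d: "0 < d" for R f K d
  proof -
    obtain m where m: "\<And>x. x \<in> K \<Longrightarrow> norm x \<le> m"
      using compact_imp_bounded[OF K] by (auto simp: bounded_iff)
    define u where "u x = f x * max 0 (min 1 (m + 2 - norm x))" for x
    have fc: "continuous_on A f" for A
      using f by (auto simp: Ckappa_ball_iff intro: continuous_on_subset)
    have uc: "continuous_on UNIV u"
      unfolding u_def by (intro continuous_intros fc)
    have uf: "\<bar>u x\<bar> \<le> \<bar>f x\<bar>" for x
      unfolding u_def abs_mult by (rule mult_left_le) auto
    have uR: "u \<in> Ckappa_ball \<kappa> R"
      unfolding Ckappa_ball_iff
    proof (intro conjI allI)
      show "\<bar>u x\<bar> * \<kappa> x \<le> R" for x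
        using mult_right_mono[OF uf[of x], of "\<kappa> x"] weight_pos[OF w, of x] Ckappa_ball_D[OF f, of x]
        by linarith
    qed (rule uc)
    have "compact (f ` cball 0 (m + 2))" by (intro compact_continuous_image fc compact_cball)
    then obtain B where B: "\<And>x. norm x \<le> m + 2 \<Longrightarrow> \<bar>f x\<bar> \<le> B"
      using compact_imp_bounded by (force simp: bounded_iff)
    have uB: "\<bar>u x\<bar> \<le> max B 0" for x
    proof (cases "norm x \<le> m + 2")
      case True
      then show ?thesis using uf[of x] B[of x] by simp
    qed (auto simp: u_def)
    have "uniformly_continuous_on (cball 0 (m + 1)) f"
      by (intro compact_uniformly_continuous fc compact_cball)
    then obtain \<delta> where \<delta>: "0 < \<delta>" "\<And>x y. norm x \<le> m + 1 \<Longrightarrow> norm y \<le> m + 1 \<Longrightarrow> dist y x < \<delta> \<Longrightarrow> dist (f y) (f x) < d"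
      using d unfolding uniformly_continuous_on_def by auto
    define \<sigma> where "\<sigma> = min 1 (\<delta> / 2) / DIM('a)"
    have \<sigma>: "0 < \<sigma>" "DIM('a) * \<sigma> \<le> 1" "DIM('a) * \<sigma> < \<delta>"
      using \<delta>(1) by (auto simp: \<sigma>_def)
    show ?thesis
    proof (intro bexI conjI ballI)
      show "mollify \<sigma> u \<in> Cb_infty" by (rule mollify_Cb_infty[OF \<sigma>(1) uc uB])
      show "mollify \<sigma> u \<in> Ckappa_ball \<kappa> (C * R)"
        by (rule mollify_in_Ckappa_ball[OF w C(2) _ \<sigma>(1,2) uR R uB]) (use C in auto)
      fix x assume x: "x \<in> K"
      show "\<bar>mollify \<sigma> u x - f x\<bar> \<le> d"
      proof (rule mollify_near[OF \<sigma>(1) uc])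
        fix y :: 'a assume y: "norm y \<le> DIM('a) * \<sigma>"
        have n: "norm (x + y) \<le> m + 1" using norm_triangle_ineq[of x y] m[OF x] y \<sigma> by linarith
        then have "u (x + y) = f (x + y)" by (simp add: u_def)
        then show "\<bar>u (x + y) - f x\<bar> \<le> d"
          using \<delta>(2)[of x "x + y"] n m[OF x] y \<sigma>(3) by (simp add: dist_real_def dist_norm)
      qed
    qed
  qed
  then show ?thesis using that[of C] C(1) by blast
qed

lemma mixed_conv_add:
  assumes w: "weight \<kappa>" and F: "mixed_conv \<kappa> F f" and G: "mixed_conv \<kappa> G g"
  shows "mixed_conv \<kappa> (\<lambda>n x. F n x + G n x) (\<lambda>x. f x + g x)"
proof -
  obtain R where "0 \<le> R" and R: "\<And>n. F n \<in> Ckappa_ball \<kappa> R" "f \<in> Ckappa_ball \<kappa> R"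
    using mixed_conv_ball[OF F] by blast
  obtain Q where "0 \<le> Q" and Q: "\<And>n. G n \<in> Ckappa_ball \<kappa> Q" "g \<in> Ckappa_ball \<kappa> Q"
    using mixed_conv_ball[OF G] by blast
  show ?thesis
  proof (rule mixed_convI)
    show "(\<lambda>x. F n x + G n x) \<in> Ckappa_ball \<kappa> (R + Q)" for n
      by (intro Ckappa_ball_add[OF w] R Q)
    show "(\<lambda>x. f x + g x) \<in> Ckappa \<kappa>"
      using Ckappa_ball_add[OF w R(2) Q(2)] by (rule Ckappa_ball_subset)
    fix K :: "'a set" and e :: real assume K: "compact K" and e: "0 < e"
    obtain N M where N: "\<forall>n\<ge>N. \<forall>x\<in>K. \<bar>F n x - f x\<bar> \<le> e / 2" and M: "\<forall>n\<ge>M. \<forall>x\<in>K. \<bar>G n x - g x\<bar> \<le> e / 2"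
      using mixed_conv_uniform_on[OF F K half_gt_zero[OF e]]
        mixed_conv_uniform_on[OF G K half_gt_zero[OF e]] by blast
    have "\<bar>F n x + G n x - (f x + g x)\<bar> \<le> e" if "n \<ge> max N M" "x \<in> K" for n x
    proof -
      have "\<bar>F n x - f x\<bar> \<le> e / 2" "\<bar>G n x - g x\<bar> \<le> e / 2" using N M that by auto
      then show ?thesis by linarith
    qed
    then show "\<exists>N. \<forall>n\<ge>N. \<forall>x\<in>K. \<bar>F n x + G n x - (f x + g x)\<bar> \<le> e" by blast
  qed
qed

lemma mixed_conv_cmult:
  fixes c :: "nat \<Rightarrow> real"
  assumes w: "weight \<kappa>" and F: "mixed_conv \<kappa> F f" and c: "c \<longlonglongrightarrow> d"
  shows "mixed_conv \<kappa> (\<lambda>n x. c n * F n x) (\<lambda>x. d * f x)"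
proof -
  obtain R where R: "0 \<le> R" "\<And>n. F n \<in> Ckappa_ball \<kappa> R" "f \<in> Ckappa_ball \<kappa> R"
    using mixed_conv_ball[OF F] by blast
  obtain M where M: "0 < M" "\<And>n. \<bar>c n\<bar> \<le> M"
    using BseqE[OF convergent_imp_Bseq[OF convergentI[OF c]]] by auto
  show ?thesis
  proof (rule mixed_convI)
    show "(\<lambda>x. c n * F n x) \<in> Ckappa_ball \<kappa> (M * R)" for n
      by (rule Ckappa_ball_mono[OF Ckappa_ball_cmult[OF R(2)]]) (intro mult_right_mono M R)
    show "(\<lambda>x. d * f x) \<in> Ckappa \<kappa>"
      by (intro Ckappa_cmult Ckappa_ball_subset[OF R(3)])
    fix K :: "'a set" and e :: real assume K: "compact K" and e: "0 < e"
    have "compact (f ` K)"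
      using R(3) K by (intro compact_continuous_image Ckappa_continuous[OF Ckappa_ball_subset])
    then obtain B where B: "0 < B" "\<And>x. x \<in> K \<Longrightarrow> \<bar>f x\<bar> \<le> B"
      using compact_imp_bounded bounded_pos[of "f ` K"] by auto
    obtain N where N: "\<forall>n\<ge>N. \<forall>x\<in>K. \<bar>F n x - f x\<bar> \<le> e / (2 * M)"
      using mixed_conv_uniform_on[OF F K, of "e / (2 * M)"] e M by auto
    have "0 < e / (2 * B)" using e B by simp
    from LIMSEQ_D[OF c this] obtain N' where N': "\<And>n. n \<ge> N' \<Longrightarrow> \<bar>c n - d\<bar> < e / (2 * B)"
      by auto
    have "\<bar>c n * F n x - d * f x\<bar> \<le> e" if n: "n \<ge> max N N'" and x: "x \<in> K" for n x
    proof -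
      have "c n * F n x - d * f x = c n * (F n x - f x) + (c n - d) * f x" by (simp add: algebra_simps)
      also have "\<bar>\<dots>\<bar> \<le> \<bar>c n\<bar> * \<bar>F n x - f x\<bar> + \<bar>c n - d\<bar> * \<bar>f x\<bar>"
        by (metis abs_mult abs_triangle_ineq)
      also have "\<dots> \<le> M * (e / (2 * M)) + e / (2 * B) * B"
        using N N'[of n] n x M B e by (intro add_mono mult_mono) (auto intro: less_imp_le)
      also have "\<dots> = e" using M B by simp
      finally show ?thesis .
    qed
    then show "\<exists>N. \<forall>n\<ge>N. \<forall>x\<in>K. \<bar>c n * F n x - d * f x\<bar> \<le> e" by blast
  qed
qed

lemma mixed_conv_const: "f \<in> Ckappa \<kappa> \<Longrightarrow> mixed_conv \<kappa> (\<lambda>n. f) f"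
  by (rule Ckappa_obtains_ball) (auto intro: mixed_convI)

lemma Cb_infty_Ckappa: "weight \<kappa> \<Longrightarrow> g \<in> Cb_infty \<Longrightarrow> g \<in> Ckappa \<kappa>"
  using Cb_infty_Lip_b Lip_b_in_Ckappa by metis

section \<open>Convex monotone operators and mixed convergence\<close>

lemma convex_opD:
  assumes "convex_op \<kappa> A" "f \<in> Ckappa \<kappa>" "g \<in> Ckappa \<kappa>" "0 \<le> l" "l \<le> 1"
  shows "A (\<lambda>x. l * f x + (1 - l) * g x) x \<le> l * A f x + (1 - l) * A g x"
proof -
  have "A (\<lambda>x. l * f x + (1 - l) * g x) \<le> (\<lambda>x. l * A f x + (1 - l) * A g x)"
    using assms unfolding convex_op_def by auto
  then show ?thesis by (rule le_funD)
qed

text \<open>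
  For \<open>l \<rightarrow> 0\<close> this gives a rate: whatever the increment in the direction \<open>g\<close> is, the increment in the
  direction \<open>l g\<close> is at most its \<open>l\<close>-fold.
\<close>

lemma convex_op_add_scaled:
  assumes w: "weight \<kappa>" and A: "convex_op \<kappa> A" and f: "f \<in> Ckappa \<kappa>" and g: "g \<in> Ckappa \<kappa>"
    and l: "0 \<le> l" "l \<le> 1"
  shows "A (\<lambda>x. f x + l * g x) x \<le> A f x + l * (A (\<lambda>x. f x + g x) x - A f x)"
proof -
  have "(\<lambda>x. l * (f x + g x) + (1 - l) * f x) = (\<lambda>x. f x + l * g x)"
    by (auto simp: algebra_simps)
  with convex_opD[OF A Ckappa_add[OF w f g] f l, of x] show ?thesis
    by (simp add: algebra_simps)
qed

lemma monotone_opD: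
  assumes "monotone_op \<kappa> A" "f \<in> Ckappa \<kappa>" "g \<in> Ckappa \<kappa>" "\<And>x. f x \<le> g x"
  shows "A f x \<le> A g x"
  using assms unfolding monotone_op_def by (auto simp: le_fun_def)

lemma convex_op_average:
  assumes w: "weight \<kappa>" and A: "convex_op \<kappa> A"
    and "finite P" "P \<noteq> {}" "\<And>i. i \<in> P \<Longrightarrow> 0 \<le> c i" "sum c P = 1" "\<And>i. i \<in> P \<Longrightarrow> F i \<in> Ckappa \<kappa>"
  shows "(\<lambda>x. \<Sum>i\<in>P. c i * F i x) \<in> Ckappa \<kappa> \<and> A (\<lambda>x. \<Sum>i\<in>P. c i * F i x) x \<le> (\<Sum>i\<in>P. c i * A (F i) x)"
  using assms(3-7)
proof (induction P arbitrary: c rule: finite_ne_induct)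
  case (singleton i)
  then show ?case by simp
next
  case (insert i P)
  have F: "F j \<in> Ckappa \<kappa>" if "j \<in> insert i P" for j using insert.prems that by blast
  have c: "0 \<le> c i" "c i + sum c P = 1" using insert.prems insert.hyps by auto
  have cP: "0 \<le> sum c P" using insert.prems by (intro sum_nonneg) auto
  show ?case
  proof (cases "sum c P = 0")
    case True
    then have "c j = 0" if "j \<in> P" for j
      using sum_nonneg_eq_0_iff[OF insert.hyps(1), of c] insert.prems that by auto
    then show ?thesis using insert.hyps c True F by simp
  next
    case False
    define s where "s = sum c P"
    have s: "0 < s" "c i = 1 - s" using False cP c by (auto simp: s_def)
    define d where "d j = c j / s" for j
    have d: "c j = s * d j" for j using s by (simp add: d_def)
    have IH: "(\<lambda>x. \<Sum>j\<in>P. d j * F j x) \<in> Ckappa \<kappa>"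
      "A (\<lambda>x. \<Sum>j\<in>P. d j * F j x) x \<le> (\<Sum>j\<in>P. d j * A (F j) x)"
      using insert.IH[of d] insert.prems s
      by (auto simp: d_def s_def simp flip: sum_divide_distrib)
    have split: "(\<Sum>j\<in>insert i P. c j * G j) = s * (\<Sum>j\<in>P. d j * G j) + (1 - s) * G i" for G
      using insert.hyps s(2) d by (simp add: sum_distrib_left mult.assoc)
    have "s \<le> 1" using s c by linarith
    then have "A (\<lambda>x. s * (\<Sum>j\<in>P. d j * F j x) + (1 - s) * F i x) x
        \<le> s * A (\<lambda>x. \<Sum>j\<in>P. d j * F j x) x + (1 - s) * A (F i) x"
      using s by (intro convex_opD[OF A IH(1) F]) auto
    also have "\<dots> \<le> s * (\<Sum>j\<in>P. d j * A (F j) x) + (1 - s) * A (F i) x"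
      using s IH(2) by simp
    finally show ?thesis
      unfolding split using F by (auto intro!: Ckappa_add[OF w] Ckappa_cmult IH)
  qed
qed

text \<open>
  The sequence is dominated by \<open>f + G j\<close>, where \<open>G j\<close> is \<open>1 / (j + 1)\<close> on the ball of radius \<open>j\<close> and
  grows to a multiple of \<open>1 / \<kappa>\<close> outside. Since \<open>G j\<close> decreases to zero, continuity from above
  applies to multiples of \<open>G j\<close>, and convexity transfers it from the base point \<open>0\<close> to \<open>f\<close>:
  \<open>f + G j\<close> is the convex combination of \<open>f\<close>, \<open>2 f\<close> and \<open>2 / \<mu> * G j\<close> with weights \<open>1 - \<mu>\<close>, \<open>\<mu> / 2\<close>
  and \<open>\<mu> / 2\<close>.
\<close>

lemma mixed_continuous_upper:
  fixes A :: "('a::euclidean_space \<Rightarrow> real) \<Rightarrow> 'a \<Rightarrow> real"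
  assumes w: "weight \<kappa>" and cvx: "convex_op \<kappa> A" and mono: "monotone_op \<kappa> A"
    and above: "\<And>F. (\<And>n. F n \<in> Ckappa \<kappa>) \<Longrightarrow> decreases_to_zero F \<Longrightarrow> decreases_to_zero (\<lambda>n. A (F n))"
    and conv: "mixed_conv \<kappa> F f" and e: "0 < e"
  shows "\<exists>N. \<forall>n\<ge>N. A (F n) x \<le> A f x + e"
proof -
  obtain R where R: "0 \<le> R" "\<And>n. F n \<in> Ckappa_ball \<kappa> R" "f \<in> Ckappa_ball \<kappa> R"
    using mixed_conv_ball[OF conv] by blast
  note FC = R(2)[THEN Ckappa_ball_subset] and fC = R(3)[THEN Ckappa_ball_subset]
  have pos: "0 < \<kappa> z" for z using w by (rule weight_pos)
  then have nz: "\<kappa> z \<noteq> 0" for z by (metis less_irrefl)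
  obtain B where B: "0 < B" "\<And>x. \<kappa> x \<le> B" using weight_bounded[OF w] by blast
  define G where "G j z = 1 / real (Suc j) + 2 * R / \<kappa> z * min 1 (max 0 (norm z - real j))" for j z
  have G0: "0 \<le> G j z" for j z
    unfolding G_def using R(1) pos[of z] by (intro add_nonneg_nonneg mult_nonneg_nonneg divide_nonneg_pos) auto
  have GC: "G j \<in> Ckappa \<kappa>" for j
  proof -
    have "G j \<in> Ckappa_ball \<kappa> (1 * B + 2 * R)"
      unfolding Ckappa_ball_iff
    proof (intro conjI allI)
      show "continuous_on UNIV (G j)"
        unfolding G_def using w nz by (intro continuous_intros) (auto simp: weight_def)
      fix z
      have "2 * R / \<kappa> z * min 1 (max 0 (norm z - real j)) \<le> 2 * R / \<kappa> z * 1"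
        using R(1) pos[of z] by (intro mult_left_mono) auto
      moreover have "1 / real (Suc j) \<le> 1" by simp
      ultimately have "G j z \<le> 1 + 2 * R / \<kappa> z" unfolding G_def by linarith
      then have "G j z * \<kappa> z \<le> (1 + 2 * R / \<kappa> z) * \<kappa> z"
        using pos[of z] by (intro mult_right_mono) auto
      also have "\<dots> = \<kappa> z + 2 * R" using nz[of z] by (simp add: distrib_right)
      finally show "\<bar>G j z\<bar> * \<kappa> z \<le> 1 * B + 2 * R" using G0[of j z] B(2)[of z] by simp
    qed
    then show ?thesis by (rule Ckappa_ball_subset)
  qed
  have Gdec: "decreases_to_zero (\<lambda>j z. c * G j z)" if c: "0 \<le> c" for c
    unfolding decreases_to_zero_def
  proof (intro conjI allI)
    show "decseq (\<lambda>j z. c * G j z)"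
    proof (rule antimonoI, rule le_funI)
      fix i j :: nat and z :: 'a assume ij: "i \<le> j"
      have "min 1 (max 0 (norm z - real j)) \<le> min 1 (max 0 (norm z - real i))"
        using ij by linarith
      then have "2 * R / \<kappa> z * min 1 (max 0 (norm z - real j)) \<le> 2 * R / \<kappa> z * min 1 (max 0 (norm z - real i))"
        using R(1) pos[of z] by (intro mult_left_mono) auto
      moreover have "1 / real (Suc j) \<le> 1 / real (Suc i)" using ij by (simp add: frac_le)
      ultimately show "c * G j z \<le> c * G i z"
        unfolding G_def by (intro mult_left_mono c) linarith
    qed
    fix z :: 'a
    have "(\<lambda>j. c * (1 / real (Suc j))) \<longlonglongrightarrow> c * 0"
      by (intro tendsto_intros LIMSEQ_Suc[OF lim_1_over_n])
    moreover have "\<forall>\<^sub>F j in sequentially. c * (1 / real (Suc j)) = c * G j z"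
    proof -
      obtain J :: nat where "norm z \<le> real J" using real_arch_simple by blast
      then have "c * (1 / real (Suc j)) = c * G j z" if "j \<ge> J" for j
      proof -
        have "max 0 (norm z - real j) = 0" using \<open>norm z \<le> real J\<close> that by simp
        then show ?thesis by (simp add: G_def)
      qed
      then show ?thesis unfolding eventually_sequentially by blast
    qed
    ultimately show "(\<lambda>j. c * G j z) \<longlonglongrightarrow> 0"
      by (auto intro: Lim_transform_eventually)
  qed
  \<comment> \<open>with \<open>\<mu> M \<le> e / 2\<close> the values of \<open>A\<close> at \<open>f\<close> and \<open>2 f\<close> contribute at most \<open>e / 2\<close>\<close>
  define M where "M = \<bar>A f x\<bar> + \<bar>A (\<lambda>z. 2 * f z) x\<bar> + 1"
  define \<mu> where "\<mu> = min 1 (e / (2 * M))"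
  have M: "0 < M" by (simp add: M_def add_nonneg_pos)
  have \<mu>: "0 < \<mu>" "\<mu> \<le> 1" "\<mu> * M \<le> e / 2"
    using e M by (auto simp: \<mu>_def min_def field_simps)
  define H where "H j z = 2 / \<mu> * G j z" for j z
  have HC: "H j \<in> Ckappa \<kappa>" for j unfolding H_def by (intro Ckappa_cmult GC)
  have "decreases_to_zero (\<lambda>j. A (H j))"
    by (rule above) (use HC Gdec[of "2 / \<mu>"] \<mu> in \<open>auto simp: H_def[abs_def]\<close>)
  then have "(\<lambda>j. A (H j) x) \<longlonglongrightarrow> 0" by (simp add: decreases_to_zero_def)
  then have "\<forall>\<^sub>F j in sequentially. A (H j) x < e"
    using e by (rule order_tendstoD(2))
  then have "\<exists>j. A (H j) x < e" by (auto simp: eventually_sequentially)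
  then obtain j where j: "A (H j) x \<le> e" by (auto dest: less_imp_le)
  have "A (\<lambda>z. f z + G j z) x = A (\<lambda>z. f z + \<mu> * (1 / \<mu> * G j z)) x"
    using \<mu> by simp
  also have "\<dots> \<le> A f x + \<mu> * (A (\<lambda>z. f z + 1 / \<mu> * G j z) x - A f x)"
    using \<mu> by (intro convex_op_add_scaled[OF w cvx fC] Ckappa_cmult GC) auto
  also have "A (\<lambda>z. f z + 1 / \<mu> * G j z) x \<le> A (\<lambda>z. 2 * f z) x / 2 + A (H j) x / 2"
  proof -
    have "(\<lambda>z. 1 / 2 * (2 * f z) + (1 - 1 / 2) * H j z) = (\<lambda>z. f z + 1 / \<mu> * G j z)"
      by (auto simp: H_def)
    with convex_opD[OF cvx Ckappa_cmult[OF fC, of 2] HC[of j], of "1/2" x] show ?thesis by simp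
  qed
  finally have "A (\<lambda>z. f z + G j z) x \<le> A f x + \<mu> * (A (\<lambda>z. 2 * f z) x / 2 + A (H j) x / 2 - A f x)"
    using \<mu> by (simp add: mult_left_mono)
  also have "\<dots> \<le> A f x + \<mu> * (M + e / 2)"
    using \<mu> j by (intro add_left_mono mult_left_mono) (auto simp: M_def abs_if split: if_splits)
  also have "\<dots> \<le> A f x + e"
  proof -
    have "\<mu> * (e / 2) \<le> 1 * (e / 2)" using \<mu> e by (intro mult_right_mono) auto
    then show ?thesis using \<mu>(3) unfolding distrib_left by linarith
  qed
  finally have le: "A (\<lambda>z. f z + G j z) x \<le> A f x + e" .
  obtain N where "\<forall>n\<ge>N. \<forall>z\<in>cball 0 (real j + 1). \<bar>F n z - f z\<bar> \<le> 1 / real (Suc j)"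
    using mixed_conv_uniform_on[OF conv compact_cball[of 0 "real j + 1"], of "1 / real (Suc j)"] by auto
  then have N: "\<bar>F n z - f z\<bar> \<le> 1 / real (Suc j)" if "n \<ge> N" "norm z \<le> real j + 1" for n z
    using that by simp
  have "A (F n) x \<le> A (\<lambda>z. f z + G j z) x" if n: "n \<ge> N" for n
  proof (rule monotone_opD[OF mono FC Ckappa_add[OF w fC GC]])
    fix z
    show "F n z \<le> f z + G j z"
    proof (cases "norm z \<le> real j + 1")
      case True
      have "1 / real (Suc j) \<le> G j z"
        unfolding G_def using R(1) pos[of z]
        by (intro order.trans[OF eq_refl add_increasing2[OF mult_nonneg_nonneg]]) auto
      then show ?thesis using N[OF n True] by linarith
    next
      case False
      then have "G j z = 1 / real (Suc j) + 2 * R / \<kappa> z" by (simp add: G_def)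
      moreover have "\<bar>F n z\<bar> \<le> R / \<kappa> z" "\<bar>f z\<bar> \<le> R / \<kappa> z"
        using Ckappa_ball_D[OF R(2)[of n], of z] Ckappa_ball_D[OF R(3), of z] pos[of z]
        by (auto simp: field_simps)
      moreover have "0 \<le> 1 / real (Suc j)" by simp
      moreover have "2 * R / \<kappa> z = R / \<kappa> z + R / \<kappa> z" by simp
      ultimately show ?thesis by linarith
    qed
  qed
  then show ?thesis using le by (meson order.trans)
qed

text \<open>
  The lower bound follows from the upper one by reflection, because \<open>f\<close> is the midpoint of \<open>F n\<close>
  and \<open>2 f - F n\<close> and the latter converges to \<open>f\<close> as well.
\<close>

lemma mixed_continuous:
  fixes A :: "('a::euclidean_space \<Rightarrow> real) \<Rightarrow> 'a \<Rightarrow> real"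
  assumes w: "weight \<kappa>" and cvx: "convex_op \<kappa> A" and mono: "monotone_op \<kappa> A"
    and above: "\<And>F. (\<And>n. F n \<in> Ckappa \<kappa>) \<Longrightarrow> decreases_to_zero F \<Longrightarrow> decreases_to_zero (\<lambda>n. A (F n))"
    and conv: "mixed_conv \<kappa> F f"
  shows "(\<lambda>n. A (F n) x) \<longlonglongrightarrow> A f x"
proof (rule LIMSEQ_I)
  fix e :: real assume e: "0 < e"
  obtain R where R: "0 \<le> R" "\<And>n. F n \<in> Ckappa_ball \<kappa> R" "f \<in> Ckappa_ball \<kappa> R"
    using mixed_conv_ball[OF conv] by blast
  note FC = R(2)[THEN Ckappa_ball_subset] and fC = R(3)[THEN Ckappa_ball_subset]
  obtain N where N: "\<And>n. n \<ge> N \<Longrightarrow> A (F n) x \<le> A f x + e / 2"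
    using mixed_continuous_upper[OF w cvx mono above conv, of "e / 2" x] e by auto
  have "mixed_conv \<kappa> (\<lambda>n x. 2 * f x - F n x) f"
  proof (rule mixed_convI)
    show "(\<lambda>x. 2 * f x - F n x) \<in> Ckappa_ball \<kappa> (\<bar>2\<bar> * R + R)" for n
      by (intro Ckappa_ball_diff[OF w] Ckappa_ball_cmult R)
    fix K :: "'a set" and d :: real assume "compact K" "0 < d"
    from mixed_conv_uniform_on[OF conv this]
    show "\<exists>N. \<forall>n\<ge>N. \<forall>x\<in>K. \<bar>2 * f x - F n x - f x\<bar> \<le> d"
      by (auto simp: abs_minus_commute)
  qed (rule fC)
  then obtain N' where N': "\<And>n. n \<ge> N' \<Longrightarrow> A (\<lambda>x. 2 * f x - F n x) x \<le> A f x + e / 2"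
    using mixed_continuous_upper[OF w cvx mono above, of "\<lambda>n x. 2 * f x - F n x" f "e / 2" x] e by auto
  have "norm (A (F n) x - A f x) < e" if n: "n \<ge> max N N'" for n
  proof -
    have "(\<lambda>x. 1 / 2 * F n x + (1 - 1 / 2) * (2 * f x - F n x)) = f"
      by (rule ext) (simp add: field_simps)
    with convex_opD[OF cvx FC[of n] Ckappa_diff[OF w Ckappa_cmult[OF fC, of 2] FC[of n]], of "1/2" x]
    have "A f x \<le> A (F n) x / 2 + A (\<lambda>x. 2 * f x - F n x) x / 2" by simp
    then show ?thesis using N[of n] N'[of n] n e by (simp add: abs_less_iff)
  qed
  then show "\<exists>no. \<forall>n\<ge>no. norm (A (F n) x - A f x) < e" by blast
qed

text \<open>
  The semigroup is known as a limit of iterates only at the times of a dense set; right continuity is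
  what carries estimates from those times to all others.
\<close>

lemma (in convex_monotone_semigroup) right_continuous:
  assumes w: "weight \<kappa>" and sc: "strongly_continuous \<kappa> S" and t: "0 \<le> t" and f: "f \<in> Ckappa \<kappa>"
  shows "((\<lambda>s. S s f x) \<longlongrightarrow> S t f x) (at_right t)"
proof (rule tendsto_at_right_sequentially[of t "t + 1"])
  fix d :: "nat \<Rightarrow> real"
  assume d: "\<And>n. t < d n" "d \<longlonglongrightarrow> t"
  have "(\<lambda>n. d n - t) \<longlonglongrightarrow> 0" using d(2) by (simp add: LIM_zero)
  then have "mixed_conv \<kappa> (\<lambda>n. S (d n - t) f) f"
    using sc f d(1) unfolding strongly_continuous_def mixed_lim_zero_def by auto
  then have "(\<lambda>n. S t (S (d n - t) f) x) \<longlonglongrightarrow> S t f x"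
    using S1[OF t] S1_cont[OF t] by (intro mixed_continuous[OF w]) auto
  moreover have "S t (S (d n - t) f) = S (d n) f" for n
    using S2_add[OF t _ f, of "d n - t"] d(1)[of n] by simp
  ultimately show "(\<lambda>n. S (d n) f x) \<longlonglongrightarrow> S t f x" by simp
qed simp

section \<open>Iterates of the one-step operators\<close>

locale chernoff_scheme = assumption_A \<kappa> h I
  for \<kappa> :: "'a::euclidean_space \<Rightarrow> real" and h :: "nat \<Rightarrow> real" and I :: "'a operators" +
  assumes weight: "weight \<kappa>" and h_pos: "\<And>n. 0 < h n" and h_lim: "h \<longlonglongrightarrow> 0"
begin

lemma kappa_pos: "0 < \<kappa> x"
  using weight by (rule weight_pos)

lemma iter_Ckappa: "f \<in> Ckappa \<kappa> \<Longrightarrow> (I (h n) ^^ k) f \<in> Ckappa \<kappa>"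
  by (induction k) (auto intro!: maps less_imp_le h_pos)

lemma iter_convex: "convex_op \<kappa> (I (h n) ^^ k)"
proof (induction k)
  case 0
  then show ?case by (simp add: convex_op_def)
next
  case (Suc k)
  show ?case
    unfolding convex_op_def
  proof (intro ballI)
    fix f g and l :: real assume f: "f \<in> Ckappa \<kappa>" and g: "g \<in> Ckappa \<kappa>" and l: "l \<in> {0..1}"
    note fk = iter_Ckappa[OF f, of k n] and gk = iter_Ckappa[OF g, of k n]
    have c: "(\<lambda>x. l * F x + (1 - l) * G x) \<in> Ckappa \<kappa>" if "F \<in> Ckappa \<kappa>" "G \<in> Ckappa \<kappa>" for F G
      by (intro Ckappa_add[OF weight] Ckappa_cmult that)
    have "(I (h n) ^^ k) (\<lambda>x. l * f x + (1 - l) * g x) \<le> (\<lambda>x. l * (I (h n) ^^ k) f x + (1 - l) * (I (h n) ^^ k) g x)"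
      using Suc f g l by (simp add: convex_op_def)
    then have "I (h n) ((I (h n) ^^ k) (\<lambda>x. l * f x + (1 - l) * g x))
        \<le> I (h n) (\<lambda>x. l * (I (h n) ^^ k) f x + (1 - l) * (I (h n) ^^ k) g x)"
      using ii[of n] iter_Ckappa[OF c[OF f g], of k n] c[OF fk gk] by (simp add: monotone_op_def)
    also have "\<dots> \<le> (\<lambda>x. l * I (h n) ((I (h n) ^^ k) f) x + (1 - l) * I (h n) ((I (h n) ^^ k) g) x)"
      using ii[of n] fk gk l by (simp add: convex_op_def)
    finally show "(I (h n) ^^ Suc k) (\<lambda>x. l * f x + (1 - l) * g x)
        \<le> (\<lambda>x. l * (I (h n) ^^ Suc k) f x + (1 - l) * (I (h n) ^^ Suc k) g x)" by simp
  qed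
qed

lemma iterate_eq_iter: "iterate h I n (real k * h n) f = (I (h n) ^^ k) f"
proof -
  have "{j::nat. real j * h n \<le> real k * h n} = {..k}"
    using h_pos[of n] by auto
  then have "steps h n (real k * h n) = k" unfolding steps_def by (simp add: cSup_eq_Max Max_eq_iff)
  then show ?thesis by (simp add: iterate_def)
qed

lemma iter_ball:
  obtains \<omega> where "0 \<le> \<omega>"
    "\<And>f R n k. 0 \<le> R \<Longrightarrow> f \<in> Ckappa_ball \<kappa> R \<Longrightarrow> (I (h n) ^^ k) f \<in> Ckappa_ball \<kappa> (exp (\<omega> * (real k * h n)) * R)"
proof -
  obtain \<omega> where \<omega>: "0 \<le> \<omega>" "\<And>f n. f \<in> Ckappa \<kappa> \<Longrightarrow> knorm \<kappa> (I (h n) f) \<le> exp (\<omega> * h n) * knorm \<kappa> f"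
    using iii by blast
  have "(I (h n) ^^ k) f \<in> Ckappa_ball \<kappa> (exp (\<omega> * (real k * h n)) * R)"
    if R: "0 \<le> R" and f: "f \<in> Ckappa_ball \<kappa> R" for f R n k
  proof (induction k)
    case 0
    then show ?case using f by simp
  next
    case (Suc k)
    have "knorm \<kappa> (I (h n) ((I (h n) ^^ k) f)) \<le> exp (\<omega> * h n) * knorm \<kappa> ((I (h n) ^^ k) f)"
      by (intro \<omega> iter_Ckappa Ckappa_ball_subset[OF f])
    also have "\<dots> \<le> exp (\<omega> * h n) * (exp (\<omega> * (real k * h n)) * R)"
      using Suc by (intro mult_left_mono) (auto simp: Ckappa_ball_def)
    also have "\<dots> = exp (\<omega> * (real (Suc k) * h n)) * R"
      by (simp add: distrib_left distrib_right flip: exp_add)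
    finally show ?case
      using iter_Ckappa[OF Ckappa_ball_subset[OF f], of "Suc k" n] by (simp add: Ckappa_ball_def)
  qed
  then show ?thesis using that \<omega>(1) by blast
qed

lemma one_step_lipschitz:
  assumes R: "0 \<le> R"
  obtains \<omega> where "0 \<le> \<omega>"
    "\<And>f g n e x. f \<in> Ckappa_ball \<kappa> R \<Longrightarrow> g \<in> Ckappa_ball \<kappa> R \<Longrightarrow> (\<And>x. \<bar>f x - g x\<bar> * \<kappa> x \<le> e) \<Longrightarrow>
      \<bar>I (h n) f x - I (h n) g x\<bar> * \<kappa> x \<le> exp (\<omega> * h n) * e"
proof -
  obtain \<omega> where \<omega>: "0 \<le> \<omega>" "\<And>n f g. f \<in> Ckappa_ball \<kappa> R \<Longrightarrow> g \<in> Ckappa_ball \<kappa> R \<Longrightarrow>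
      knorm \<kappa> (\<lambda>x. I (h n) f x - I (h n) g x) \<le> exp (h n * \<omega>) * knorm \<kappa> (\<lambda>x. f x - g x)"
  proof -
    obtain W where W: "\<forall>r\<ge>0. (W::real\<Rightarrow>real) r \<ge> 0 \<and>
        (\<forall>n. \<forall>f\<in>Ckappa_ball \<kappa> r. \<forall>g\<in>Ckappa_ball \<kappa> r.
           knorm \<kappa> (\<lambda>x. I (h n) f x - I (h n) g x) \<le> exp (h n * W r) * knorm \<kappa> (\<lambda>x. f x - g x))"
      using iv by (elim exE conjE)
    show ?thesis by (rule that[of "W R"]) (use W R in \<open>simp_all\<close>)
  qed
  have "\<bar>I (h n) f x - I (h n) g x\<bar> * \<kappa> x \<le> exp (\<omega> * h n) * e"
    if fg: "f \<in> Ckappa_ball \<kappa> R" "g \<in> Ckappa_ball \<kappa> R" and e: "\<And>x. \<bar>f x - g x\<bar> * \<kappa> x \<le> e" for f g n e x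
  proof -
    have "(\<lambda>x. I (h n) f x - I (h n) g x) \<in> Ckappa \<kappa>"
      using fg h_pos by (intro Ckappa_diff[OF weight] maps Ckappa_ball_subset[of _ \<kappa> R]) (auto intro: less_imp_le)
    from le_knorm[OF this, of x] have "\<bar>I (h n) f x - I (h n) g x\<bar> * \<kappa> x \<le> knorm \<kappa> (\<lambda>x. I (h n) f x - I (h n) g x)" .
    also have "\<dots> \<le> exp (h n * \<omega>) * knorm \<kappa> (\<lambda>x. f x - g x)" by (intro \<omega> fg)
    also have "\<dots> \<le> exp (h n * \<omega>) * e" using e by (intro mult_left_mono knorm_le) auto
    finally show ?thesis by (simp add: mult.commute)
  qed
  then show ?thesis using that \<omega>(1) by blast
qed

text \<open>
  The one-step constants multiply up to \<open>exp (\<omega> k h)\<close>, which stays bounded for \<open>k h \<le> T\<close>. All iterates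
  have to remain in one ball for the constant \<open>\<omega>\<close> to be the same in each step.
\<close>

lemma iter_lipschitz:
  assumes R: "0 \<le> R" and T: "0 \<le> T"
  obtains L where "1 \<le> L"
    "\<And>f g n k e x. real k * h n \<le> T \<Longrightarrow> f \<in> Ckappa_ball \<kappa> R \<Longrightarrow> g \<in> Ckappa_ball \<kappa> R \<Longrightarrow>
      (\<And>x. \<bar>f x - g x\<bar> * \<kappa> x \<le> e) \<Longrightarrow> \<bar>(I (h n) ^^ k) f x - (I (h n) ^^ k) g x\<bar> * \<kappa> x \<le> L * e"
proof -
  obtain \<nu> where \<nu>: "0 \<le> \<nu>" "\<And>f R n k. 0 \<le> R \<Longrightarrow> f \<in> Ckappa_ball \<kappa> R \<Longrightarrow>
      (I (h n) ^^ k) f \<in> Ckappa_ball \<kappa> (exp (\<nu> * (real k * h n)) * R)"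
    using iter_ball by blast
  define R' where "R' = exp (\<nu> * T) * R"
  have R': "0 \<le> R'" using R by (simp add: R'_def)
  obtain \<omega> where \<omega>: "0 \<le> \<omega>"
    "\<And>f g n e x. f \<in> Ckappa_ball \<kappa> R' \<Longrightarrow> g \<in> Ckappa_ball \<kappa> R' \<Longrightarrow> (\<And>x. \<bar>f x - g x\<bar> * \<kappa> x \<le> e) \<Longrightarrow>
      \<bar>I (h n) f x - I (h n) g x\<bar> * \<kappa> x \<le> exp (\<omega> * h n) * e"
    using one_step_lipschitz[OF R'] by blast
  have ball: "(I (h n) ^^ k) f \<in> Ckappa_ball \<kappa> R'" if "real k * h n \<le> T" "f \<in> Ckappa_ball \<kappa> R" for f n k
    using \<nu>(2)[OF R that(2)] unfolding R'_def
    by (rule Ckappa_ball_mono)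
       (use R mult_left_mono[OF that(1) \<nu>(1)] in \<open>auto intro!: mult_right_mono\<close>)
  have step: "\<bar>(I (h n) ^^ k) f x - (I (h n) ^^ k) g x\<bar> * \<kappa> x \<le> exp (\<omega> * (real k * h n)) * e"
    if "real k * h n \<le> T" and fg: "f \<in> Ckappa_ball \<kappa> R" "g \<in> Ckappa_ball \<kappa> R"
      and e: "\<And>x. \<bar>f x - g x\<bar> * \<kappa> x \<le> e" for f g n k e x
    using that(1)
  proof (induction k arbitrary: x)
    case 0
    then show ?case using e by simp
  next
    case (Suc k)
    then have k: "real k * h n \<le> T" using h_pos[of n] by (simp add: distrib_right)
    have "\<bar>I (h n) ((I (h n) ^^ k) f) x - I (h n) ((I (h n) ^^ k) g) x\<bar> * \<kappa> x
        \<le> exp (\<omega> * h n) * (exp (\<omega> * (real k * h n)) * e)"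
      by (intro \<omega>(2) ball k fg Suc.IH)
    then show ?case by (simp add: distrib_left distrib_right exp_add mult.assoc)
  qed
  show ?thesis
  proof (rule that[of "exp (\<omega> * T)"])
    show "1 \<le> exp (\<omega> * T)" using \<omega>(1) T by simp
    fix f g n k e x
    assume k: "real k * h n \<le> T" and fg: "f \<in> Ckappa_ball \<kappa> R" "g \<in> Ckappa_ball \<kappa> R"
      and e: "\<And>x. \<bar>f x - g x\<bar> * \<kappa> x \<le> e"
    have "0 \<le> \<bar>f x - g x\<bar> * \<kappa> x" using kappa_pos[of x] by simp
    then have "0 \<le> e" using e[of x] by linarith
    moreover have "exp (\<omega> * (real k * h n)) \<le> exp (\<omega> * T)" using k \<omega>(1) by (simp add: mult_left_mono)
    ultimately have "exp (\<omega> * (real k * h n)) * e \<le> exp (\<omega> * T) * e" by (rule mult_right_mono[rotated])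
    with step[OF k fg e, of x] show "\<bar>(I (h n) ^^ k) f x - (I (h n) ^^ k) g x\<bar> * \<kappa> x \<le> exp (\<omega> * T) * e"
      by linarith
  qed
qed

lemma iter_equicontinuous:
  assumes e: "0 < e" and R: "0 \<le> R" and T: "0 \<le> T" and K: "compact K"
  obtains K' \<delta> where "compact K'" "0 < \<delta>"
    "\<And>f g n k x. real k * h n \<le> T \<Longrightarrow> f \<in> Ckappa_ball \<kappa> R \<Longrightarrow> g \<in> Ckappa_ball \<kappa> R \<Longrightarrow>
      (\<And>x. x \<in> K' \<Longrightarrow> \<bar>f x - g x\<bar> \<le> \<delta>) \<Longrightarrow> x \<in> K \<Longrightarrow> \<bar>(I (h n) ^^ k) f x - (I (h n) ^^ k) g x\<bar> \<le> e"
proof -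
  obtain K' c where K': "compact K'" "0 \<le> c" and le: "\<And>t n f g. t \<in> {0..T} \<Longrightarrow>
      f \<in> Ckappa_ball \<kappa> R \<Longrightarrow> g \<in> Ckappa_ball \<kappa> R \<Longrightarrow>
      snorm_on K (\<lambda>x. iterate h I n t f x - iterate h I n t g x) \<le> c * snorm_on K' (\<lambda>x. f x - g x) + e / 2"
    using vii[rule_format, OF half_gt_zero[OF e] R T K] by blast
  define \<delta> where "\<delta> = e / (2 * (c + 1))"
  have \<delta>: "0 < \<delta>" "c * \<delta> \<le> e / 2" using e K'(2) by (auto simp: \<delta>_def field_simps)
  show ?thesis
  proof (rule that[OF K'(1) \<delta>(1)])
    fix f g n k x
    assume k: "real k * h n \<le> T" and fg: "f \<in> Ckappa_ball \<kappa> R" "g \<in> Ckappa_ball \<kappa> R"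
      and close: "\<And>x. x \<in> K' \<Longrightarrow> \<bar>f x - g x\<bar> \<le> \<delta>" and x: "x \<in> K"
    have "continuous_on K (\<lambda>x. (I (h n) ^^ k) f x - (I (h n) ^^ k) g x)"
      by (intro continuous_intros Ckappa_continuous[of _ \<kappa>] iter_Ckappa Ckappa_ball_subset[of _ \<kappa> R] fg)
    from le_snorm_on[OF this K x]
    have "\<bar>(I (h n) ^^ k) f x - (I (h n) ^^ k) g x\<bar> \<le> c * snorm_on K' (\<lambda>x. f x - g x) + e / 2"
      using le[of "real k * h n" f g n] k fg h_pos[of n] by (simp add: iterate_eq_iter less_imp_le)
    also have "\<dots> \<le> c * \<delta> + e / 2"
      using close \<delta>(1) K'(2) by (intro add_right_mono mult_left_mono snorm_on_le) auto
    finally show "\<bar>(I (h n) ^^ k) f x - (I (h n) ^^ k) g x\<bar> \<le> e" using \<delta>(2) by linarith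
  qed
qed

lemma iter_Lip_b:
  obtains c where "0 \<le> c"
    "\<And>f r n k. 0 \<le> r \<Longrightarrow> f \<in> Lip_b r \<Longrightarrow> (I (h n) ^^ k) f \<in> Lip_b (exp (c * (real k * h n)) * r)"
proof -
  obtain c where c: "0 \<le> c" "\<And>f r n. 0 \<le> r \<Longrightarrow> f \<in> Lip_b r \<Longrightarrow> I (h n) f \<in> Lip_b (exp (c * h n) * r)"
    using viii by blast
  have "(I (h n) ^^ k) f \<in> Lip_b (exp (c * (real k * h n)) * r)" if "0 \<le> r" "f \<in> Lip_b r" for f r n k
  proof (induction k)
    case 0
    then show ?case using that by simp
  next
    case (Suc k)
    then have "I (h n) ((I (h n) ^^ k) f) \<in> Lip_b (exp (c * h n) * (exp (c * (real k * h n)) * r))"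
      using that(1) by (intro c) auto
    then show ?case by (simp add: distrib_left distrib_right exp_add mult.assoc)
  qed
  then show ?thesis using that c(1) by blast
qed

text \<open>
  In each step the error made so far is amplified by at most \<open>exp (\<omega> h)\<close> and a new error
  \<open>r' \<eta> h / \<kappa>\<close> is added, where \<open>r'\<close> is a common Lipschitz bound for the iterates of \<open>f\<close>.
\<close>

lemma iter_shift:
  assumes r: "0 \<le> r" and T: "0 \<le> T" and e: "0 < e"
  obtains \<delta> n0 where "0 < \<delta>"
    "\<And>f x n k y. n \<ge> n0 \<Longrightarrow> real k * h n \<le> T \<Longrightarrow> f \<in> Lip_b r \<Longrightarrow> norm x \<le> \<delta> \<Longrightarrow>
      (I (h n) ^^ k) (shift x f) y \<le> (I (h n) ^^ k) f (x + y) + e * (real k * h n) / \<kappa> y"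
proof -
  obtain c where c: "0 \<le> c"
    "\<And>f r n k. 0 \<le> r \<Longrightarrow> f \<in> Lip_b r \<Longrightarrow> (I (h n) ^^ k) f \<in> Lip_b (exp (c * (real k * h n)) * r)"
    using iter_Lip_b by blast
  obtain B where B: "0 < B" "\<And>x. \<kappa> x \<le> B" using weight_bounded[OF weight] by blast
  define r' where "r' = exp (c * T) * r"
  define R where "R = r' * B + e * T"
  have r': "0 \<le> r'" using r by (simp add: r'_def)
  have R: "0 \<le> R" using r' B T e by (simp add: R_def)
  obtain \<omega> where \<omega>: "0 \<le> \<omega>"
    "\<And>f g n e x. f \<in> Ckappa_ball \<kappa> R \<Longrightarrow> g \<in> Ckappa_ball \<kappa> R \<Longrightarrow> (\<And>x. \<bar>f x - g x\<bar> * \<kappa> x \<le> e) \<Longrightarrow>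
      \<bar>I (h n) f x - I (h n) g x\<bar> * \<kappa> x \<le> exp (\<omega> * h n) * e"
    using one_step_lipschitz[OF R] by blast
  \<comment> \<open>chosen such that the accumulated error \<open>r\' \<eta> k h exp (\<omega> k h)\<close> is at most \<open>e k h\<close>\<close>
  define \<eta> where "\<eta> = e / ((r' + 1) * exp (\<omega> * T))"
  have \<eta>: "0 < \<eta>" using e r' by (simp add: \<eta>_def)
  have \<eta>e: "r' * \<eta> * exp (\<omega> * T) \<le> e"
    using r' e by (simp add: \<eta>_def divide_le_eq mult_left_mono)
  obtain \<delta> n0 where \<delta>: "0 < \<delta>" "\<And>r f x n. 0 \<le> r \<Longrightarrow> f \<in> Lip_b r \<Longrightarrow> norm x \<le> \<delta> \<Longrightarrow> n \<ge> n0 \<Longrightarrow>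
      I (h n) (shift x f) \<le> (\<lambda>y. shift x (I (h n) f) y + r * \<eta> * h n / \<kappa> y)"
    using v[rule_format, OF \<eta>] by blast
  have main: "(I (h n) ^^ k) (shift x f) y \<le> (I (h n) ^^ k) f (x + y)
      + r' * \<eta> * (real k * h n) * exp (\<omega> * (real k * h n)) / \<kappa> y"
    if n: "n \<ge> n0" and k: "real k * h n \<le> T" and f: "f \<in> Lip_b r" and x: "norm x \<le> \<delta>" for f x n k y
    using k
  proof (induction k arbitrary: y)
    case 0
    then show ?case by (simp add: shift_def)
  next
    case (Suc k)
    define E where "E = r' * \<eta> * (real k * h n) * exp (\<omega> * (real k * h n))"
    define g where "g = (I (h n) ^^ k) f"
    have k: "real k * h n \<le> T" using Suc.prems h_pos[of n] by (simp add: distrib_right)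
    have "g \<in> Lip_b (exp (c * (real k * h n)) * r)" unfolding g_def by (rule c(2)[OF r f])
    moreover have "exp (c * (real k * h n)) * r \<le> r'"
      unfolding r'_def using k c(1) r by (intro mult_right_mono) (auto simp: mult_left_mono)
    ultimately have g: "g \<in> Lip_b r'" by (rule Lip_b_mono)
    have E0: "0 \<le> E" unfolding E_def using r' \<eta> h_pos[of n] by simp
    have "E \<le> r' * \<eta> * (real k * h n) * exp (\<omega> * T)"
      unfolding E_def using k r' \<eta> \<omega>(1) h_pos[of n] by (intro mult_left_mono) (auto simp: mult_left_mono)
    also have "\<dots> = (r' * \<eta> * exp (\<omega> * T)) * (real k * h n)" by simp
    also have "\<dots> \<le> e * T"
      using e k r' \<eta> h_pos[of n] by (intro mult_mono \<eta>e) auto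
    finally have ET: "E \<le> e * T" .
    have gR: "shift x g \<in> Ckappa_ball \<kappa> (r' * B)"
      using Lip_b_in_Ckappa_ball[OF weight Lip_b_shift[OF g] B(2)] .
    have gR1: "shift x g \<in> Ckappa_ball \<kappa> R"
      by (rule Ckappa_ball_mono[OF gR]) (use e T in \<open>simp add: R_def\<close>)
    have gR2: "(\<lambda>y. shift x g y + E / \<kappa> y) \<in> Ckappa_ball \<kappa> R"
      by (rule Ckappa_ball_mono[OF Ckappa_ball_add[OF weight gR Ckappa_ball_divide_weight[OF weight]]])
         (use E0 ET in \<open>simp add: R_def\<close>)
    have fC: "shift x f \<in> Ckappa \<kappa>" by (rule Lip_b_in_Ckappa[OF weight Lip_b_shift[OF f]])
    have "I (h n) ((I (h n) ^^ k) (shift x f)) y \<le> I (h n) (\<lambda>y. shift x g y + E / \<kappa> y) y"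
    proof (rule monotone_opD[where A = "I (h n)"])
      show "monotone_op \<kappa> (I (h n))" using ii by blast
      show "(I (h n) ^^ k) (shift x f) \<in> Ckappa \<kappa>" by (rule iter_Ckappa[OF fC])
      show "(\<lambda>y. shift x g y + E / \<kappa> y) \<in> Ckappa \<kappa>" by (rule Ckappa_ball_subset[OF gR2])
      show "(I (h n) ^^ k) (shift x f) z \<le> shift x g z + E / \<kappa> z" for z
        using Suc.IH[OF k, of z] by (simp add: shift_def g_def E_def)
    qed
    also have "\<dots> \<le> I (h n) (shift x g) y + exp (\<omega> * h n) * E / \<kappa> y"
    proof -
      have "\<bar>shift x g z + E / \<kappa> z - shift x g z\<bar> * \<kappa> z \<le> E" for z
        using E0 kappa_pos[of z] by simp
      from \<omega>(2)[OF gR2 gR1 this, of n y]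
      have "(I (h n) (\<lambda>y. shift x g y + E / \<kappa> y) y - I (h n) (shift x g) y) * \<kappa> y \<le> exp (\<omega> * h n) * E"
        using mult_right_mono[OF abs_ge_self, of "\<kappa> y"] kappa_pos[of y] by (meson less_imp_le order_trans)
      then show ?thesis using kappa_pos[of y] by (simp add: field_simps)
    qed
    also have "I (h n) (shift x g) y \<le> I (h n) g (x + y) + r' * \<eta> * h n / \<kappa> y"
      using le_funD[OF \<delta>(2)[OF r' g x n], of y] by (simp add: shift_def)
    also have "I (h n) g (x + y) + r' * \<eta> * h n / \<kappa> y + exp (\<omega> * h n) * E / \<kappa> y
        = I (h n) g (x + y) + (r' * \<eta> * h n * 1 + exp (\<omega> * h n) * E) / \<kappa> y"
      by (simp add: add_divide_distrib)
    also have "\<dots> \<le> I (h n) g (x + y)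
        + (r' * \<eta> * h n * exp (\<omega> * (real (Suc k) * h n)) + exp (\<omega> * h n) * E) / \<kappa> y"
      using r' \<eta> h_pos[of n] kappa_pos[of y] \<omega>(1)
      by (intro add_left_mono divide_right_mono add_right_mono mult_left_mono) auto
    also have "r' * \<eta> * h n * exp (\<omega> * (real (Suc k) * h n)) + exp (\<omega> * h n) * E
        = r' * \<eta> * (real (Suc k) * h n) * exp (\<omega> * (real (Suc k) * h n))"
      unfolding E_def by (simp add: distrib_left distrib_right exp_add)
    finally show ?case by (simp add: g_def)
  qed
  show ?thesis
  proof (rule that[of \<delta> n0])
    fix f :: "'a \<Rightarrow> real" and x y :: 'a and n k
    assume n: "n \<ge> n0" and k: "real k * h n \<le> T" and f: "f \<in> Lip_b r" and x: "norm x \<le> \<delta>"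
    have "r' * \<eta> * (real k * h n) * exp (\<omega> * (real k * h n)) \<le> r' * \<eta> * (real k * h n) * exp (\<omega> * T)"
      using k r' \<eta> \<omega>(1) h_pos[of n] by (intro mult_left_mono) (auto simp: mult_left_mono)
    also have "\<dots> = (r' * \<eta> * exp (\<omega> * T)) * (real k * h n)" by simp
    also have "\<dots> \<le> e * (real k * h n)"
      using h_pos[of n] by (intro mult_right_mono \<eta>e) auto
    finally have "r' * \<eta> * (real k * h n) * exp (\<omega> * (real k * h n)) / \<kappa> y \<le> e * (real k * h n) / \<kappa> y"
      using kappa_pos[of y] by (intro divide_right_mono) auto
    with main[OF n k f x, of y]
    show "(I (h n) ^^ k) (shift x f) y \<le> (I (h n) ^^ k) f (x + y) + e * (real k * h n) / \<kappa> y"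
      by linarith
  qed (rule \<delta>(1))
qed

lemma quotient_mixed_conv:
  assumes "g \<in> Cb_infty"
  shows "mixed_conv \<kappa> (\<lambda>n x. (I (h n) g x - g x) / h n) (deriv0 \<kappa> I g)"
proof -
  obtain a where a: "has_deriv0 \<kappa> I g a" using vi assms by blast
  with deriv0_eq[OF a] h_pos h_lim show ?thesis
    unfolding has_deriv0_def mixed_lim_zero_def by simp
qed

text \<open>
  A telescoping sum: each step moves \<open>g\<close> by \<open>O(h)\<close> in the weighted norm, since the difference
  quotients converge and hence are bounded, and the iterates are uniformly Lipschitz.
\<close>

lemma iter_smooth_bound:
  assumes g: "g \<in> Cb_infty" and T: "0 \<le> T"
  obtains C where "0 \<le> C"
    "\<And>n k x. real k * h n \<le> T \<Longrightarrow> \<bar>(I (h n) ^^ k) g x - g x\<bar> * \<kappa> x \<le> C * (real k * h n)"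
proof -
  obtain R where R: "0 \<le> R" "\<And>n. (\<lambda>x. (I (h n) g x - g x) / h n) \<in> Ckappa_ball \<kappa> R"
      "deriv0 \<kappa> I g \<in> Ckappa_ball \<kappa> R"
    using mixed_conv_ball[OF quotient_mixed_conv[OF g]] by blast
  have gC: "g \<in> Ckappa \<kappa>" using g by (rule Cb_infty_Ckappa[OF weight])
  obtain Q where Q: "0 \<le> Q" "g \<in> Ckappa_ball \<kappa> Q" using Ckappa_obtains_ball[OF gC] by blast
  have one: "\<bar>I (h n) g x - g x\<bar> * \<kappa> x \<le> R * h n" for n x
  proof -
    have "\<bar>I (h n) g x - g x\<bar> / h n * \<kappa> x \<le> R"
      using Ckappa_ball_D[OF R(2)[of n], of x] h_pos[of n] by (simp add: abs_divide)
    then show ?thesis using h_pos[of n] by (simp add: pos_divide_le_eq)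
  qed
  have QRT: "0 \<le> Q + R * T" using Q R T by simp
  obtain L where L: "1 \<le> L"
    "\<And>f g n k e x. real k * h n \<le> T \<Longrightarrow> f \<in> Ckappa_ball \<kappa> (Q + R * T) \<Longrightarrow> g \<in> Ckappa_ball \<kappa> (Q + R * T) \<Longrightarrow>
      (\<And>x. \<bar>f x - g x\<bar> * \<kappa> x \<le> e) \<Longrightarrow> \<bar>(I (h n) ^^ k) f x - (I (h n) ^^ k) g x\<bar> * \<kappa> x \<le> L * e"
    using iter_lipschitz[OF QRT T] by blast
  have main: "\<bar>(I (h n) ^^ k) g x - g x\<bar> * \<kappa> x \<le> (L * R) * (real k * h n)" if "real k * h n \<le> T" for n k x
    using that
  proof (induction k)
    case 0
    then show ?case by simp
  next
    case (Suc k)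
    have k: "real k * h n \<le> T" "h n \<le> T"
    proof -
      have "real k * h n + h n \<le> T" using Suc.prems by (simp add: distrib_right)
      moreover have "0 \<le> real k * h n" using h_pos[of n] by simp
      ultimately show "real k * h n \<le> T" "h n \<le> T" using h_pos[of n] by linarith+
    qed
    have gb: "g \<in> Ckappa_ball \<kappa> (Q + R * T)"
      using Q(2) by (rule Ckappa_ball_mono) (use R T in simp)
    have "(\<lambda>x. g x + h n * ((I (h n) g x - g x) / h n)) \<in> Ckappa_ball \<kappa> (Q + \<bar>h n\<bar> * R)"
      by (intro Ckappa_ball_add[OF weight] Ckappa_ball_cmult Q R)
    have "I (h n) g \<in> Ckappa_ball \<kappa> (Q + h n * R)"
    proof -
      have "h n \<noteq> 0" "\<bar>h n\<bar> = h n" using h_pos[of n] by auto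
      then show "I (h n) g \<in> Ckappa_ball \<kappa> (Q + h n * R)"
        using \<open>(\<lambda>x. g x + h n * ((I (h n) g x - g x) / h n)) \<in> Ckappa_ball \<kappa> (Q + \<bar>h n\<bar> * R)\<close> by simp
    qed
    then have Igb: "I (h n) g \<in> Ckappa_ball \<kappa> (Q + R * T)"
      by (rule Ckappa_ball_mono) (use mult_left_mono[OF k(2) R(1)] in \<open>simp add: mult.commute\<close>)
    have "\<bar>(I (h n) ^^ k) (I (h n) g) x - (I (h n) ^^ k) g x\<bar> * \<kappa> x \<le> L * (R * h n)"
      by (rule L(2)[OF k(1) Igb gb one])
    moreover have "\<bar>(I (h n) ^^ Suc k) g x - g x\<bar>
        \<le> \<bar>(I (h n) ^^ k) (I (h n) g) x - (I (h n) ^^ k) g x\<bar> + \<bar>(I (h n) ^^ k) g x - g x\<bar>"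
      by (simp add: funpow_swap1)
    then have "\<bar>(I (h n) ^^ Suc k) g x - g x\<bar> * \<kappa> x
        \<le> (\<bar>(I (h n) ^^ k) (I (h n) g) x - (I (h n) ^^ k) g x\<bar> + \<bar>(I (h n) ^^ k) g x - g x\<bar>) * \<kappa> x"
      using kappa_pos[of x] by (intro mult_right_mono) auto
    moreover have "L * R * (real (Suc k) * h n) = L * (R * h n) + L * R * (real k * h n)"
      by (simp add: algebra_simps)
    ultimately show ?case using Suc.IH[OF k(1)] unfolding distrib_right[of _ _ "\<kappa> x"] by linarith
  qed
  have "0 \<le> L * R" using L(1) R(1) by simp
  then show ?thesis using main by (rule that)
qed

text \<open>
  Strong continuity at time zero, uniformly in the discretization. It is clear for smooth functions
  by the preceding lemma, and equicontinuity extends it to limits in the mixed topology.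
\<close>

lemma iter_near_identity:
  assumes F: "mixed_conv \<kappa> F f" and K: "compact K" and e: "0 < e"
  shows "\<exists>\<delta>>0. \<exists>n0. \<forall>n\<ge>n0. \<forall>k. real k * h n \<le> \<delta> \<longrightarrow> (\<forall>x\<in>K. \<bar>(I (h n) ^^ k) (F n) x - f x\<bar> \<le> e)"
proof (cases "K = {}")
  case True
  then show ?thesis by (auto intro: exI[of _ 1])
next
  case False
  obtain R where R: "0 \<le> R" "\<And>n. F n \<in> Ckappa_ball \<kappa> R" "f \<in> Ckappa_ball \<kappa> R"
    using mixed_conv_ball[OF F] by blast
  obtain C where C: "1 \<le> C"
    "\<And>R f K d. 0 \<le> R \<Longrightarrow> f \<in> Ckappa_ball \<kappa> R \<Longrightarrow> compact K \<Longrightarrow> 0 < d \<Longrightarrow>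
      \<exists>g\<in>Cb_infty. g \<in> Ckappa_ball \<kappa> (C * R) \<and> (\<forall>x\<in>K. \<bar>g x - f x\<bar> \<le> d)"
    using Cb_infty_dense[OF weight] by blast
  have CR: "0 \<le> C * R" "R \<le> C * R" using C(1) R(1) by (auto simp: mult_le_cancel_right1)
  have e3: "0 < e / 3" using e by simp
  obtain K' \<delta>' where K': "compact K'" "0 < \<delta>'"
    "\<And>f g n k x. real k * h n \<le> 1 \<Longrightarrow> f \<in> Ckappa_ball \<kappa> (C * R) \<Longrightarrow> g \<in> Ckappa_ball \<kappa> (C * R) \<Longrightarrow>
      (\<And>x. x \<in> K' \<Longrightarrow> \<bar>f x - g x\<bar> \<le> \<delta>') \<Longrightarrow> x \<in> K \<Longrightarrow> \<bar>(I (h n) ^^ k) f x - (I (h n) ^^ k) g x\<bar> \<le> e / 3"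
    using iter_equicontinuous[OF e3 CR(1) zero_le_one K] by blast
  \<comment> \<open>accuracy of the smooth approximation \<open>g\<close>: then \<open>F n\<close> and \<open>g\<close> are \<open>\<delta>\'\<close>-close on \<open>K\'\<close>\<close>
  define d where "d = min (\<delta>' / 2) (e / 3)"
  have d: "0 < d" "d \<le> \<delta>' / 2" "d \<le> e / 3" using K'(2) e by (auto simp: d_def)
  obtain g where g: "g \<in> Cb_infty" "g \<in> Ckappa_ball \<kappa> (C * R)" "\<forall>x\<in>K \<union> K'. \<bar>g x - f x\<bar> \<le> d"
    using C(2)[OF R(1,3) compact_Un[OF K K'(1)] d(1)] by blast
  obtain N where N: "\<forall>n\<ge>N. \<forall>x\<in>K'. \<bar>F n x - f x\<bar> \<le> d"
    using mixed_conv_uniform_on[OF F K'(1) d(1)] by blast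
  obtain C1 where C1: "0 \<le> C1"
    "\<And>n k x. real k * h n \<le> 1 \<Longrightarrow> \<bar>(I (h n) ^^ k) g x - g x\<bar> * \<kappa> x \<le> C1 * (real k * h n)"
    using iter_smooth_bound[OF g(1) zero_le_one] by blast
  have "continuous_on K \<kappa>" using weight unfolding weight_def by (auto intro: continuous_on_subset)
  then obtain z where z: "z \<in> K" "\<And>x. x \<in> K \<Longrightarrow> \<kappa> z \<le> \<kappa> x"
    using continuous_attains_inf[OF K False] by blast
  define \<delta> where "\<delta> = min 1 (e * \<kappa> z / (3 * (C1 + 1)))"
  have \<delta>: "0 < \<delta>" "\<delta> \<le> 1" using e kappa_pos[of z] C1(1) by (auto simp: \<delta>_def)
  have "\<delta> \<le> e * \<kappa> z / (3 * (C1 + 1))" by (simp add: \<delta>_def)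
  then have C1\<delta>: "(C1 + 1) * \<delta> \<le> e / 3 * \<kappa> z" using C1(1) by (simp add: field_simps)
  have "\<bar>(I (h n) ^^ k) (F n) x - f x\<bar> \<le> e" if n: "n \<ge> N" and k: "real k * h n \<le> \<delta>" and x: "x \<in> K" for n k x
  proof -
    have k1: "real k * h n \<le> 1" using k \<delta> by simp
    have "\<bar>F n y - g y\<bar> \<le> \<delta>'" if "y \<in> K'" for y
    proof -
      have "\<bar>F n y - f y\<bar> \<le> d" "\<bar>g y - f y\<bar> \<le> d" using N n g(3) that by auto
      then show ?thesis using d(2) by linarith
    qed
    then have 1: "\<bar>(I (h n) ^^ k) (F n) x - (I (h n) ^^ k) g x\<bar> \<le> e / 3"
      using Ckappa_ball_mono[OF R(2) CR(2)] by (intro K'(3) k1 g x)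
    have "\<bar>(I (h n) ^^ k) g x - g x\<bar> * \<kappa> x \<le> C1 * (real k * h n)" by (rule C1(2)[OF k1])
    also have "\<dots> \<le> (C1 + 1) * \<delta>" using C1(1) k h_pos[of n] by (intro mult_mono) auto
    also have "\<dots> \<le> e / 3 * \<kappa> z" by (rule C1\<delta>)
    also have "\<dots> \<le> e / 3 * \<kappa> x" using z(2)[OF x] e by (intro mult_left_mono) auto
    finally have 2: "\<bar>(I (h n) ^^ k) g x - g x\<bar> \<le> e / 3"
      using kappa_pos[of x] by (simp add: mult_le_cancel_right)
    have "\<bar>g x - f x\<bar> \<le> d" using g(3) x by blast
    then have "\<bar>g x - f x\<bar> \<le> e / 3" using d(3) by linarith
    with 1 2 show ?thesis by linarith
  qed
  then show ?thesis using \<delta>(1) by blast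
qed

text \<open>
  The increment of one step is \<open>I\<^sup>k (I g) - I\<^sup>k g\<close>, where \<open>I g = g + h q\<close> with \<open>q\<close> close to \<open>I'(0) g\<close>.
  Convexity of \<open>I\<^sup>k\<close> bounds it above by \<open>h (I\<^sup>k (g + q) - I\<^sup>k g)\<close> and below by
  \<open>h (I\<^sup>k (I g) - I\<^sup>k (I g - q))\<close>. For \<open>k h\<close> small \<open>I\<^sup>k\<close> is close to the identity, so that both bounds
  are \<open>h I'(0) g\<close> up to \<open>o(h)\<close>.
\<close>

lemma iter_expansion:
  assumes g: "g \<in> Cb_infty" and K: "compact K" and e: "0 < e"
  shows "\<exists>\<delta>>0. \<exists>n0. \<forall>n\<ge>n0. \<forall>k. real k * h n \<le> \<delta> \<longrightarrow>
    (\<forall>x\<in>K. \<bar>(I (h n) ^^ k) g x - g x - real k * h n * deriv0 \<kappa> I g x\<bar> \<le> e * (real k * h n))"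
proof -
  define a where "a = deriv0 \<kappa> I g"
  define q where "q n x = (I (h n) g x - g x) / h n" for n x
  have gC: "g \<in> Ckappa \<kappa>" using g by (rule Cb_infty_Ckappa[OF weight])
  have q: "mixed_conv \<kappa> q a" unfolding q_def[abs_def] a_def by (rule quotient_mixed_conv[OF g])
  have qC: "q n \<in> Ckappa \<kappa>" for n using q by (simp add: mixed_conv_def)
  have g1: "mixed_conv \<kappa> (\<lambda>n. g) g" by (rule mixed_conv_const[OF gC])
  have Ieq: "I (h n) g = (\<lambda>x. g x + h n * q n x)" for n
    using h_pos[of n] by (auto simp: q_def)
  have "mixed_conv \<kappa> (\<lambda>n x. g x + h n * q n x) (\<lambda>x. g x + 0 * a x)"
    by (rule mixed_conv_add[OF weight g1 mixed_conv_cmult[OF weight q h_lim]])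
  then have Ig: "mixed_conv \<kappa> (\<lambda>n. I (h n) g) g" by (simp add: Ieq[symmetric])
  have gq: "mixed_conv \<kappa> (\<lambda>n x. g x + q n x) (\<lambda>x. g x + a x)"
    by (rule mixed_conv_add[OF weight g1 q])
  have Igq: "mixed_conv \<kappa> (\<lambda>n x. I (h n) g x + - 1 * q n x) (\<lambda>x. g x + - 1 * a x)"
    by (rule mixed_conv_add[OF weight Ig mixed_conv_cmult[OF weight q tendsto_const]])
  have "\<forall>\<^sub>F n in sequentially. h n < 1" using order_tendstoD(2)[OF h_lim, of 1] by simp
  then obtain n1 where n1: "\<And>n. n \<ge> n1 \<Longrightarrow> h n \<le> 1" by (force simp: eventually_sequentially)
  note near = iter_near_identity[OF _ K half_gt_zero[OF e]]
  obtain \<delta>1 m1 where 1: "0 < \<delta>1" "\<And>n k x. n \<ge> m1 \<Longrightarrow> real k * h n \<le> \<delta>1 \<Longrightarrow> x \<in> K \<Longrightarrow> \<bar>(I (h n) ^^ k) g x - g x\<bar> \<le> e / 2"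
    using near[OF g1] by blast
  obtain \<delta>2 m2 where 2: "0 < \<delta>2" "\<And>n k x. n \<ge> m2 \<Longrightarrow> real k * h n \<le> \<delta>2 \<Longrightarrow> x \<in> K \<Longrightarrow> \<bar>(I (h n) ^^ k) (I (h n) g) x - g x\<bar> \<le> e / 2"
    using near[OF Ig] by blast
  obtain \<delta>3 m3 where 3: "0 < \<delta>3" "\<And>n k x. n \<ge> m3 \<Longrightarrow> real k * h n \<le> \<delta>3 \<Longrightarrow> x \<in> K \<Longrightarrow>
      \<bar>(I (h n) ^^ k) (\<lambda>x. g x + q n x) x - (g x + a x)\<bar> \<le> e / 2"
    using near[OF gq] by blast
  obtain \<delta>4 m4 where 4: "0 < \<delta>4" "\<And>n k x. n \<ge> m4 \<Longrightarrow> real k * h n \<le> \<delta>4 \<Longrightarrow> x \<in> K \<Longrightarrow>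
      \<bar>(I (h n) ^^ k) (\<lambda>x. I (h n) g x + - 1 * q n x) x - (g x + - 1 * a x)\<bar> \<le> e / 2"
    using near[OF Igq] by blast
  define \<delta> where "\<delta> = min (min \<delta>1 \<delta>2) (min \<delta>3 \<delta>4)"
  define n0 where "n0 = max n1 (max (max m1 m2) (max m3 m4))"
  have "\<bar>(I (h n) ^^ k) g x - g x - real k * h n * a x\<bar> \<le> e * (real k * h n)"
    if n: "n \<ge> n0" and k: "real k * h n \<le> \<delta>" and x: "x \<in> K" for n k x
    using k
  proof (induction k)
    case 0
    then show ?case by simp
  next
    case (Suc k)
    have k: "real k * h n \<le> \<delta>" using Suc.prems h_pos[of n] by (simp add: distrib_right)
    let ?A = "I (h n) ^^ k"
    have hn: "0 \<le> h n" "h n \<le> 1" using h_pos[of n] n1 n by (auto simp: n0_def intro: less_imp_le)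
    have bounds: "\<bar>?A g x - g x\<bar> \<le> e / 2" "\<bar>?A (I (h n) g) x - g x\<bar> \<le> e / 2"
      "\<bar>?A (\<lambda>x. g x + q n x) x - (g x + a x)\<bar> \<le> e / 2"
      "\<bar>?A (\<lambda>x. I (h n) g x + - 1 * q n x) x - (g x + - 1 * a x)\<bar> \<le> e / 2"
      by (intro 1 2 3 4 x; use n k in \<open>simp add: n0_def \<delta>_def\<close>)+
    have IgC: "I (h n) g \<in> Ckappa \<kappa>" by (intro maps gC hn)
    have "?A (I (h n) g) x \<le> ?A g x + h n * (?A (\<lambda>x. g x + q n x) x - ?A g x)"
      unfolding Ieq[of n] by (intro convex_op_add_scaled[OF weight iter_convex] gC qC hn)
    moreover have "h n * (?A (\<lambda>x. g x + q n x) x - ?A g x) \<le> h n * (a x + e)"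
      by (intro mult_left_mono hn(1)) (use bounds(1,3) in linarith)
    ultimately have up: "?A (I (h n) g) x - ?A g x \<le> h n * (a x + e)" by linarith
    have "?A (\<lambda>x. I (h n) g x + h n * (- 1 * q n x)) x
        \<le> ?A (I (h n) g) x + h n * (?A (\<lambda>x. I (h n) g x + - 1 * q n x) x - ?A (I (h n) g) x)"
      by (intro convex_op_add_scaled[OF weight iter_convex] IgC Ckappa_cmult qC hn)
    moreover have "(\<lambda>x. I (h n) g x + h n * (- 1 * q n x)) = g" by (simp add: Ieq)
    moreover have "h n * (?A (\<lambda>x. I (h n) g x + - 1 * q n x) x - ?A (I (h n) g) x) \<le> h n * (- (a x - e))"
      by (intro mult_left_mono hn(1)) (use bounds(2,4) in linarith)
    ultimately have lo: "?A g x - ?A (I (h n) g) x \<le> h n * (- (a x - e))" by simp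
    have "\<bar>?A (I (h n) g) x - ?A g x - h n * a x\<bar> \<le> e * h n"
      using up lo by (simp add: abs_le_iff algebra_simps)
    moreover have "(I (h n) ^^ Suc k) g x - g x - real (Suc k) * h n * a x
        = (?A (I (h n) g) x - ?A g x - h n * a x) + (?A g x - g x - real k * h n * a x)"
      by (simp add: funpow_swap1 algebra_simps)
    moreover have "\<bar>?A g x - g x - real k * h n * a x\<bar> \<le> e * (real k * h n)" by (rule Suc.IH[OF k])
    moreover have "e * (real (Suc k) * h n) = e * h n + e * (real k * h n)" by (simp add: algebra_simps)
    ultimately show ?case by linarith
  qed
  moreover have "0 < \<delta>" using 1 2 3 4 by (simp add: \<delta>_def)
  ultimately show ?thesis unfolding a_def by blast
qed

end

section \<open>Passage from the iterates to the semigroup\<close>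

lemma steps_bounds:
  assumes h: "0 < h n" and d: "0 \<le> d"
  shows "real (steps h n d) * h n \<le> d" "d < real (steps h n d) * h n + h n"
proof -
  let ?A = "{k::nat. real k * h n \<le> d}"
  have "?A \<subseteq> {..nat \<lfloor>d / h n\<rfloor>}"
    using h by (auto simp: le_nat_floor field_simps)
  then have fin: "finite ?A" using finite_subset by blast
  have "0 \<in> ?A" using d by simp
  then have "Max ?A \<in> ?A" using Max_in[OF fin] by blast
  then show "real (steps h n d) * h n \<le> d" by (simp add: steps_def)
  have "Suc (Max ?A) \<notin> ?A" using Max_ge[OF fin, of "Suc (Max ?A)"] by auto
  then show "d < real (steps h n d) * h n + h n"
    by (simp add: steps_def distrib_right not_le)
qed

locale chernoff_semigroup = chernoff_scheme \<kappa> h I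
  for \<kappa> :: "'a::euclidean_space \<Rightarrow> real" and h :: "nat \<Rightarrow> real" and I :: "'a operators" +
  fixes S :: "'a operators"
  assumes associated: "associated \<kappa> h I S"

sublocale chernoff_semigroup \<subseteq> sg: convex_monotone_semigroup \<kappa> S
  using associated by (simp add: associated_def)

context chernoff_semigroup
begin

text \<open>
  The approximation is an iterated limit: first along the subsequence at a time \<open>d\<close> of the dense set,
  then \<open>d \<down> t\<close>. A single sequence cannot serve all functions and points at once, but the
  corresponding iterated filter can. Pairs \<open>(n, k)\<close> stand for \<open>k\<close> steps of length \<open>h n\<close>.
\<close>

lemma approximating_filter:
  assumes t: "0 \<le> t"
  obtains F :: "(nat \<times> nat) filter" where "F \<noteq> bot"
    "\<And>n0. \<forall>\<^sub>F (n, k) in F. n \<ge> n0"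
    "((\<lambda>(n, k). real k * h n) \<longlongrightarrow> t) F"
    "\<And>f x. f \<in> Ckappa \<kappa> \<Longrightarrow> ((\<lambda>(n, k). (I (h n) ^^ k) f x) \<longlongrightarrow> S t f x) F"
proof -
  obtain D \<phi> where D: "D \<subseteq> {0..}" "{0..} \<subseteq> closure D" and \<phi>: "strict_mono (\<phi> :: nat \<Rightarrow> nat)"
    and conv: "\<And>f d. f \<in> Ckappa \<kappa> \<Longrightarrow> d \<in> D \<Longrightarrow> mixed_conv \<kappa> (\<lambda>l. iterate h I (\<phi> l) d f) (S d f)"
    using associated unfolding associated_def by blast
  have sc: "strongly_continuous \<kappa> S" using associated by (simp add: associated_def)
  define H where "H = inf (at_right t) (principal D)"
  have evH: "eventually P H \<longleftrightarrow> (\<exists>b>t. \<forall>d. t < d \<and> d < b \<and> d \<in> D \<longrightarrow> P d)" for P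
    unfolding H_def eventually_inf_principal eventually_at_right_field by blast
  have Hnb: "H \<noteq> bot"
    unfolding trivial_limit_def evH
  proof safe
    fix b assume b: "t < b" "\<forall>d. t < d \<and> d < b \<and> d \<in> D \<longrightarrow> False"
    have "(t + b) / 2 \<in> closure D" using D(2) t b(1) by auto
    moreover have "(t + b) / 2 \<in> {t<..<b}" using b(1) by simp
    ultimately have "D \<inter> {t<..<b} \<noteq> {}"
      using open_Int_closure_eq_empty[of "{t<..<b}" D] by (metis IntI emptyE inf_commute open_greaterThanLessThan)
    then show False using b(2) by auto
  qed
  \<comment> \<open>the iterated filter, with \<open>steps h n d\<close> steps of length \<open>h n\<close> for the time \<open>d\<close>\<close>
  define ev where "ev P \<longleftrightarrow> (\<forall>\<^sub>F d in H. \<forall>\<^sub>F l in sequentially. P (\<phi> l, steps h (\<phi> l) d))" for P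
  define F where "F = Abs_filter ev"
  have "is_filter ev"
  proof
    show "ev (\<lambda>x. True)" by (simp add: ev_def)
    show "ev (\<lambda>x. P x \<and> Q x)" if "ev P" "ev Q" for P Q
      using that unfolding ev_def by eventually_elim (rule eventually_conj)
    show "ev Q" if "\<forall>x. P x \<longrightarrow> Q x" "ev P" for P Q
      using that(2) unfolding ev_def
      by (rule eventually_mono) (use that(1) in \<open>auto elim!: eventually_mono\<close>)
  qed
  then have evF: "eventually P F \<longleftrightarrow> ev P" for P
    unfolding F_def by (rule eventually_Abs_filter)
  have lim: "(f \<longlongrightarrow> L) F"
    if g: "\<And>d. t < d \<Longrightarrow> d \<in> D \<Longrightarrow> (\<lambda>l. f (\<phi> l, steps h (\<phi> l) d)) \<longlonglongrightarrow> g d" and L: "(g \<longlongrightarrow> L) (at_right t)"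
    for f :: "nat \<times> nat \<Rightarrow> real" and g L
  proof (rule tendstoI)
    fix e :: real assume e: "0 < e"
    have "\<forall>\<^sub>F d in at_right t. dist (g d) L < e / 2" using tendstoD[OF L, of "e / 2"] e by simp
    then obtain b where b: "t < b" "\<And>d. t < d \<Longrightarrow> d < b \<Longrightarrow> dist (g d) L < e / 2"
      unfolding eventually_at_right_field by blast
    have "\<forall>\<^sub>F l in sequentially. dist (f (\<phi> l, steps h (\<phi> l) d)) L < e" if d: "t < d" "d < b" "d \<in> D" for d
    proof -
      have "\<forall>\<^sub>F l in sequentially. dist (f (\<phi> l, steps h (\<phi> l) d)) (g d) < e / 2"
        using tendstoD[OF g[OF d(1,3)], of "e / 2"] e by simp
      then show ?thesis
        by (rule eventually_mono) (use b(2)[OF d(1,2)] in \<open>metis dist_triangle_half_l dist_commute\<close>)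
    qed
    then show "\<forall>\<^sub>F x in F. dist (f x) L < e"
      unfolding evF ev_def evH using b(1) by blast
  qed
  show ?thesis
  proof (rule that[of F])
    show "F \<noteq> bot"
      unfolding trivial_limit_def evF ev_def using Hnb by (simp add: trivial_limit_def)
    show "\<forall>\<^sub>F (n, k) in F. n \<ge> n0" for n0
    proof -
      have "\<forall>\<^sub>F l in sequentially. n0 \<le> \<phi> l"
        using filterlim_subseq[OF \<phi>] by (simp add: filterlim_at_top)
      then show ?thesis unfolding evF ev_def by simp
    qed
    show "((\<lambda>(n, k). real k * h n) \<longlongrightarrow> t) F"
    proof (rule lim)
      fix d assume d: "t < d" "d \<in> D"
      have "(\<lambda>l. h (\<phi> l)) \<longlonglongrightarrow> 0" using LIMSEQ_subseq_LIMSEQ[OF h_lim \<phi>] by (simp add: o_def)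
      then have "(\<lambda>l. d - h (\<phi> l)) \<longlonglongrightarrow> d - 0" by (intro tendsto_intros)
      then have "(\<lambda>l. d - h (\<phi> l)) \<longlonglongrightarrow> d" by simp
      from tendsto_sandwich[OF _ _ this tendsto_const]
      show "(\<lambda>l. case (\<phi> l, steps h (\<phi> l) d) of (n, k) \<Rightarrow> real k * h n) \<longlonglongrightarrow> d"
        using steps_bounds[of h _ d, OF h_pos] d(1) t
        by (simp add: always_eventually less_imp_le algebra_simps)
    qed (rule tendsto_ident_at)
    show "((\<lambda>(n, k). (I (h n) ^^ k) f x) \<longlongrightarrow> S t f x) F" if f: "f \<in> Ckappa \<kappa>" for f x
    proof (rule lim)
      show "(\<lambda>l. case (\<phi> l, steps h (\<phi> l) d) of (n, k) \<Rightarrow> (I (h n) ^^ k) f x) \<longlonglongrightarrow> S d f x"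
        if "t < d" "d \<in> D" for d
        using mixed_conv_pointwise[OF conv[OF f that(2)], of x] by (simp add: iterate_def)
      show "((\<lambda>s. S s f x) \<longlongrightarrow> S t f x) (at_right t)"
        by (rule sg.right_continuous[OF weight sc t f])
    qed
  qed
qed

text \<open>
  Every estimate for the iterates that is used below is a linear inequality between at most two
  values, with a bound that depends on the elapsed time.
\<close>

lemma limit_le:
  assumes t: "0 \<le> t" "t < T" and f: "f \<in> Ckappa \<kappa>" and g: "g \<in> Ckappa \<kappa>" and G: "isCont G t"
    and le: "\<And>n k. n \<ge> N \<Longrightarrow> real k * h n \<le> T \<Longrightarrow>
      a * (I (h n) ^^ k) f x + b * (I (h n) ^^ k) g y \<le> G (real k * h n)"
  shows "a * S t f x + b * S t g y \<le> G t"
proof -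
  obtain F :: "(nat \<times> nat) filter" where F: "F \<noteq> bot" "\<And>N. \<forall>\<^sub>F (n, k) in F. n \<ge> N"
    and time: "((\<lambda>(n, k). real k * h n) \<longlongrightarrow> t) F"
    and lim: "\<And>f x. f \<in> Ckappa \<kappa> \<Longrightarrow> ((\<lambda>(n, k). (I (h n) ^^ k) f x) \<longlongrightarrow> S t f x) F"
    using approximating_filter[OF t(1)] by blast
  have "((\<lambda>p. G (case p of (n, k) \<Rightarrow> real k * h n)) \<longlongrightarrow> G t) F"
    by (rule isCont_tendsto_compose[OF G time])
  moreover have "((\<lambda>p. a * (case p of (n, k) \<Rightarrow> (I (h n) ^^ k) f x) + b * (case p of (n, k) \<Rightarrow> (I (h n) ^^ k) g y))
      \<longlongrightarrow> a * S t f x + b * S t g y) F"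
    by (intro tendsto_intros lim f g)
  moreover have "\<forall>\<^sub>F p in F. a * (case p of (n, k) \<Rightarrow> (I (h n) ^^ k) f x) + b * (case p of (n, k) \<Rightarrow> (I (h n) ^^ k) g y)
      \<le> G (case p of (n, k) \<Rightarrow> real k * h n)"
    using F(2)[of N] order_tendstoD(2)[OF time t(2)]
    by eventually_elim (auto intro: le less_imp_le)
  ultimately show ?thesis by (rule tendsto_le[OF F(1)])
qed

lemma limit_abs_diff_le:
  assumes t: "0 \<le> t" "t < T" and f: "f \<in> Ckappa \<kappa>" and g: "g \<in> Ckappa \<kappa>" and G: "isCont G t"
    and le: "\<And>n k. n \<ge> N \<Longrightarrow> real k * h n \<le> T \<Longrightarrow>
      \<bar>(I (h n) ^^ k) f x - (I (h n) ^^ k) g y\<bar> \<le> G (real k * h n)"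
  shows "\<bar>S t f x - S t g y\<bar> \<le> G t"
proof -
  have "1 * S t f x + - 1 * S t g y \<le> G t"
    by (rule limit_le[OF t f g G, of N]) (use le in \<open>force simp: abs_le_iff\<close>)
  moreover have "- 1 * S t f x + 1 * S t g y \<le> G t"
    by (rule limit_le[OF t f g G, of N]) (use le in \<open>force simp: abs_le_iff\<close>)
  ultimately show ?thesis by linarith
qed

lemma semigroup_lipschitz:
  assumes R: "0 \<le> R" and T: "0 \<le> T"
  obtains L where "1 \<le> L"
    "\<And>f g t e x. 0 \<le> t \<Longrightarrow> t \<le> T \<Longrightarrow> f \<in> Ckappa_ball \<kappa> R \<Longrightarrow> g \<in> Ckappa_ball \<kappa> R \<Longrightarrow>
      (\<And>x. \<bar>f x - g x\<bar> * \<kappa> x \<le> e) \<Longrightarrow> \<bar>S t f x - S t g x\<bar> \<le> L * e / \<kappa> x"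
proof -
  obtain L where L: "1 \<le> L"
    "\<And>f g n k e x. real k * h n \<le> T + 1 \<Longrightarrow> f \<in> Ckappa_ball \<kappa> R \<Longrightarrow> g \<in> Ckappa_ball \<kappa> R \<Longrightarrow>
      (\<And>x. \<bar>f x - g x\<bar> * \<kappa> x \<le> e) \<Longrightarrow> \<bar>(I (h n) ^^ k) f x - (I (h n) ^^ k) g x\<bar> * \<kappa> x \<le> L * e"
    using iter_lipschitz[OF R, of "T + 1"] add_nonneg_nonneg[OF T zero_le_one] by blast
  have "\<bar>S t f x - S t g x\<bar> \<le> L * e / \<kappa> x"
    if t: "0 \<le> t" "t \<le> T" and fg: "f \<in> Ckappa_ball \<kappa> R" "g \<in> Ckappa_ball \<kappa> R"
      and e: "\<And>x. \<bar>f x - g x\<bar> * \<kappa> x \<le> e" for f g t e x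
  proof (rule limit_abs_diff_le[where G = "\<lambda>_. L * e / \<kappa> x" and T = "T + 1" and N = 0])
    show "\<bar>(I (h n) ^^ k) f x - (I (h n) ^^ k) g x\<bar> \<le> L * e / \<kappa> x" if "real k * h n \<le> T + 1" for n k
      using L(2)[OF that fg e, of x] kappa_pos[of x] by (simp add: pos_le_divide_eq)
  qed (use t fg Ckappa_ball_subset in auto)
  then show ?thesis using that L(1) by blast
qed

lemma semigroup_equicontinuous:
  assumes e: "0 < e" and R: "0 \<le> R" and T: "0 \<le> T" and K: "compact K"
  obtains K' \<delta> where "compact K'" "0 < \<delta>"
    "\<And>f g t x. 0 \<le> t \<Longrightarrow> t \<le> T \<Longrightarrow> f \<in> Ckappa_ball \<kappa> R \<Longrightarrow> g \<in> Ckappa_ball \<kappa> R \<Longrightarrow>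
      (\<And>x. x \<in> K' \<Longrightarrow> \<bar>f x - g x\<bar> \<le> \<delta>) \<Longrightarrow> x \<in> K \<Longrightarrow> \<bar>S t f x - S t g x\<bar> \<le> e"
proof -
  have T1: "0 \<le> T + 1" using T by simp
  obtain K' \<delta> where K': "compact K'" "0 < \<delta>"
    "\<And>f g n k x. real k * h n \<le> T + 1 \<Longrightarrow> f \<in> Ckappa_ball \<kappa> R \<Longrightarrow> g \<in> Ckappa_ball \<kappa> R \<Longrightarrow>
      (\<And>x. x \<in> K' \<Longrightarrow> \<bar>f x - g x\<bar> \<le> \<delta>) \<Longrightarrow> x \<in> K \<Longrightarrow> \<bar>(I (h n) ^^ k) f x - (I (h n) ^^ k) g x\<bar> \<le> e"
    using iter_equicontinuous[OF e R T1 K] by blast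
  have main: "\<bar>S t f x - S t g x\<bar> \<le> e"
    if t: "0 \<le> t" "t \<le> T" and fg: "f \<in> Ckappa_ball \<kappa> R" "g \<in> Ckappa_ball \<kappa> R"
      and close: "\<And>x. x \<in> K' \<Longrightarrow> \<bar>f x - g x\<bar> \<le> \<delta>" and x: "x \<in> K" for f g t x
  proof (rule limit_abs_diff_le[where G = "\<lambda>_. e" and T = "T + 1" and N = 0])
    show "\<bar>(I (h n) ^^ k) f x - (I (h n) ^^ k) g x\<bar> \<le> e" if "real k * h n \<le> T + 1" for n k
      by (rule K'(3)[OF that fg close x])
  qed (use t fg Ckappa_ball_subset in auto)
  show ?thesis by (rule that[OF K'(1,2) main])
qed

lemma semigroup_Lip_b:
  obtains c where "0 \<le> c"
    "\<And>f r t. 0 \<le> r \<Longrightarrow> 0 \<le> t \<Longrightarrow> f \<in> Lip_b r \<Longrightarrow> S t f \<in> Lip_b (exp (c * t) * r)"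
proof -
  obtain c where c: "0 \<le> c"
    "\<And>f r n k. 0 \<le> r \<Longrightarrow> f \<in> Lip_b r \<Longrightarrow> (I (h n) ^^ k) f \<in> Lip_b (exp (c * (real k * h n)) * r)"
    using iter_Lip_b by blast
  have "S t f \<in> Lip_b (exp (c * t) * r)" if r: "0 \<le> r" and t: "0 \<le> t" and f: "f \<in> Lip_b r" for f r t
  proof (rule Lip_b_I)
    have fC: "f \<in> Ckappa \<kappa>" by (rule Lip_b_in_Ckappa[OF weight f])
    have t1: "t < t + 1" by simp
    show "\<bar>S t f x - S t f y\<bar> \<le> exp (c * t) * r * dist x y" for x y
      by (rule limit_abs_diff_le[OF t t1 fC fC, where G = "\<lambda>s. exp (c * s) * r * dist x y" and N = 0])
         (use Lip_b_D[OF c(2)[OF r f]] in \<open>auto intro!: continuous_intros\<close>)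
    have bound: "\<bar>(I (h n) ^^ k) f x\<bar> \<le> exp (c * (real k * h n)) * r" for n k x
      using c(2)[OF r f, of k n] by (simp add: Lip_b_def)
    have "1 * S t f x + 0 * S t f x \<le> exp (c * t) * r" for x
      by (rule limit_le[OF t t1 fC fC, where G = "\<lambda>s. exp (c * s) * r" and N = 0])
         (use bound in \<open>auto intro!: continuous_intros simp: abs_le_iff\<close>)
    moreover have "- 1 * S t f x + 0 * S t f x \<le> exp (c * t) * r" for x
      by (rule limit_le[OF t t1 fC fC, where G = "\<lambda>s. exp (c * s) * r" and N = 0])
         (use bound in \<open>auto intro!: continuous_intros simp: abs_le_iff\<close>)
    ultimately show "\<bar>S t f x\<bar> \<le> exp (c * t) * r" for x by (simp add: abs_le_iff)
  qed (use r in simp)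
  then show ?thesis using that c(1) by blast
qed

lemma semigroup_shift:
  assumes r: "0 \<le> r" and T: "0 \<le> T" and e: "0 < e"
  obtains \<delta> where "0 < \<delta>"
    "\<And>f x t y. 0 \<le> t \<Longrightarrow> t \<le> T \<Longrightarrow> f \<in> Lip_b r \<Longrightarrow> norm x \<le> \<delta> \<Longrightarrow>
      S t (shift x f) y \<le> S t f (x + y) + e * t / \<kappa> y"
proof -
  have T1: "0 \<le> T + 1" using T by simp
  obtain \<delta> n0 where \<delta>: "0 < \<delta>"
    "\<And>f x n k y. n \<ge> n0 \<Longrightarrow> real k * h n \<le> T + 1 \<Longrightarrow> f \<in> Lip_b r \<Longrightarrow> norm x \<le> \<delta> \<Longrightarrow>
      (I (h n) ^^ k) (shift x f) y \<le> (I (h n) ^^ k) f (x + y) + e * (real k * h n) / \<kappa> y"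
    using iter_shift[OF r T1 e] by blast
  have "S t (shift x f) y \<le> S t f (x + y) + e * t / \<kappa> y"
    if t: "0 \<le> t" "t \<le> T" and f: "f \<in> Lip_b r" and x: "norm x \<le> \<delta>" for f x t y
  proof -
    have "1 * S t (shift x f) y + - 1 * S t f (x + y) \<le> e * t / \<kappa> y"
    proof (rule limit_le[where G = "\<lambda>s. e * s / \<kappa> y" and T = "T + 1" and N = n0])
      show "shift x f \<in> Ckappa \<kappa>" by (rule Lip_b_in_Ckappa[OF weight Lip_b_shift[OF f]])
      show "f \<in> Ckappa \<kappa>" by (rule Lip_b_in_Ckappa[OF weight f])
      show "1 * (I (h n) ^^ k) (shift x f) y + - 1 * (I (h n) ^^ k) f (x + y) \<le> e * (real k * h n) / \<kappa> y"
        if "n \<ge> n0" "real k * h n \<le> T + 1" for n k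
        using \<delta>(2)[OF that f x, of y] by simp
    qed (use t kappa_pos[of y] in \<open>auto intro!: continuous_intros\<close>)
    then show ?thesis by simp
  qed
  then show ?thesis using that \<delta>(1) by blast
qed

lemma semigroup_smooth_bound:
  assumes g: "g \<in> Cb_infty" and T: "0 \<le> T"
  obtains C where "0 \<le> C" "\<And>t x. 0 \<le> t \<Longrightarrow> t \<le> T \<Longrightarrow> \<bar>S t g x - g x\<bar> * \<kappa> x \<le> C * t"
proof -
  obtain C where C: "0 \<le> C"
    "\<And>n k x. real k * h n \<le> T + 1 \<Longrightarrow> \<bar>(I (h n) ^^ k) g x - g x\<bar> * \<kappa> x \<le> C * (real k * h n)"
    using iter_smooth_bound[OF g, of "T + 1"] add_nonneg_nonneg[OF T zero_le_one] by blast
  have gC: "g \<in> Ckappa \<kappa>" using g by (rule Cb_infty_Ckappa[OF weight])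
  have "\<bar>S t g x - g x\<bar> * \<kappa> x \<le> C * t" if t: "0 \<le> t" "t \<le> T" for t x
  proof -
    have t1: "t < T + 1" using t by simp
    have step: "\<bar>(I (h n) ^^ k) g x - g x\<bar> \<le> C * (real k * h n) / \<kappa> x" if "real k * h n \<le> T + 1" for n k
      using C(2)[OF that, of x] kappa_pos[of x] by (simp add: pos_le_divide_eq)
    have cont: "isCont (\<lambda>s. C * s / \<kappa> x + d) t" for d
      using kappa_pos[of x] by (auto intro!: continuous_intros)
    have step1: "1 * (I (h n) ^^ k) g x + 0 * (I (h n) ^^ k) g x \<le> C * (real k * h n) / \<kappa> x + g x"
      and step2: "- 1 * (I (h n) ^^ k) g x + 0 * (I (h n) ^^ k) g x \<le> C * (real k * h n) / \<kappa> x + - g x"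
      if "real k * h n \<le> T + 1" for n k
      using step[OF that] unfolding abs_le_iff by linarith+
    have "1 * S t g x + 0 * S t g x \<le> C * t / \<kappa> x + g x"
      by (rule limit_le[OF t(1) t1 gC gC cont step1, of 0])
    moreover have "- 1 * S t g x + 0 * S t g x \<le> C * t / \<kappa> x + - g x"
      by (rule limit_le[OF t(1) t1 gC gC cont step2, of 0])
    ultimately have "\<bar>S t g x - g x\<bar> \<le> C * t / \<kappa> x" by (simp add: abs_le_iff)
    then show ?thesis using kappa_pos[of x] by (simp add: pos_le_divide_eq)
  qed
  then show ?thesis using that C(1) by blast
qed

text \<open>
  Thus \<open>I'(0)\<close> is the generator of the semigroup on smooth functions, locally uniformly in space.
\<close>

lemma semigroup_expansion:
  assumes g: "g \<in> Cb_infty" and K: "compact K" and e: "0 < e"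
  shows "\<exists>\<delta>>0. \<forall>t. 0 \<le> t \<and> t < \<delta> \<longrightarrow> (\<forall>x\<in>K. \<bar>S t g x - g x - t * deriv0 \<kappa> I g x\<bar> \<le> e * t)"
proof -
  define a where "a = deriv0 \<kappa> I g"
  obtain \<delta> n0 where \<delta>: "0 < \<delta>" "\<And>n k x. n \<ge> n0 \<Longrightarrow> real k * h n \<le> \<delta> \<Longrightarrow> x \<in> K \<Longrightarrow>
      \<bar>(I (h n) ^^ k) g x - g x - real k * h n * a x\<bar> \<le> e * (real k * h n)"
    using iter_expansion[OF g K e] unfolding a_def by blast
  have gC: "g \<in> Ckappa \<kappa>" using g by (rule Cb_infty_Ckappa[OF weight])
  have "\<bar>S t g x - g x - t * a x\<bar> \<le> e * t" if t: "0 \<le> t" "t < \<delta>" and x: "x \<in> K" for t x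
  proof -
    have cont: "isCont (\<lambda>s. e * s + (g x + s * a x)) t" "isCont (\<lambda>s. e * s - (g x + s * a x)) t"
      by (intro continuous_intros)+
    have step1: "1 * (I (h n) ^^ k) g x + 0 * (I (h n) ^^ k) g x \<le> e * (real k * h n) + (g x + real k * h n * a x)"
      and step2: "- 1 * (I (h n) ^^ k) g x + 0 * (I (h n) ^^ k) g x \<le> e * (real k * h n) - (g x + real k * h n * a x)"
      if "n \<ge> n0" "real k * h n \<le> \<delta>" for n k
      using \<delta>(2)[OF that x] unfolding abs_le_iff by linarith+
    have "1 * S t g x + 0 * S t g x \<le> e * t + (g x + t * a x)"
      by (rule limit_le[OF t gC gC cont(1) step1])
    moreover have "- 1 * S t g x + 0 * S t g x \<le> e * t - (g x + t * a x)"
      by (rule limit_le[OF t gC gC cont(2) step2])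
    ultimately show ?thesis by (simp add: abs_le_iff)
  qed
  then show ?thesis using \<delta>(1) unfolding a_def by blast
qed

end

lemma mollify_Lip_b:
  fixes f :: "'a::euclidean_space \<Rightarrow> real"
  assumes \<sigma>: "0 < \<sigma>" and f: "f \<in> Lip_b r"
  shows "mollify \<sigma> f \<in> Cb_infty" "\<bar>mollify \<sigma> f x\<bar> \<le> r"
proof -
  have fc: "continuous_on UNIV f" and fr: "\<And>x. \<bar>f x\<bar> \<le> r"
    using Lip_b_continuous[OF f] f by (auto simp: Lip_b_def)
  show "mollify \<sigma> f \<in> Cb_infty" by (rule mollify_Cb_infty[OF \<sigma> fc fr])
  show "\<bar>mollify \<sigma> f x\<bar> \<le> r" using mollify_near[OF \<sigma> fc, of x 0 r] fr by simp
qed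

lemma mollify_Lip_b_in_Ckappa_ball:
  fixes f :: "'a::euclidean_space \<Rightarrow> real"
  assumes w: "weight \<kappa>" and B: "\<And>x. \<kappa> x \<le> B" and \<sigma>: "0 < \<sigma>" and f: "f \<in> Lip_b r"
  shows "mollify \<sigma> f \<in> Ckappa_ball \<kappa> (r * B)"
proof (rule bounded_in_Ckappa_ball[OF w _ _ B])
  obtain s where "mollify \<sigma> f \<in> Lip_b s" using Cb_infty_Lip_b[OF mollify_Lip_b(1)[OF \<sigma> f]] by blast
  then show "continuous_on UNIV (mollify \<sigma> f)" by (rule Lip_b_continuous)
qed (rule mollify_Lip_b(2)[OF \<sigma> f])

lemma mollify_Lip_b_near:
  fixes f :: "'a::euclidean_space \<Rightarrow> real" and \<sigma> :: real
  assumes \<sigma>: "0 < \<sigma>" "DIM('a) * \<sigma> \<le> e" and f: "f \<in> Lip_b r" and r: "0 \<le> r"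
  shows "\<bar>mollify \<sigma> f x - f x\<bar> \<le> r * e"
proof (rule mollify_near[OF \<sigma>(1) Lip_b_continuous[OF f]])
  fix y :: 'a assume "norm y \<le> DIM('a) * \<sigma>"
  then have "r * dist (x + y) x \<le> r * e" using \<sigma>(2) r by (intro mult_left_mono) (auto simp: dist_norm)
  then show "\<bar>f (x + y) - f x\<bar> \<le> r * e" using Lip_b_D[OF f, of "x + y" x] by linarith
qed

text \<open>
  Jensen's inequality for the convex operator \<open>S t\<close> and the averages that approximate the
  mollification, followed by the estimate for small translations.
\<close>

lemma (in chernoff_semigroup) mollify_commute:
  assumes r: "0 \<le> r" and T: "0 \<le> T" and e: "0 < e"
  obtains \<delta> where "0 < \<delta>"
    "\<And>(\<sigma>::real) f t y. 0 < \<sigma> \<Longrightarrow> DIM('a) * \<sigma> \<le> \<delta> \<Longrightarrow> 0 \<le> t \<Longrightarrow> t \<le> T \<Longrightarrow> f \<in> Lip_b r \<Longrightarrow>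
      S t (mollify \<sigma> f) y \<le> mollify \<sigma> (S t f) y + e * t / \<kappa> y"
proof -
  obtain \<delta> where \<delta>: "0 < \<delta>"
    "\<And>f x t y. 0 \<le> t \<Longrightarrow> t \<le> T \<Longrightarrow> f \<in> Lip_b r \<Longrightarrow> norm x \<le> \<delta> \<Longrightarrow>
      S t (shift x f) y \<le> S t f (x + y) + e * t / \<kappa> y"
    using semigroup_shift[OF r T e] by blast
  obtain c where c: "0 \<le> c"
    "\<And>f r t. 0 \<le> r \<Longrightarrow> 0 \<le> t \<Longrightarrow> f \<in> Lip_b r \<Longrightarrow> S t f \<in> Lip_b (exp (c * t) * r)"
    using semigroup_Lip_b by blast
  obtain B where B: "0 < B" "\<And>x. \<kappa> x \<le> B" using weight_bounded[OF weight] by blast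
  have rB: "0 \<le> r * B" using r B by simp
  obtain L where L: "1 \<le> L"
    "\<And>f g t e x. 0 \<le> t \<Longrightarrow> t \<le> T \<Longrightarrow> f \<in> Ckappa_ball \<kappa> (r * B) \<Longrightarrow> g \<in> Ckappa_ball \<kappa> (r * B) \<Longrightarrow>
      (\<And>x. \<bar>f x - g x\<bar> * \<kappa> x \<le> e) \<Longrightarrow> \<bar>S t f x - S t g x\<bar> \<le> L * e / \<kappa> x"
    using semigroup_lipschitz[OF rB T] by blast
  have main: "S t (mollify \<sigma> f) y \<le> mollify \<sigma> (S t f) y + e * t / \<kappa> y"
    if \<sigma>: "0 < \<sigma>" "DIM('a) * \<sigma> \<le> \<delta>" and t: "0 \<le> t" "t \<le> T" and f: "f \<in> Lip_b r" for \<sigma> :: real and f t y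
  proof (rule field_le_epsilon)
    fix \<eta> :: real assume \<eta>: "0 < \<eta>"
    define r' where "r' = exp (c * t) * r"
    have r': "0 \<le> r'" using r by (simp add: r'_def)
    have Sf: "S t f \<in> Lip_b r'" unfolding r'_def by (rule c(2)[OF r t(1) f])
    define Q where "Q = L * (r * B) / \<kappa> y + r'"
    have Q: "0 \<le> Q" using L(1) rB r' kappa_pos[of y] by (simp add: Q_def)
    define d where "d = \<eta> / (Q + 1)"
    have d: "0 < d" "Q * d \<le> \<eta>" using \<eta> Q by (auto simp: d_def field_simps)
    obtain P :: "('a \<times> 'a set) set" and w where P: "finite P" "\<And>i. i \<in> P \<Longrightarrow> 0 \<le> w i" "sum w P = 1"
      "\<And>i. i \<in> P \<Longrightarrow> norm (fst i) \<le> DIM('a) * \<sigma>"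
      and avg: "\<And>u x m. continuous_on UNIV u \<Longrightarrow> (\<And>y z. dist y z < d \<Longrightarrow> \<bar>u (x + y) - u (x + z)\<bar> \<le> m) \<Longrightarrow>
        \<bar>mollify \<sigma> u x - (\<Sum>i\<in>P. w i * u (x + fst i))\<bar> \<le> m"
      using mollify_finite_average[OF \<sigma>(1) d(1), where 'a = 'a] by blast
    have avg_Lip: "\<bar>mollify \<sigma> u x - (\<Sum>i\<in>P. w i * u (x + fst i))\<bar> \<le> m * d"
      if u: "u \<in> Lip_b m" and m: "0 \<le> m" for u x m
    proof (rule avg[OF Lip_b_continuous[OF u]])
      fix y z :: 'a assume "dist y z < d"
      then have "m * dist (x + y) (x + z) \<le> m * d" using m by (intro mult_left_mono) auto
      then show "\<bar>u (x + y) - u (x + z)\<bar> \<le> m * d" using Lip_b_D[OF u, of "x + y" "x + z"] by linarith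
    qed
    have Pne: "P \<noteq> {}" using P(3) by auto
    have sh: "shift (fst i) f \<in> Ckappa \<kappa>" for i :: "'a \<times> 'a set"
      by (rule Lip_b_in_Ckappa[OF weight Lip_b_shift[OF f]])
    define A where "A = (\<lambda>x. \<Sum>i\<in>P. w i * shift (fst i) f x)"
    have A_eq: "A x = (\<Sum>i\<in>P. w i * f (x + fst i))" for x
      by (simp add: A_def shift_def add.commute)
    have jensen: "A \<in> Ckappa \<kappa> \<and> S t A y \<le> (\<Sum>i\<in>P. w i * S t (shift (fst i) f) y)"
      unfolding A_def using sg.S1[OF t(1)] P sh
      by (intro convex_op_average[OF weight _ P(1) Pne]) auto
    have AB: "A \<in> Ckappa_ball \<kappa> (r * B)"
    proof (rule bounded_in_Ckappa_ball[OF weight _ _ B(2)])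
      show "continuous_on UNIV A" using jensen by (auto intro: Ckappa_continuous)
      fix x
      have "\<bar>A x\<bar> \<le> (\<Sum>i\<in>P. w i * r)"
        unfolding A_eq
      proof (rule order.trans[OF sum_abs], rule sum_mono)
        fix i assume "i \<in> P"
        then have "0 \<le> w i" by (rule P(2))
        moreover have "\<bar>f (x + fst i)\<bar> \<le> r" using f by (simp add: Lip_b_def)
        ultimately show "\<bar>w i * f (x + fst i)\<bar> \<le> w i * r" by (simp add: abs_mult mult_left_mono)
      qed
      also have "\<dots> = r" using P(3) by (simp flip: sum_distrib_right)
      finally show "\<bar>A x\<bar> \<le> r" .
    qed
    have "\<bar>mollify \<sigma> f x - A x\<bar> * \<kappa> x \<le> r * d * B" for x
      unfolding A_eq using avg_Lip[OF f r, of x] B(2)[of x] kappa_pos[of x] r d(1)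
      by (intro mult_mono) auto
    from L(2)[OF t mollify_Lip_b_in_Ckappa_ball[OF weight B(2) \<sigma>(1) f] AB this, of y]
    have "S t (mollify \<sigma> f) y \<le> S t A y + L * (r * d * B) / \<kappa> y" by linarith
    also have "S t A y \<le> (\<Sum>i\<in>P. w i * S t (shift (fst i) f) y)" using jensen by blast
    also have "\<dots> \<le> (\<Sum>i\<in>P. w i * (S t f (y + fst i) + e * t / \<kappa> y))"
    proof (intro sum_mono mult_left_mono P(2))
      fix i assume "i \<in> P"
      then have "norm (fst i) \<le> \<delta>" using P(4) \<sigma>(2) by fastforce
      from \<delta>(2)[OF t f this, of y] show "S t (shift (fst i) f) y \<le> S t f (y + fst i) + e * t / \<kappa> y"
        by (simp add: add.commute)
    qed
    also have "\<dots> = (\<Sum>i\<in>P. w i * S t f (y + fst i)) + e * t / \<kappa> y"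
      by (simp only: distrib_left sum.distrib sum_distrib_right[symmetric] P(3) mult_1)
    also have "(\<Sum>i\<in>P. w i * S t f (y + fst i)) \<le> mollify \<sigma> (S t f) y + r' * d"
      using avg_Lip[OF Sf r', of y] by linarith
    finally have "S t (mollify \<sigma> f) y
        \<le> mollify \<sigma> (S t f) y + r' * d + e * t / \<kappa> y + L * (r * d * B) / \<kappa> y" by simp
    moreover have "r' * d + L * (r * d * B) / \<kappa> y = Q * d"
      by (simp add: Q_def distrib_right)
    ultimately show "S t (mollify \<sigma> f) y \<le> mollify \<sigma> (S t f) y + e * t / \<kappa> y + \<eta>"
      using d(2) by linarith
  qed
  show ?thesis by (rule that[OF \<delta>(1) main])
qed

section \<open>Comparison of the two semigroups\<close>

text \<open>
  The supremum of all \<open>s\<close> with \<open>\<psi> 0 \<le> \<psi> s\<close> is attained by semicontinuity from the left, and it cannot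
  be smaller than \<open>t\<close> because \<open>\<psi>\<close> does not decrease immediately to its right.
\<close>

lemma le_of_local_increase:
  fixes \<psi> :: "real \<Rightarrow> real"
  assumes t: "0 \<le> t"
    and incr: "\<And>s. 0 \<le> s \<Longrightarrow> s < t \<Longrightarrow> \<exists>\<delta>>0. \<forall>h. 0 < h \<and> h < \<delta> \<and> s + h \<le> t \<longrightarrow> \<psi> s \<le> \<psi> (s + h)"
    and left: "\<And>s c X. 0 < s \<Longrightarrow> s \<le> t \<Longrightarrow> (\<And>n::nat. 0 \<le> X n) \<Longrightarrow> (\<And>n. X n < s) \<Longrightarrow> X \<longlonglongrightarrow> s \<Longrightarrow>
      (\<And>n. c \<le> \<psi> (X n)) \<Longrightarrow> c \<le> \<psi> s"
  shows "\<psi> 0 \<le> \<psi> t"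
proof -
  define A where "A = {s. 0 \<le> s \<and> s \<le> t \<and> \<psi> 0 \<le> \<psi> s}"
  have A0: "0 \<in> A" using t by (simp add: A_def)
  have bdd: "bdd_above A" unfolding A_def by (intro bdd_aboveI[of _ t]) auto
  define m where "m = Sup A"
  have m: "0 \<le> m" "m \<le> t"
  proof -
    show "0 \<le> m" unfolding m_def by (rule cSup_upper[OF A0 bdd])
    show "m \<le> t" unfolding m_def by (rule cSup_least) (use A0 in \<open>auto simp: A_def\<close>)
  qed
  have mA: "m \<in> A"
  proof (rule ccontr)
    assume mA: "m \<notin> A"
    then have m0: "0 < m" using A0 m(1) by (metis less_eq_real_def)
    have "m \<in> closure A" unfolding m_def by (rule closure_contains_Sup) (use A0 bdd in auto)
    then obtain X where X: "\<And>n. X n \<in> A" "X \<longlonglongrightarrow> m" by (auto simp: closure_sequential)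
    have "X n < m" for n
      using cSup_upper[OF X(1)[of n] bdd] X(1)[of n] mA by (auto simp: m_def less_le)
    then have "\<psi> 0 \<le> \<psi> m"
      by (intro left[OF m0 m(2) _ _ X(2)]) (use X(1) in \<open>auto simp: A_def\<close>)
    then show False using mA m by (simp add: A_def)
  qed
  have "m = t"
  proof (rule ccontr)
    assume "m \<noteq> t"
    then have mt: "m < t" using m by simp
    obtain \<delta> where \<delta>: "0 < \<delta>" "\<forall>h. 0 < h \<and> h < \<delta> \<and> m + h \<le> t \<longrightarrow> \<psi> m \<le> \<psi> (m + h)"
      using incr[OF m(1) mt] by blast
    define h where "h = min (\<delta> / 2) (t - m)"
    have h: "0 < h" "h < \<delta>" "m + h \<le> t" using \<delta>(1) mt by (auto simp: h_def min_def)
    then have "m + h \<in> A" using \<delta>(2) mA m by (force simp: A_def)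
    then have "m + h \<le> m" unfolding m_def by (rule cSup_upper[OF _ bdd])
    then show False using h(1) by simp
  qed
  then show ?thesis using mA by (simp add: A_def)
qed

locale generator_comparison =
  A: chernoff_semigroup \<kappa> h I S + B: chernoff_semigroup \<kappa> h J T
  for \<kappa> :: "'a::euclidean_space \<Rightarrow> real" and h :: "nat \<Rightarrow> real" and I J S T :: "'a operators" +
  assumes generator_le: "\<And>f. f \<in> Cb_infty \<Longrightarrow> deriv0 \<kappa> I f \<le> deriv0 \<kappa> J f"
begin

text \<open>
  The remainder is \<open>k = (S \<tau> u - T \<tau> u)\<^sup>+ / \<tau>\<close>. Both semigroups move \<open>u\<close> by \<open>O(\<tau>)\<close>, which bounds
  \<open>k\<close> in the weighted norm, and the ordering of the generators makes it small on compact sets.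
\<close>

lemma infinitesimal_domination:
  assumes u: "u \<in> Cb_infty"
  obtains C where "0 \<le> C"
    "\<And>K d. compact K \<Longrightarrow> 0 < d \<Longrightarrow> \<exists>\<delta>>0. \<forall>\<tau>. 0 < \<tau> \<and> \<tau> < \<delta> \<longrightarrow>
      (\<exists>k\<in>Ckappa_ball \<kappa> C. (\<forall>z. S \<tau> u z \<le> T \<tau> u z + \<tau> * k z) \<and> (\<forall>z\<in>K. \<bar>k z\<bar> \<le> d))"
proof -
  obtain C1 where C1: "0 \<le> C1" "\<And>t x. 0 \<le> t \<Longrightarrow> t \<le> 1 \<Longrightarrow> \<bar>S t u x - u x\<bar> * \<kappa> x \<le> C1 * t"
    using A.semigroup_smooth_bound[OF u zero_le_one] by blast
  obtain C2 where C2: "0 \<le> C2" "\<And>t x. 0 \<le> t \<Longrightarrow> t \<le> 1 \<Longrightarrow> \<bar>T t u x - u x\<bar> * \<kappa> x \<le> C2 * t"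
    using B.semigroup_smooth_bound[OF u zero_le_one] by blast
  have uC: "u \<in> Ckappa \<kappa>" by (rule Cb_infty_Ckappa[OF A.weight u])
  have main: "\<exists>\<delta>>0. \<forall>\<tau>. 0 < \<tau> \<and> \<tau> < \<delta> \<longrightarrow>
      (\<exists>k\<in>Ckappa_ball \<kappa> (C1 + C2). (\<forall>z. S \<tau> u z \<le> T \<tau> u z + \<tau> * k z) \<and> (\<forall>z\<in>K. \<bar>k z\<bar> \<le> d))"
    if K: "compact K" and d: "0 < d" for K d
  proof -
    obtain \<delta>1 where \<delta>1: "0 < \<delta>1" "\<And>t x. 0 \<le> t \<Longrightarrow> t < \<delta>1 \<Longrightarrow> x \<in> K \<Longrightarrow>
        \<bar>S t u x - u x - t * deriv0 \<kappa> I u x\<bar> \<le> d / 2 * t"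
      using A.semigroup_expansion[OF u K half_gt_zero[OF d]] by blast
    obtain \<delta>2 where \<delta>2: "0 < \<delta>2" "\<And>t x. 0 \<le> t \<Longrightarrow> t < \<delta>2 \<Longrightarrow> x \<in> K \<Longrightarrow>
        \<bar>T t u x - u x - t * deriv0 \<kappa> J u x\<bar> \<le> d / 2 * t"
      using B.semigroup_expansion[OF u K half_gt_zero[OF d]] by blast
    define \<delta> where "\<delta> = min 1 (min \<delta>1 \<delta>2)"
    have "\<exists>k\<in>Ckappa_ball \<kappa> (C1 + C2). (\<forall>z. S \<tau> u z \<le> T \<tau> u z + \<tau> * k z) \<and> (\<forall>z\<in>K. \<bar>k z\<bar> \<le> d)"
      if \<tau>: "0 < \<tau>" "\<tau> < \<delta>" for \<tau>
    proof -
      define k where "k z = max 0 (S \<tau> u z - T \<tau> u z) / \<tau>" for z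
      have \<tau>1: "0 \<le> \<tau>" "\<tau> \<le> 1" "\<tau> < \<delta>1" "\<tau> < \<delta>2" using \<tau> by (auto simp: \<delta>_def)
      have "k \<in> Ckappa_ball \<kappa> (C1 + C2)"
        unfolding Ckappa_ball_iff
      proof (intro conjI allI)
        show "continuous_on UNIV k"
          unfolding k_def using \<tau>(1)
          by (intro continuous_intros Ckappa_continuous[OF A.sg.maps[OF \<tau>1(1) uC]]
              Ckappa_continuous[OF B.sg.maps[OF \<tau>1(1) uC]]) auto
        fix z
        have "max 0 (S \<tau> u z - T \<tau> u z) \<le> \<bar>S \<tau> u z - u z\<bar> + \<bar>T \<tau> u z - u z\<bar>" by linarith
        then have "max 0 (S \<tau> u z - T \<tau> u z) * \<kappa> z \<le> (\<bar>S \<tau> u z - u z\<bar> + \<bar>T \<tau> u z - u z\<bar>) * \<kappa> z"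
          using A.kappa_pos[of z] by (intro mult_right_mono) auto
        also have "\<dots> \<le> (C1 + C2) * \<tau>"
          using C1(2)[OF \<tau>1(1,2), of z] C2(2)[OF \<tau>1(1,2), of z] unfolding distrib_right by linarith
        finally show "\<bar>k z\<bar> * \<kappa> z \<le> C1 + C2"
          using \<tau>(1) by (simp add: k_def pos_divide_le_eq)
      qed
      moreover have "S \<tau> u z \<le> T \<tau> u z + \<tau> * k z" for z
        using \<tau>(1) by (simp add: k_def)
      moreover have "\<bar>k z\<bar> \<le> d" if z: "z \<in> K" for z
      proof -
        have "\<tau> * deriv0 \<kappa> I u z \<le> \<tau> * deriv0 \<kappa> J u z"
          using generator_le[OF u] \<tau>1(1) by (intro mult_left_mono) (auto simp: le_fun_def)
        then have "S \<tau> u z - T \<tau> u z \<le> d / 2 * \<tau> + d / 2 * \<tau>"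
          using \<delta>1(2)[OF \<tau>1(1,3) z] \<delta>2(2)[OF \<tau>1(1,4) z] by linarith
        moreover have "d / 2 * \<tau> + d / 2 * \<tau> = d * \<tau>" by simp
        moreover have "0 \<le> d * \<tau>" using d \<tau>(1) by simp
        ultimately have "max 0 (S \<tau> u z - T \<tau> u z) \<le> d * \<tau>" by linarith
        then show ?thesis using \<tau>(1) by (simp add: k_def pos_divide_le_eq)
      qed
      ultimately show ?thesis by blast
    qed
    moreover have "0 < \<delta>" using \<delta>1(1) \<delta>2(1) by (simp add: \<delta>_def)
    ultimately show ?thesis by blast
  qed
  have C0: "0 \<le> C1 + C2" using C1(1) C2(1) by simp
  show ?thesis by (rule that[OF C0 main])
qed

text \<open>
  The constant \<open>L\<close> is chosen before the mollification. This order matters: the remainder \<open>k\<close> from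
  \<open>infinitesimal_domination\<close> has a bound \<open>M\<close> that deteriorates as the mollification radius shrinks,
  but it enters with the factor \<open>\<tau>\<close>, and \<open>\<tau> M \<le> 1\<close> for small \<open>\<tau>\<close>. Hence the ball on which \<open>L\<close> is a
  Lipschitz constant does not depend on the radius.
\<close>

lemma mollified_comparison:
  assumes f: "f \<in> Cb_infty" "f \<in> Lip_b r" and r: "0 \<le> r" and t: "0 \<le> t"
  obtains L where "0 \<le> L"
    "\<And>(e::real) x. 0 < e \<Longrightarrow> e \<le> 1 \<Longrightarrow> \<exists>(\<sigma>::real)>0. DIM('a) * \<sigma> \<le> e \<and>
      S t (mollify \<sigma> f) x \<le> mollify \<sigma> (T t f) x + (L / \<kappa> x + 1) * e * t"
proof -
  obtain c where c: "0 \<le> c"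
    "\<And>f r t. 0 \<le> r \<Longrightarrow> 0 \<le> t \<Longrightarrow> f \<in> Lip_b r \<Longrightarrow> T t f \<in> Lip_b (exp (c * t) * r)"
    using B.semigroup_Lip_b by blast
  define r' where "r' = exp (c * t) * r"
  have r': "0 \<le> r'" using r by (simp add: r'_def)
  have TL: "T s f \<in> Lip_b r'" if s: "0 \<le> s" "s \<le> t" for s
    using c(2)[OF r s(1) f(2)] unfolding r'_def
    by (rule Lip_b_mono) (use c(1) s r in \<open>auto intro!: mult_right_mono mult_left_mono\<close>)
  obtain b where b: "0 < b" "\<And>x. \<kappa> x \<le> b" using weight_bounded[OF A.weight] by blast
  define R where "R = r' * b"
  have R: "0 \<le> R" "0 \<le> R + 2" using r' b by (auto simp: R_def)
  have fC: "f \<in> Ckappa \<kappa>" by (rule Cb_infty_Ckappa[OF A.weight f(1)])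
  obtain L where L: "1 \<le> L"
    "\<And>f g s e x. 0 \<le> s \<Longrightarrow> s \<le> t \<Longrightarrow> f \<in> Ckappa_ball \<kappa> (R + 2) \<Longrightarrow> g \<in> Ckappa_ball \<kappa> (R + 2) \<Longrightarrow>
      (\<And>x. \<bar>f x - g x\<bar> * \<kappa> x \<le> e) \<Longrightarrow> \<bar>S s f x - S s g x\<bar> \<le> L * e / \<kappa> x"
    using A.semigroup_lipschitz[OF R(2) t] by blast
  obtain L1 where L1: "1 \<le> L1"
    "\<And>f g s e x. 0 \<le> s \<Longrightarrow> s \<le> t \<Longrightarrow> f \<in> Ckappa_ball \<kappa> R \<Longrightarrow> g \<in> Ckappa_ball \<kappa> R \<Longrightarrow>
      (\<And>x. \<bar>f x - g x\<bar> * \<kappa> x \<le> e) \<Longrightarrow> \<bar>T s f x - T s g x\<bar> \<le> L1 * e / \<kappa> x"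
    using B.semigroup_lipschitz[OF R(1) t] by blast
  obtain C where C: "0 \<le> C" "\<And>s x. 0 \<le> s \<Longrightarrow> s \<le> t \<Longrightarrow> \<bar>T s f x - f x\<bar> * \<kappa> x \<le> C * s"
    using B.semigroup_smooth_bound[OF f(1) t] by blast
  obtain C0 where C0: "1 \<le> C0" "\<And>x y. norm y \<le> 1 \<Longrightarrow> \<kappa> x \<le> C0 * \<kappa> (x + y)"
    using weight_translation_bound[OF A.weight] by blast
  have TR: "T s f \<in> Ckappa_ball \<kappa> R" if "0 \<le> s" "s \<le> t" for s
    unfolding R_def by (rule Lip_b_in_Ckappa_ball[OF A.weight TL[OF that] b(2)])
  have T_time: "\<bar>T (s + d) f z - T s f z\<bar> \<le> L1 * (C * d) / \<kappa> z" if "0 \<le> s" "0 \<le> d" "s + d \<le> t" for s d z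
  proof -
    have "T (s + d) f = T s (T d f)" by (rule B.sg.S2_add[OF that(1,2) fC])
    moreover have "f \<in> Ckappa_ball \<kappa> R"
      using TR[of 0] t B.sg.S2_zero[OF fC] by simp
    moreover have "\<bar>T d f y - f y\<bar> * \<kappa> y \<le> C * d" for y by (rule C(2)) (use that in auto)
    moreover have "T d f \<in> Ckappa_ball \<kappa> R" by (rule TR) (use that in auto)
    ultimately show ?thesis using L1(2)[of s "T d f" f "C * d" z] that by simp
  qed
  have "\<exists>(\<sigma>::real)>0. DIM('a) * \<sigma> \<le> e \<and>
      S t (mollify \<sigma> f) x \<le> mollify \<sigma> (T t f) x + (L / \<kappa> x + 1) * e * t"
    if e: "0 < e" "e \<le> 1" for e :: real and x
  proof -
    obtain \<delta>0 where \<delta>0: "0 < \<delta>0"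
      "\<And>(\<sigma>::real) f s y. 0 < \<sigma> \<Longrightarrow> DIM('a) * \<sigma> \<le> \<delta>0 \<Longrightarrow> 0 \<le> s \<Longrightarrow> s \<le> t \<Longrightarrow> f \<in> Lip_b r' \<Longrightarrow>
        T s (mollify \<sigma> f) y \<le> mollify \<sigma> (T s f) y + e * s / \<kappa> y"
      using B.mollify_commute[OF r' t e(1)] by blast
    define \<sigma> where "\<sigma> = min \<delta>0 e / DIM('a)"
    have \<sigma>: "0 < \<sigma>" "DIM('a) * \<sigma> \<le> \<delta>0" "DIM('a) * \<sigma> \<le> e" "DIM('a) * \<sigma> \<le> 1"
      using \<delta>0(1) e by (auto simp: \<sigma>_def)
    define u where "u s = mollify \<sigma> (T s f)" for s
    have uS: "u s \<in> Cb_infty" and uR: "u s \<in> Ckappa_ball \<kappa> R" if "0 \<le> s" "s \<le> t" for s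
      unfolding u_def R_def
      using mollify_Lip_b(1)[OF \<sigma>(1) TL[OF that]]
        mollify_Lip_b_in_Ckappa_ball[OF A.weight b(2) \<sigma>(1) TL[OF that]] by auto
    \<comment> \<open>the interpolating curve, corrected by the admitted rate of decrease\<close>
    define \<psi> where "\<psi> s = S (t - s) (u s) x + (L / \<kappa> x + 1) * e * s" for s
    have "\<psi> 0 \<le> \<psi> t"
    proof (rule le_of_local_increase[OF t])
      fix s assume s: "0 \<le> s" "s < t"
      note us = uS[OF s(1) less_imp_le[OF s(2)]]
      obtain M where M: "0 \<le> M"
        "\<And>K d. compact K \<Longrightarrow> 0 < d \<Longrightarrow> \<exists>\<delta>>0. \<forall>\<tau>. 0 < \<tau> \<and> \<tau> < \<delta> \<longrightarrow>
          (\<exists>k\<in>Ckappa_ball \<kappa> M. (\<forall>z. S \<tau> (u s) z \<le> T \<tau> (u s) z + \<tau> * k z) \<and> (\<forall>z\<in>K. \<bar>k z\<bar> \<le> d))"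
        using infinitesimal_domination[OF us] by blast
      have RM: "0 \<le> R + M" using R M by simp
      obtain K' d where K': "compact K'" "0 < d"
        "\<And>f g s y. 0 \<le> s \<Longrightarrow> s \<le> t \<Longrightarrow> f \<in> Ckappa_ball \<kappa> (R + M) \<Longrightarrow> g \<in> Ckappa_ball \<kappa> (R + M) \<Longrightarrow>
          (\<And>y. y \<in> K' \<Longrightarrow> \<bar>f y - g y\<bar> \<le> d) \<Longrightarrow> y \<in> {x} \<Longrightarrow> \<bar>S s f y - S s g y\<bar> \<le> e"
        using A.semigroup_equicontinuous[OF e(1) RM t compact_sing] by blast
      obtain \<delta>1 where \<delta>1: "0 < \<delta>1" "\<And>\<tau>. 0 < \<tau> \<Longrightarrow> \<tau> < \<delta>1 \<Longrightarrow>
          \<exists>k\<in>Ckappa_ball \<kappa> M. (\<forall>z. S \<tau> (u s) z \<le> T \<tau> (u s) z + \<tau> * k z) \<and> (\<forall>z\<in>K'. \<bar>k z\<bar> \<le> d)"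
        using M(2)[OF K'(1,2)] by blast
      \<comment> \<open>the second bound ensures \<open>\<tau> \<le> 1\<close> and \<open>\<tau> M \<le> 1\<close>\<close>
      define \<delta> where "\<delta> = min \<delta>1 (1 / (M + 1))"
      have \<delta>: "0 < \<delta>" using \<delta>1(1) M(1) by (simp add: \<delta>_def)
      have "\<psi> s \<le> \<psi> (s + \<tau>)" if \<tau>: "0 < \<tau>" "\<tau> < \<delta>" "s + \<tau> \<le> t" for \<tau>
      proof -
        have \<tau>M: "\<tau> \<le> 1" "\<tau> * M \<le> 1"
        proof -
          have "\<tau> * (M + 1) \<le> 1" using \<tau>(2) M(1) by (simp add: \<delta>_def pos_less_divide_eq)
          moreover have "0 \<le> \<tau> * M" using \<tau>(1) M(1) by simp
          ultimately show "\<tau> \<le> 1" "\<tau> * M \<le> 1" using \<tau>(1) by (simp_all add: distrib_left)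
        qed
        obtain k where k: "k \<in> Ckappa_ball \<kappa> M" "\<And>z. S \<tau> (u s) z \<le> T \<tau> (u s) z + \<tau> * k z"
          "\<And>z. z \<in> K' \<Longrightarrow> \<bar>k z\<bar> \<le> d"
          using \<delta>1(2)[of \<tau>] \<tau> by (auto simp: \<delta>_def)
        define v where "v = u (s + \<tau>)"
        have vR: "v \<in> Ckappa_ball \<kappa> R" unfolding v_def by (rule uR) (use s \<tau> in auto)
        define w where "w = (\<lambda>z. v z + \<tau> * k z)"
        have wR: "w \<in> Ckappa_ball \<kappa> (R + \<bar>\<tau>\<bar> * M)"
          unfolding w_def by (intro Ckappa_ball_add[OF A.weight] Ckappa_ball_cmult vR k)
        have wR1: "w \<in> Ckappa_ball \<kappa> (R + 2)"
          by (rule Ckappa_ball_mono[OF wR]) (use \<tau>M \<tau>(1) in simp)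
        have wR2: "(\<lambda>z. w z + e * \<tau> / \<kappa> z) \<in> Ckappa_ball \<kappa> (R + 2)"
        proof (rule Ckappa_ball_mono)
          show "(\<lambda>z. w z + e * \<tau> / \<kappa> z) \<in> Ckappa_ball \<kappa> (R + \<bar>\<tau>\<bar> * M + \<bar>e * \<tau>\<bar>)"
            by (intro Ckappa_ball_add[OF A.weight] wR Ckappa_ball_divide_weight[OF A.weight])
          have "e * \<tau> \<le> 1" using e \<tau>(1) \<tau>M by (intro mult_le_one) auto
          then show "R + \<bar>\<tau>\<bar> * M + \<bar>e * \<tau>\<bar> \<le> R + 2" using e \<tau>(1) \<tau>M by (simp add: abs_mult)
        qed
        \<comment> \<open>domination of \<open>S\<close> by \<open>T\<close>, then commutation of \<open>T\<close> with the mollification\<close>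
        have dom: "S \<tau> (u s) z \<le> w z + e * \<tau> / \<kappa> z" for z
        proof -
          have "T \<tau> (u s) z \<le> mollify \<sigma> (T \<tau> (T s f)) z + e * \<tau> / \<kappa> z"
            unfolding u_def using \<tau> s by (intro \<delta>0(2) \<sigma> TL) auto
          also have "T \<tau> (T s f) = T (s + \<tau>) f"
            using B.sg.S2_add[OF _ s(1) fC, of \<tau>] \<tau>(1) by (simp add: add.commute)
          finally show ?thesis using k(2)[of z] by (simp add: w_def v_def u_def)
        qed
        have rest: "0 \<le> t - (s + \<tau>)" "t - (s + \<tau>) \<le> t" using s \<tau> by auto
        let ?P = "S (t - (s + \<tau>))"
        have uC: "u s \<in> Ckappa \<kappa>" by (rule Cb_infty_Ckappa[OF A.weight us])
        have vC: "v \<in> Ckappa \<kappa>" by (rule Ckappa_ball_subset[OF vR])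
        have kC: "k \<in> Ckappa \<kappa>" by (rule Ckappa_ball_subset[OF k(1)])
        have "S (t - s) (u s) = ?P (S \<tau> (u s))"
          using A.sg.S2_add[OF rest(1) less_imp_le[OF \<tau>(1)] uC] by simp
        then have "S (t - s) (u s) x = ?P (S \<tau> (u s)) x" by simp
        also have "\<dots> \<le> ?P (\<lambda>z. w z + e * \<tau> / \<kappa> z) x"
          using A.sg.S1[OF rest(1)] A.sg.maps[OF less_imp_le[OF \<tau>(1)] uC] Ckappa_ball_subset[OF wR2] dom
          by (intro monotone_opD[where A = ?P and \<kappa> = \<kappa>]) auto
        also have "\<dots> \<le> ?P w x + L * (e * \<tau>) / \<kappa> x"
        proof -
          have "\<bar>w z + e * \<tau> / \<kappa> z - w z\<bar> * \<kappa> z \<le> e * \<tau>" for z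
            using e \<tau>(1) A.kappa_pos[of z] by (simp add: abs_mult)
          from L(2)[OF rest wR2 wR1 this, of x] show ?thesis by linarith
        qed
        also have "?P w x \<le> ?P v x + \<tau> * (?P (\<lambda>z. v z + k z) x - ?P v x)"
          unfolding w_def using A.sg.S1[OF rest(1)] \<tau>(1) \<tau>M
          by (intro convex_op_add_scaled[OF A.weight _ vC kC]) auto
        also have "?P (\<lambda>z. v z + k z) x - ?P v x \<le> e"
        proof -
          have "\<bar>?P (\<lambda>z. v z + k z) x - ?P v x\<bar> \<le> e"
          proof (rule K'(3)[OF rest])
            show "(\<lambda>z. v z + k z) \<in> Ckappa_ball \<kappa> (R + M)" by (rule Ckappa_ball_add[OF A.weight vR k(1)])
            show "v \<in> Ckappa_ball \<kappa> (R + M)" by (rule Ckappa_ball_mono[OF vR]) (use M in simp)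
          qed (use k(3) in auto)
          then show ?thesis by linarith
        qed
        finally have "S (t - s) (u s) x \<le> ?P v x + \<tau> * e + L * (e * \<tau>) / \<kappa> x"
          using \<tau>(1) by (simp add: mult_left_mono)
        moreover have "(L / \<kappa> x + 1) * e * (s + \<tau>) = (L / \<kappa> x + 1) * e * s + (\<tau> * e + L * (e * \<tau>) / \<kappa> x)"
          by (simp add: algebra_simps add_divide_distrib)
        ultimately show ?thesis unfolding \<psi>_def v_def by linarith
      qed
      then show "\<exists>\<delta>>0. \<forall>\<tau>. 0 < \<tau> \<and> \<tau> < \<delta> \<and> s + \<tau> \<le> t \<longrightarrow> \<psi> s \<le> \<psi> (s + \<tau>)"
        using \<delta> by blast
    next
      fix s a and X :: "nat \<Rightarrow> real"
      assume s: "0 < s" "s \<le> t" and X: "\<And>n. 0 \<le> X n" "\<And>n. X n < s" "X \<longlonglongrightarrow> s"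
        and a: "\<And>n. a \<le> \<psi> (X n)"
      define Q where "Q = L * (C0 * (L1 * C)) / \<kappa> x"
      have Xt: "X n \<le> t" for n using X(2)[of n] s by linarith
      have s0: "0 \<le> s" using s by simp
      \<comment> \<open>replacing \<open>u (X n)\<close> by the fixed function \<open>u s\<close> brings the claim into the form of (S4)\<close>
      have lower: "a - (L / \<kappa> x + 1) * e * X n - Q * (s - X n) \<le> S (t - X n) (u s) x" for n
      proof -
        have close: "\<bar>u s z - u (X n) z\<bar> * \<kappa> z \<le> C0 * (L1 * C) * (s - X n)" for z
        proof -
          have "\<bar>u s z - u (X n) z\<bar> \<le> C0 * (L1 * C) * (s - X n) / \<kappa> z"
            unfolding u_def
          proof (rule mollify_diff_le[OF \<sigma>(1)])
            show "continuous_on UNIV (T s f)" "continuous_on UNIV (T (X n) f)"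
              using TL[OF s0 s(2)] TL[OF X(1) Xt] by (auto intro: Lip_b_continuous)
            fix y :: 'a assume "norm y \<le> DIM('a) * \<sigma>"
            then have y: "norm y \<le> 1" using \<sigma>(4) by linarith
            have "\<bar>T s f (z + y) - T (X n) f (z + y)\<bar> \<le> L1 * (C * (s - X n)) / \<kappa> (z + y)"
              using T_time[of "X n" "s - X n" "z + y"] X(1,2)[of n] s by simp
            also have "\<dots> \<le> L1 * (C * (s - X n)) * (C0 / \<kappa> z)"
            proof -
              have "1 / \<kappa> (z + y) \<le> C0 / \<kappa> z"
                using C0(2)[OF y, of z] A.kappa_pos[of z] A.kappa_pos[of "z + y"] by (simp add: field_simps)
              then have "L1 * (C * (s - X n)) * (1 / \<kappa> (z + y)) \<le> L1 * (C * (s - X n)) * (C0 / \<kappa> z)"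
                using L1(1) C(1) X(2)[of n] by (intro mult_left_mono) auto
              then show ?thesis by simp
            qed
            finally show "\<bar>T s f (z + y) - T (X n) f (z + y)\<bar> \<le> C0 * (L1 * C) * (s - X n) / \<kappa> z"
              by (simp add: mult_ac)
          qed
          then show ?thesis using A.kappa_pos[of z] by (simp add: pos_le_divide_eq)
        qed
        have uR2: "u q \<in> Ckappa_ball \<kappa> (R + 2)" if "0 \<le> q" "q \<le> t" for q
          by (rule Ckappa_ball_mono[OF uR[OF that]]) simp
        have "\<bar>S (t - X n) (u s) x - S (t - X n) (u (X n)) x\<bar> \<le> L * (C0 * (L1 * C) * (s - X n)) / \<kappa> x"
          using X(1)[of n] Xt[of n] s by (intro L(2) uR2 close) auto
        also have "\<dots> = Q * (s - X n)" by (simp add: Q_def)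
        finally show ?thesis using a[of n] unfolding \<psi>_def by linarith
      qed
      have "(\<lambda>n. a - (L / \<kappa> x + 1) * e * X n - Q * (s - X n)) \<longlonglongrightarrow> a - (L / \<kappa> x + 1) * e * s - Q * (s - s)"
        by (intro tendsto_intros X(3))
      then have "(\<lambda>n. ereal (a - (L / \<kappa> x + 1) * e * X n - Q * (s - X n))) \<longlonglongrightarrow> ereal (a - (L / \<kappa> x + 1) * e * s)"
        by simp
      then have "ereal (a - (L / \<kappa> x + 1) * e * s)
          = limsup (\<lambda>n. ereal (a - (L / \<kappa> x + 1) * e * X n - Q * (s - X n)))"
        by (rule lim_imp_Limsup[OF sequentially_bot, symmetric])
      also have "\<dots> \<le> limsup (\<lambda>n. ereal (S (t - X n) (u s) x))"
        by (rule Limsup_mono) (simp add: lower always_eventually)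
      also have "\<dots> \<le> ereal (S (t - s) (u s) x)"
        using Xt s X(3) by (intro A.sg.S4 Cb_infty_Ckappa[OF A.weight uS]) (auto intro!: tendsto_intros)
      finally show "a \<le> \<psi> s" by (simp add: \<psi>_def)
    qed
    moreover have "\<psi> 0 = S t (mollify \<sigma> f) x"
      using B.sg.S2_zero[OF fC] by (simp add: \<psi>_def u_def)
    moreover have "\<psi> t = mollify \<sigma> (T t f) x + (L / \<kappa> x + 1) * e * t"
      using A.sg.S2_zero[OF Ckappa_ball_subset[OF uR[OF t order_refl]]] by (simp add: \<psi>_def u_def)
    ultimately show ?thesis using \<sigma> by metis
  qed
  moreover have "0 \<le> L" using L(1) by simp
  ultimately show ?thesis using that by blast
qed

lemma comparison_Cb_infty:
  assumes f: "f \<in> Cb_infty" and t: "0 \<le> t"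
  shows "S t f x \<le> T t f x"
proof -
  obtain r where r: "0 \<le> r" "f \<in> Lip_b r" using Cb_infty_Lip_b[OF f] by blast
  obtain L where L: "0 \<le> L"
    "\<And>(e::real) x. 0 < e \<Longrightarrow> e \<le> 1 \<Longrightarrow> \<exists>(\<sigma>::real)>0. DIM('a) * \<sigma> \<le> e \<and>
      S t (mollify \<sigma> f) x \<le> mollify \<sigma> (T t f) x + (L / \<kappa> x + 1) * e * t"
    using mollified_comparison[OF f r(2,1) t] by blast
  obtain c where c: "0 \<le> c"
    "\<And>f r t. 0 \<le> r \<Longrightarrow> 0 \<le> t \<Longrightarrow> f \<in> Lip_b r \<Longrightarrow> T t f \<in> Lip_b (exp (c * t) * r)"
    using B.semigroup_Lip_b by blast
  define r' where "r' = exp (c * t) * r"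
  have r': "0 \<le> r'" using r by (simp add: r'_def)
  have Tf: "T t f \<in> Lip_b r'" unfolding r'_def by (rule c(2)[OF r(1) t r(2)])
  obtain b where b: "0 < b" "\<And>x. \<kappa> x \<le> b" using weight_bounded[OF A.weight] by blast
  have R: "0 \<le> r * b" using r b by simp
  obtain L1 where L1: "1 \<le> L1"
    "\<And>f g s e x. 0 \<le> s \<Longrightarrow> s \<le> t \<Longrightarrow> f \<in> Ckappa_ball \<kappa> (r * b) \<Longrightarrow> g \<in> Ckappa_ball \<kappa> (r * b) \<Longrightarrow>
      (\<And>x. \<bar>f x - g x\<bar> * \<kappa> x \<le> e) \<Longrightarrow> \<bar>S s f x - S s g x\<bar> \<le> L1 * e / \<kappa> x"
    using A.semigroup_lipschitz[OF R t] by blast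
  define Q where "Q = L1 * (r * b) / \<kappa> x + r' + (L / \<kappa> x + 1) * t"
  have Q: "0 \<le> Q" using L L1 R r' t A.kappa_pos[of x] by (simp add: Q_def)
  have main: "S t f x \<le> T t f x + Q * e" if e: "0 < e" "e \<le> 1" for e :: real
  proof -
    obtain \<sigma> :: real where \<sigma>: "0 < \<sigma>" "DIM('a) * \<sigma> \<le> e"
      "S t (mollify \<sigma> f) x \<le> mollify \<sigma> (T t f) x + (L / \<kappa> x + 1) * e * t"
      using L(2)[OF e] by blast
    have "\<bar>f z - mollify \<sigma> f z\<bar> * \<kappa> z \<le> r * e * b" for z
      using mollify_Lip_b_near[OF \<sigma>(1,2) r(2,1), of z] b(2)[of z] A.kappa_pos[of z] r(1) e
      by (intro mult_mono) (auto simp: abs_minus_commute)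
    from L1(2)[OF t order_refl Lip_b_in_Ckappa_ball[OF A.weight r(2) b(2)]
        mollify_Lip_b_in_Ckappa_ball[OF A.weight b(2) \<sigma>(1) r(2)] this, of x]
    have "S t f x \<le> S t (mollify \<sigma> f) x + L1 * (r * e * b) / \<kappa> x" by linarith
    moreover have "mollify \<sigma> (T t f) x \<le> T t f x + r' * e"
      using mollify_Lip_b_near[OF \<sigma>(1,2) Tf r', of x] by linarith
    moreover have "Q * e = L1 * (r * e * b) / \<kappa> x + r' * e + (L / \<kappa> x + 1) * e * t"
      by (simp add: Q_def algebra_simps add_divide_distrib)
    ultimately show ?thesis using \<sigma>(3) by linarith
  qed
  show ?thesis
  proof (rule field_le_epsilon)
    fix d :: real assume d: "0 < d"
    define e where "e = min 1 (d / (Q + 1))"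
    have e: "0 < e" "e \<le> 1" using d Q by (auto simp: e_def)
    have "Q * e \<le> Q * (d / (Q + 1))" using Q by (intro mult_left_mono) (auto simp: e_def)
    also have "\<dots> \<le> d" using Q d by (simp add: field_simps)
    finally show "S t f x \<le> T t f x + d" using main[OF e] by linarith
  qed
qed

lemma comparison:
  assumes f: "f \<in> Ckappa \<kappa>" and t: "0 \<le> t"
  shows "S t f x \<le> T t f x"
proof (rule field_le_epsilon)
  fix e :: real assume e: "0 < e"
  then have e2: "0 < e / 2" by simp
  obtain R where R: "0 \<le> R" "f \<in> Ckappa_ball \<kappa> R" using Ckappa_obtains_ball[OF f] by blast
  obtain C where C: "1 \<le> C"
    "\<And>R f K d. 0 \<le> R \<Longrightarrow> f \<in> Ckappa_ball \<kappa> R \<Longrightarrow> compact K \<Longrightarrow> 0 < d \<Longrightarrow>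
      \<exists>g\<in>Cb_infty. g \<in> Ckappa_ball \<kappa> (C * R) \<and> (\<forall>x\<in>K. \<bar>g x - f x\<bar> \<le> d)"
    using Cb_infty_dense[OF A.weight] by blast
  have CR: "0 \<le> C * R" "R \<le> C * R" using C(1) R(1) by (auto simp: mult_le_cancel_right1)
  obtain K1 d1 where 1: "compact K1" "0 < d1"
    "\<And>f g s y. 0 \<le> s \<Longrightarrow> s \<le> t \<Longrightarrow> f \<in> Ckappa_ball \<kappa> (C * R) \<Longrightarrow> g \<in> Ckappa_ball \<kappa> (C * R) \<Longrightarrow>
      (\<And>y. y \<in> K1 \<Longrightarrow> \<bar>f y - g y\<bar> \<le> d1) \<Longrightarrow> y \<in> {x} \<Longrightarrow> \<bar>S s f y - S s g y\<bar> \<le> e / 2"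
    using A.semigroup_equicontinuous[OF e2 CR(1) t compact_sing] by blast
  obtain K2 d2 where 2: "compact K2" "0 < d2"
    "\<And>f g s y. 0 \<le> s \<Longrightarrow> s \<le> t \<Longrightarrow> f \<in> Ckappa_ball \<kappa> (C * R) \<Longrightarrow> g \<in> Ckappa_ball \<kappa> (C * R) \<Longrightarrow>
      (\<And>y. y \<in> K2 \<Longrightarrow> \<bar>f y - g y\<bar> \<le> d2) \<Longrightarrow> y \<in> {x} \<Longrightarrow> \<bar>T s f y - T s g y\<bar> \<le> e / 2"
    using B.semigroup_equicontinuous[OF e2 CR(1) t compact_sing] by blast
  have d: "0 < min d1 d2" using 1 2 by simp
  obtain g where g: "g \<in> Cb_infty" "g \<in> Ckappa_ball \<kappa> (C * R)" "\<forall>y\<in>K1 \<union> K2. \<bar>g y - f y\<bar> \<le> min d1 d2"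
    using C(2)[OF R compact_Un[OF 1(1) 2(1)] d] by blast
  have fR: "f \<in> Ckappa_ball \<kappa> (C * R)" by (rule Ckappa_ball_mono[OF R(2) CR(2)])
  have "\<bar>S t g x - S t f x\<bar> \<le> e / 2"
    by (rule 1(3)[OF t order_refl g(2) fR]) (use g(3) in auto)
  moreover have "\<bar>T t g x - T t f x\<bar> \<le> e / 2"
    by (rule 2(3)[OF t order_refl g(2) fR]) (use g(3) in auto)
  moreover have "S t g x \<le> T t g x" by (rule comparison_Cb_infty[OF g(1) t])
  ultimately show "S t f x \<le> T t f x + e" by linarith
qed

end

theorem theorem5p10:
  fixes \<kappa> :: "'a::euclidean_space \<Rightarrow> real"
    and h :: "nat \<Rightarrow> real"
    and I J S T :: "'a operators"
  assumes "weight \<kappa>"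
    and "\<And>n. 0 < h n"
    and "h \<longlonglongrightarrow> 0"
    and "assumption_A \<kappa> h I"
    and "assumption_A \<kappa> h J"
    and "\<And>f. f \<in> Cb_infty \<Longrightarrow> deriv0 \<kappa> I f \<le> deriv0 \<kappa> J f"
    and "associated \<kappa> h I S"
    and "associated \<kappa> h J T"
  shows "\<forall>t\<ge>0. \<forall>f\<in>Ckappa \<kappa>. S t f \<le> T t f"
proof -
  interpret generator_comparison \<kappa> h I J S T
  proof (intro generator_comparison.intro chernoff_semigroup.intro chernoff_scheme.intro
      chernoff_scheme_axioms.intro chernoff_semigroup_axioms.intro generator_comparison_axioms.intro)
  qed (use assms in auto)
  show ?thesis using comparison by (auto simp: le_fun_def)
qed

end
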